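(* Let $(M,I)$ be a contact manifold of dimension $2n+1$ with contact differential ideal $\mathcal I\subset\Omega^*(M)$. Then any class in $H^{n+1}(\mathcal I)$ has a unique global representative closed form $\Pi\in\mathcal I^{n+1}=\mathcal I\cap\Omega^{n+1}(M)$ satisfying $\theta\wedge\Pi=0$ for every (local) contact form $\theta\in\Gamma(I)$; equivalently, $\Pi\equiv 0 \pmod{\{I\}}$.
   Context: A contact manifold $(M,I)$ is a smooth manifold $M$ of dimension $2n+1$ with a line subbundle $I\subset T^*M$ such that any local nonvanishing section $\theta$ of $I$ (a contact form) satisfies $\theta\wedge(d\theta)^n\neq 0$. Throughout $n\ge 2$. $\mathcal I\subset\Omega^*(M)$ is the ideal of differential forms locally generated algebraically by $\theta$ and $d\theta$; it is closed under $d$, and $H^{*}(\mathcal I)$ denotes the cohomology of the complex $(\mathcal I^*,d)$, $\mathcal I^k=\mathcal I\cap\Omega^k(M)$. $\{I\}$ denotes the algebraic ideal in $\Omega^*(M)$ generated by the sections of $I$ (locally, the multiples of $\theta$). *)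

theory Defs
  imports "HOL-Analysis.Analysis" "HOL-Library.Function_Algebras"
begin

section \<open>Smooth maps between open subsets of normed spaces\<close>

text \<open>\<open>Ck k S f\<close> is meant for open \<open>S\<close>; for a Euclidean domain, continuity of all the directional
  derivatives \<open>x \<mapsto> Df(x) v\<close> is the same as continuity of \<open>Df\<close>.\<close>

primrec Ck :: "nat \<Rightarrow> 'a::real_normed_vector set \<Rightarrow> ('a \<Rightarrow> 'b::real_normed_vector) \<Rightarrow> bool" where
  "Ck 0 S f \<longleftrightarrow> continuous_on S f"
| "Ck (Suc k) S f \<longleftrightarrow>
     (\<forall>x\<in>S. f differentiable (at x)) \<and> (\<forall>v. Ck k S (\<lambda>x. frechet_derivative f (at x) v))"

definition smooth_on :: "'a::real_normed_vector set \<Rightarrow> ('a \<Rightarrow> 'b::real_normed_vector) \<Rightarrow> bool" where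
  "smooth_on S f \<longleftrightarrow> (\<forall>k. Ck k S f)"

section \<open>Smooth manifolds\<close>

text \<open>A chart is a pair of its domain and its coordinate map; only the values of the map on the
  domain matter.\<close>

type_synonym ('m, 'e) chart = "'m set \<times> ('m \<Rightarrow> 'e)"

definition chart_inv :: "('m, 'e) chart \<Rightarrow> 'e \<Rightarrow> 'm" where
  "chart_inv c = inv_into (fst c) (snd c)"

definition transition :: "('m, 'e) chart \<Rightarrow> ('m, 'e) chart \<Rightarrow> 'e \<Rightarrow> 'e" where
  "transition c c' = snd c' \<circ> chart_inv c"

definition smooth_manifold :: "'m topology \<Rightarrow> ('m, 'e::euclidean_space) chart set \<Rightarrow> bool" where
  "smooth_manifold M A \<longleftrightarrow>
     Hausdorff_space M \<and> second_countable M \<and>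
     (\<Union>c\<in>A. fst c) = topspace M \<and>
     (\<forall>c\<in>A. openin M (fst c) \<and> open (snd c ` fst c) \<and>
        homeomorphic_map (subtopology M (fst c)) (top_of_set (snd c ` fst c)) (snd c)) \<and>
     (\<forall>c\<in>A. \<forall>c'\<in>A. smooth_on (snd c ` (fst c \<inter> fst c')) (transition c c'))"

section \<open>Exterior algebra of a vector space\<close>

text \<open>An alternating \<open>k\<close>-linear form takes a sequence of vectors and only looks at the entries
  with index \<open>< k\<close>.\<close>

type_synonym 'e mform = "(nat \<Rightarrow> 'e) \<Rightarrow> real"

definition alternating :: "nat \<Rightarrow> 'e::euclidean_space mform \<Rightarrow> bool" where
  "alternating k a \<longleftrightarrow>
     (\<forall>v w. (\<forall>i<k. v i = w i) \<longrightarrow> a v = a w) \<and>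
     (\<forall>i<k. \<forall>v. linear (\<lambda>x. a (v(i := x)))) \<and>
     (\<forall>v. \<forall>i<k. \<forall>j<k. i \<noteq> j \<and> v i = v j \<longrightarrow> a v = 0)"

definition mform_wedge :: "nat \<Rightarrow> nat \<Rightarrow> 'e mform \<Rightarrow> 'e mform \<Rightarrow> 'e mform" where
  "mform_wedge k l a b = (\<lambda>v.
     (\<Sum>\<sigma> | \<sigma> permutes {..<k + l}. of_int (sign \<sigma>) * a (v \<circ> \<sigma>) * b (\<lambda>i. v (\<sigma> (k + i))))
       / (fact k * fact l))"

section \<open>Differential forms\<close>

text \<open>An element of the \<open>k\<close>-th exterior power of the cotangent space at \<open>p\<close> is given by its
  expressions in all charts of the atlas around \<open>p\<close>, which are related by pullback along the
  derivatives of the transition maps. The component at an irrelevant chart is 0, so that equality of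
  such elements is equality of functions. A differential form on an open subset \<open>U\<close> is likewise
  0 at points outside \<open>U\<close>.\<close>

type_synonym ('m, 'e) covec = "('m, 'e) chart \<Rightarrow> 'e mform"
type_synonym ('m, 'e) dform = "'m \<Rightarrow> ('m, 'e) covec"

definition ext_cotangent ::
    "('m, 'e::euclidean_space) chart set \<Rightarrow> nat \<Rightarrow> 'm \<Rightarrow> ('m, 'e) covec set" where
  "ext_cotangent A k p = {a.
     (\<forall>c. if c \<in> A \<and> p \<in> fst c then alternating k (a c) else a c = 0) \<and>
     (\<forall>c\<in>A. \<forall>c'\<in>A. p \<in> fst c \<inter> fst c' \<longrightarrow>
        (\<forall>v. a c v = a c' (\<lambda>i. frechet_derivative (transition c c') (at (snd c p)) (v i))))}"

definition forms ::
    "('m, 'e::euclidean_space) chart set \<Rightarrow> 'm set \<Rightarrow> nat \<Rightarrow> ('m, 'e) dform set" where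
  "forms A U k = {\<omega>.
     (\<forall>p. if p \<in> U then \<omega> p \<in> ext_cotangent A k p else \<omega> p = 0) \<and>
     (\<forall>c\<in>A. \<forall>v. smooth_on (snd c ` (U \<inter> fst c)) (\<lambda>x. \<omega> (chart_inv c x) c v))}"

definition restrict_form :: "'m set \<Rightarrow> ('m, 'e) dform \<Rightarrow> ('m, 'e) dform" where
  "restrict_form U \<omega> = (\<lambda>p. if p \<in> U then \<omega> p else 0)"

definition wedge :: "nat \<Rightarrow> nat \<Rightarrow> ('m, 'e) dform \<Rightarrow> ('m, 'e) dform \<Rightarrow> ('m, 'e) dform" where
  "wedge k l \<omega> \<eta> = (\<lambda>p c. mform_wedge k l (\<omega> p c) (\<eta> p c))"

text \<open>\<open>wedge_power_left k \<eta> l \<omega> m\<close> is \<open>\<eta> \<and> \<omega>\<^sup>m\<close> for a \<open>k\<close>-form \<open>\<eta>\<close> and an \<open>l\<close>-form \<open>\<omega>\<close>.\<close>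

primrec wedge_power_left ::
    "nat \<Rightarrow> ('m, 'e) dform \<Rightarrow> nat \<Rightarrow> ('m, 'e) dform \<Rightarrow> nat \<Rightarrow> ('m, 'e) dform" where
  "wedge_power_left k \<eta> l \<omega> 0 = \<eta>"
| "wedge_power_left k \<eta> l \<omega> (Suc m) = wedge (k + m * l) l (wedge_power_left k \<eta> l \<omega> m) \<omega>"

text \<open>The exterior derivative of a \<open>k\<close>-form on \<open>U\<close>, computed in each chart by
  \<open>d\<omega>(v\<^sub>0, \<dots>, v\<^sub>k) = \<Sum>\<^sub>i (-1)\<^sup>i D\<^bsub>v\<^sub>i\<^esub>(\<omega>(v\<^sub>0, \<dots>, v\<^sub>i omitted, \<dots>, v\<^sub>k))\<close>
  for constant vector fields \<open>v\<^sub>i\<close>.\<close>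

definition ext_deriv ::
    "('m, 'e::euclidean_space) chart set \<Rightarrow> 'm set \<Rightarrow> nat \<Rightarrow> ('m, 'e) dform \<Rightarrow> ('m, 'e) dform" where
  "ext_deriv A U k \<omega> = (\<lambda>p c v.
     if p \<in> U \<and> c \<in> A \<and> p \<in> fst c then
       (\<Sum>i\<le>k. (- 1) ^ i *
          frechet_derivative (\<lambda>x. \<omega> (chart_inv c x) c (\<lambda>j. if j < i then v j else v (Suc j)))
            (at (snd c p)) (v i))
     else 0)"

text \<open>The homogeneous ideal of the algebra of differential forms on \<open>U\<close> generated by a set \<open>S\<close> of
  homogeneous forms, each given with its degree; \<open>ideal_gen A U S k \<omega>\<close> says that \<open>\<omega>\<close> is in the
  degree-\<open>k\<close> part. Multiplication on one side is enough by graded commutativity.\<close>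

inductive ideal_gen ::
    "('m, 'e::euclidean_space) chart set \<Rightarrow> 'm set \<Rightarrow> (nat \<times> ('m, 'e) dform) set \<Rightarrow>
     nat \<Rightarrow> ('m, 'e) dform \<Rightarrow> bool"
  for A U S where
  zero: "ideal_gen A U S k 0"
| mult: "(j, s) \<in> S \<Longrightarrow> \<alpha> \<in> forms A U l \<Longrightarrow> ideal_gen A U S (j + l) (wedge j l s \<alpha>)"
| add: "ideal_gen A U S k \<omega> \<Longrightarrow> ideal_gen A U S k \<eta> \<Longrightarrow> ideal_gen A U S k (\<omega> + \<eta>)"

section \<open>Contact manifolds\<close>

text \<open>A line subbundle of the cotangent bundle, given by its fibres \<open>I p\<close>.\<close>

definition line_subbundle ::
    "'m topology \<Rightarrow> ('m, 'e::euclidean_space) chart set \<Rightarrow> ('m \<Rightarrow> ('m, 'e) covec set) \<Rightarrow> bool" where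
  "line_subbundle M A I \<longleftrightarrow>
     (\<forall>p\<in>topspace M. \<exists>U \<theta>. openin M U \<and> p \<in> U \<and> \<theta> \<in> forms A U 1 \<and>
        (\<forall>q\<in>U. \<theta> q \<noteq> 0 \<and> I q = {\<lambda>c v. r * \<theta> q c v | r. r \<in> UNIV}))"

definition sections ::
    "('m, 'e::euclidean_space) chart set \<Rightarrow> ('m \<Rightarrow> ('m, 'e) covec set) \<Rightarrow> 'm set \<Rightarrow>
     ('m, 'e) dform set" where
  "sections A I U = {\<theta> \<in> forms A U 1. \<forall>q\<in>U. \<theta> q \<in> I q}"

definition contact_forms ::
    "('m, 'e::euclidean_space) chart set \<Rightarrow> ('m \<Rightarrow> ('m, 'e) covec set) \<Rightarrow> 'm set \<Rightarrow>
     ('m, 'e) dform set" where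
  "contact_forms A I U = {\<theta> \<in> sections A I U. \<forall>q\<in>U. \<theta> q \<noteq> 0}"

definition contact_manifold ::
    "'m topology \<Rightarrow> ('m, 'e::euclidean_space) chart set \<Rightarrow> nat \<Rightarrow>
     ('m \<Rightarrow> ('m, 'e) covec set) \<Rightarrow> bool" where
  "contact_manifold M A n I \<longleftrightarrow>
     smooth_manifold M A \<and> DIM('e) = 2 * n + 1 \<and> line_subbundle M A I \<and>
     (\<forall>U \<theta>. openin M U \<and> \<theta> \<in> contact_forms A I U \<longrightarrow>
        (\<forall>p\<in>U. wedge_power_left 1 \<theta> 2 (ext_deriv A U 1 \<theta>) n p \<noteq> 0))"

text \<open>The degree-\<open>k\<close> part of the ideal locally generated by \<open>\<theta>\<close> and \<open>d\<theta>\<close>.\<close>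

definition contact_ideal ::
    "'m topology \<Rightarrow> ('m, 'e::euclidean_space) chart set \<Rightarrow> ('m \<Rightarrow> ('m, 'e) covec set) \<Rightarrow>
     nat \<Rightarrow> ('m, 'e) dform set" where
  "contact_ideal M A I k = {\<omega> \<in> forms A (topspace M) k.
     \<forall>p\<in>topspace M. \<exists>U \<theta>. openin M U \<and> p \<in> U \<and> \<theta> \<in> contact_forms A I U \<and>
        ideal_gen A U {(1, \<theta>), (2, ext_deriv A U 1 \<theta>)} k (restrict_form U \<omega>)}"

text \<open>The degree-\<open>k\<close> part of the ideal \<open>{I}\<close> generated by the sections of \<open>I\<close>. As for the ideal
  above, this is the space of global sections of a sheaf of ideals: the condition is local and the
  generators over a small open set \<open>U\<close> are the sections of \<open>I\<close> over \<open>U\<close>.\<close>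

definition line_ideal ::
    "'m topology \<Rightarrow> ('m, 'e::euclidean_space) chart set \<Rightarrow> ('m \<Rightarrow> ('m, 'e) covec set) \<Rightarrow>
     nat \<Rightarrow> ('m, 'e) dform set" where
  "line_ideal M A I k = {\<omega> \<in> forms A (topspace M) k.
     \<forall>p\<in>topspace M. \<exists>U. openin M U \<and> p \<in> U \<and>
        ideal_gen A U {(1, s) | s. s \<in> sections A I U} k (restrict_form U \<omega>)}"

section \<open>Cohomology of the contact ideal\<close>

definition cocycles ::
    "'m topology \<Rightarrow> ('m, 'e::euclidean_space) chart set \<Rightarrow> ('m \<Rightarrow> ('m, 'e) covec set) \<Rightarrow>
     nat \<Rightarrow> ('m, 'e) dform set" where
  "cocycles M A I k = {\<omega> \<in> contact_ideal M A I k. ext_deriv A (topspace M) k \<omega> = 0}"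

definition coboundaries ::
    "'m topology \<Rightarrow> ('m, 'e::euclidean_space) chart set \<Rightarrow> ('m \<Rightarrow> ('m, 'e) covec set) \<Rightarrow>
     nat \<Rightarrow> ('m, 'e) dform set" where
  "coboundaries M A I k =
     (case k of 0 \<Rightarrow> {0} | Suc j \<Rightarrow> ext_deriv A (topspace M) j ` contact_ideal M A I j)"

definition cohomology ::
    "'m topology \<Rightarrow> ('m, 'e::euclidean_space) chart set \<Rightarrow> ('m \<Rightarrow> ('m, 'e) covec set) \<Rightarrow>
     nat \<Rightarrow> ('m, 'e) dform set set" where
  "cohomology M A I k =
     cocycles M A I k //
       {(\<omega>, \<eta>). \<omega> \<in> cocycles M A I k \<and> \<eta> \<in> cocycles M A I k \<and> \<omega> - \<eta> \<in> coboundaries M A I k}"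

end

theory Submission
  imports Defs
begin

text \<open>Locally \<open>\<omega> = \<theta> \<and> \<alpha> + d\<theta> \<and> \<beta>\<close>, and subtracting \<open>d(\<theta> \<and> \<beta>)\<close> leaves the multiple
  \<open>\<theta> \<and> (\<alpha> + d\<beta>)\<close> of \<open>\<theta>\<close>. The Lefschetz map \<open>\<beta> \<mapsto> d\<theta> \<and> \<beta>\<close> is injective modulo \<open>\<theta>\<close> in degrees
  below \<open>n\<close>; hence \<open>\<theta> \<and> \<beta>\<close> depends on neither the decomposition nor the contact form, and these local
  corrections glue without a partition of unity. The same injectivity gives uniqueness: any
  \<open>\<phi> \<in> \<I>\<^sup>n\<close> is locally \<open>\<theta> \<and> \<delta>\<close> plus an exact form, \<open>d\<phi> = d\<theta> \<and> \<delta> - \<theta> \<and> d\<delta>\<close>, and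
  \<open>\<theta> \<and> d\<phi> = 0\<close> forces \<open>\<theta> \<and> \<delta> = 0\<close>, so that \<open>d\<phi> = 0\<close>.\<close>

text \<open>The condition \<theta> \<and> (d\<theta>)^n \<noteq> 0 is used pointwise and without a
  symplectic basis: interior products lower the degree of a form until only a scalar multiple of
  \<theta> \<and> (d\<theta>)^r is left, with r \<le> n. Degree n + 1 makes both halves work: the
  cofactor \<beta> of d\<theta> in an (n + 1)-form and the form \<delta> belonging to a primitive of
  degree n both have degree n - 1, still below n. The bound n \<ge> 2 gives the primitive a cofactor
  of d\<theta>, of degree n - 2. Forms are given by coordinate expressions, and their calculus rests
  on one device, the alternation \<open>Alt\<close> of a function that need not be alternating.
  Wedge products and d both have this shape. Associativity and the product rule come from reindexing
  permutations; d d = 0 and independence of the chart hold because the second derivatives that occur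
  are symmetric in two slots, and \<open>Alt\<close> annihilates such terms.\<close>

section \<open>Alternation and the wedge product\<close>

text \<open>No factor 1/n! is included: on an alternating form \<open>Alt n\<close> is
  multiplication by n!, and the normalisation of \<open>mform_wedge\<close> is divided out
  separately.\<close>

definition Alt :: "nat \<Rightarrow> 'e mform \<Rightarrow> 'e mform" where
  "Alt n T = (\<lambda>v. \<Sum>\<sigma> | \<sigma> permutes {..<n}. of_int (sign \<sigma>) * T (v \<circ> \<sigma>))"

definition tensor :: "nat \<Rightarrow> 'e mform \<Rightarrow> 'e mform \<Rightarrow> 'e mform" where
  "tensor k a b = (\<lambda>v. a v * b (\<lambda>i. v (k + i)))"

text \<open>The tensor product of two alternating forms is only multilinear, which is all that
  \<open>Alt\<close> requires to produce an alternating form.\<close>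

definition multilinear :: "nat \<Rightarrow> 'e::euclidean_space mform \<Rightarrow> bool" where
  "multilinear k a \<longleftrightarrow>
     (\<forall>v w. (\<forall>i<k. v i = w i) \<longrightarrow> a v = a w) \<and> (\<forall>i<k. \<forall>v. linear (\<lambda>x. a (v(i := x))))"

lemma alternating_imp_multilinear: "alternating k a \<Longrightarrow> multilinear k a"
  by (simp add: alternating_def multilinear_def)

lemma multilinear_cong: "multilinear k a \<Longrightarrow> (\<And>i. i < k \<Longrightarrow> v i = w i) \<Longrightarrow> a v = a w"
  by (simp add: multilinear_def)

lemma multilinear_linear: "multilinear k a \<Longrightarrow> i < k \<Longrightarrow> linear (\<lambda>x. a (v(i := x)))"
  by (simp add: multilinear_def)

lemmas alternating_cong = multilinear_cong[OF alternating_imp_multilinear]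
lemmas alternating_linear = multilinear_linear[OF alternating_imp_multilinear]

lemma alternating_eq_0: "alternating k a \<Longrightarrow> i < k \<Longrightarrow> j < k \<Longrightarrow> i \<noteq> j \<Longrightarrow> v i = v j \<Longrightarrow> a v = 0"
  by (simp add: alternating_def)

lemma sign_compose_permutes:
  assumes "p permutes S" "q permutes S" "finite S"
  shows "sign (p \<circ> q) = sign p * sign q"
  using assms by (meson permutation_permutes sign_compose)

lemma alternating_transpose:
  assumes a: "alternating k a" and ij: "i < k" "j < k" "i \<noteq> j"
  shows "a (v \<circ> Transposition.transpose i j) = - a v"
proof -
  define w where "w x y = v(i := x, j := y)" for x y
  have l1: "linear (\<lambda>x. a (w x y))" for y
  proof -
    have "w x y = (v(j := y))(i := x)" for x
      using ij by (auto simp: w_def)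
    then show ?thesis using alternating_linear[OF a ij(1)] by simp
  qed
  have l2: "linear (\<lambda>y. a (w x y))" for x
    unfolding w_def using alternating_linear[OF a ij(2)] by simp
  have z: "a (w x x) = 0" for x
    by (rule alternating_eq_0[OF a ij]) (use ij in \<open>auto simp: w_def\<close>)
  \<comment> \<open>Polarisation: with equal entries in both slots the left side and the two outer
    terms vanish, which leaves the two mixed terms.\<close>
  have "a (w (v i + v j) (v i + v j)) = a (w (v i) (v i)) + a (w (v i) (v j)) + (a (w (v j) (v i)) + a (w (v j) (v j)))"
    by (simp add: linear_add[OF l1] linear_add[OF l2])
  then have "a (w (v j) (v i)) = - a (w (v i) (v j))"
    by (simp add: z)
  moreover have "w (v j) (v i) = v \<circ> Transposition.transpose i j" "w (v i) (v j) = v"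
    using ij by (auto simp: w_def fun_eq_iff Transposition.transpose_def)
  ultimately show ?thesis by simp
qed

lemma alternating_permute:
  assumes a: "alternating k a" and s: "\<sigma> permutes {..<k}"
  shows "a (v \<circ> \<sigma>) = of_int (sign \<sigma>) * a v"
  using s finite_lessThan
proof (induction arbitrary: v rule: permutes_induct)
  case (swap i j p)
  have "a (v \<circ> (Transposition.transpose i j \<circ> p)) = of_int (sign p) * a (v \<circ> Transposition.transpose i j)"
    unfolding swap.IH[symmetric] comp_assoc ..
  also have "\<dots> = - of_int (sign p) * a v"
    using alternating_transpose[OF a] swap.hyps by simp
  also have "sign (Transposition.transpose i j \<circ> p) = - sign p"
    using swap.hyps sign_compose_permutes[OF permutes_swap_id, of i "{..<k}" j p]
    by (simp add: sign_swap_id)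
  ultimately show ?case by (simp only: of_int_minus)
qed simp

text \<open>Reindexing by \<open>p \<mapsto> p \<circ> q\<close> changes each sign by that of
  \<open>q\<close>.\<close>

lemma Alt_permute:
  assumes q: "q permutes {..<n}"
  shows "Alt n (\<lambda>v. T (v \<circ> q)) v = of_int (sign q) * Alt n T v"
proof -
  have "of_int (sign q) * Alt n T v =
      of_int (sign q) * (\<Sum>p | p permutes {..<n}. of_int (sign (p \<circ> q)) * T (v \<circ> (p \<circ> q)))"
    unfolding Alt_def by (subst sum_permutations_compose_right[OF q]) simp
  also have "\<dots> = (\<Sum>p | p permutes {..<n}. of_int (sign p) * T (v \<circ> p \<circ> q))"
    unfolding sum_distrib_left
  proof (intro sum.cong refl)
    fix p assume "p \<in> {p. p permutes {..<n}}"
    then have "sign (p \<circ> q) = sign p * sign q"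
      using sign_compose_permutes[OF _ q] by simp
    then have "real_of_int (sign q) * of_int (sign (p \<circ> q)) = of_int (sign p * (sign q * sign q))"
      by (simp del: sign_idempotent)
    then show "real_of_int (sign q) * (of_int (sign (p \<circ> q)) * T (v \<circ> (p \<circ> q))) = of_int (sign p) * T (v \<circ> p \<circ> q)"
      by (simp add: comp_assoc flip: mult.assoc)
  qed
  finally show ?thesis by (simp add: Alt_def comp_assoc)
qed

text \<open>\<open>Alt_permute\<close> with a transposition makes the alternation its own negative.
  In this way the second derivatives disappear from d d and from the change of coordinates.\<close>

lemma Alt_symmetric_eq_0:
  assumes "\<And>v. T (v \<circ> Transposition.transpose i j) = T v" "i < n" "j < n" "i \<noteq> j"
  shows "Alt n T v = 0"
  using Alt_permute[OF permutes_swap_id, of i n j T v] assms by (simp add: sign_swap_id)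

lemma alternating_Alt:
  assumes T: "multilinear n T"
  shows "alternating n (Alt n T)"
  unfolding alternating_def
proof (intro conjI allI impI)
  fix v w :: "nat \<Rightarrow> 'a" assume vw: "\<forall>i<n. v i = w i"
  show "Alt n T v = Alt n T w" unfolding Alt_def
  proof (intro sum.cong refl, goal_cases)
    case (1 p)
    have "T (v \<circ> p) = T (w \<circ> p)"
      by (rule multilinear_cong[OF T])
        (use vw 1 permutes_in_image[of p "{..<n}"] in \<open>auto simp: comp_def\<close>)
    then show ?case by simp
  qed
next
  fix i v assume i: "i < n"
  show "linear (\<lambda>x. Alt n T (v(i := x)))" unfolding Alt_def
  proof (intro linear_compose_sum ballI)
    fix p assume p: "p \<in> {p. p permutes {..<n}}"
    \<comment> \<open>The entry \<open>i\<close> of \<open>v\<close> is read by \<open>T\<close> at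
      position \<open>inv p i\<close>.\<close>
    have "v(i := x) \<circ> p = (v \<circ> p)(inv p i := x)" for x
      using p permutes_inverses[of p] by (auto simp: fun_eq_iff)
    moreover have "inv p i < n" using p i permutes_in_image[OF permutes_inv, of p "{..<n}"] by auto
    ultimately have "linear (\<lambda>x. T (v(i := x) \<circ> p))"
      using multilinear_linear[OF T] by simp
    then show "linear (\<lambda>x. real_of_int (sign p) * T (v(i := x) \<circ> p))"
      using linear_compose_scale_right[of "\<lambda>x. T (v(i := x) \<circ> p)" "real_of_int (sign p)"] by simp
  qed
next
  fix v :: "nat \<Rightarrow> 'a" and i j assume ij: "i < n" "j < n" "i \<noteq> j \<and> v i = v j"
  then have t: "Transposition.transpose i j permutes {..<n}" by (simp add: permutes_swap_id)
  \<comment> \<open>Composing on the left with the transposition changes no argument list but every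
    sign, so the sum is its own negative.\<close>
  have "v \<circ> Transposition.transpose i j = v" using ij by (auto simp: fun_eq_iff Transposition.transpose_def)
  then have v: "v \<circ> (Transposition.transpose i j \<circ> p) = v \<circ> p" for p
    by (simp flip: comp_assoc)
  have "Alt n T v = (\<Sum>p | p permutes {..<n}. of_int (sign (Transposition.transpose i j \<circ> p)) * T (v \<circ> (Transposition.transpose i j \<circ> p)))"
    unfolding Alt_def by (subst setum_permutations_compose_left[OF t]) simp
  also have "\<dots> = (\<Sum>p | p permutes {..<n}. - (of_int (sign p) * T (v \<circ> p)))"
    unfolding v by (intro sum.cong refl) (use ij sign_compose_permutes[OF t] in \<open>auto simp: sign_swap_id\<close>)
  finally show "Alt n T v = 0" by (simp add: sum_negf Alt_def)
qed

lemma Alt_alternating: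
  assumes a: "alternating k a"
  shows "Alt k a v = fact k * a v"
proof -
  have "Alt k a v = (\<Sum>p | p permutes {..<k}. a v)"
    unfolding Alt_def
  proof (intro sum.cong refl)
    fix p assume "p \<in> {p. p permutes {..<k}}"
    then have "of_int (sign p) * a (v \<circ> p) = of_int (sign p * sign p) * a v"
      using alternating_permute[OF a, of p v] by (simp del: sign_idempotent)
    then show "of_int (sign p) * a (v \<circ> p) = a v" by simp
  qed
  then show ?thesis by (simp add: card_permutations[of "{..<k}" k])
qed

lemma Alt_add: "Alt n (\<lambda>v. S v + T v) v = Alt n S v + Alt n T v"
  by (simp add: Alt_def ring_distribs sum.distrib)

lemma Alt_scale: "Alt n (\<lambda>v. r * T v) v = r * Alt n T v"
  by (simp add: Alt_def sum_distrib_left mult_ac)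

lemma Alt_sum: "Alt n (\<lambda>v. \<Sum>i\<in>X. T i v) v = (\<Sum>i\<in>X. Alt n (T i) v)"
  by (induction X rule: infinite_finite_induct) (simp_all add: Alt_add, simp_all add: Alt_def)

section \<open>Alternation of tensor products and associativity of the wedge product\<close>

definition shift_perm :: "nat \<Rightarrow> (nat \<Rightarrow> nat) \<Rightarrow> nat \<Rightarrow> nat" where
  "shift_perm k \<tau> = (\<lambda>i. if i < k then i else k + \<tau> (i - k))"

text \<open>The block embedding of the permutations of l letters takes transpositions to
  transpositions.\<close>

lemma shift_perm_permutes_sign:
  assumes "\<tau> permutes {..<l}"
  shows "shift_perm k \<tau> permutes {..<k + l} \<and> sign (shift_perm k \<tau>) = sign \<tau>"
  using assms finite_lessThan
proof (induction rule: permutes_induct)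
  case id
  have "shift_perm k id = id" by (auto simp: shift_perm_def fun_eq_iff)
  then show ?case by (metis permutes_id sign_id)
next
  case (swap a b p)
  have t: "Transposition.transpose (k + a) (k + b) permutes {..<k + l}" "Transposition.transpose a b permutes {..<l}"
    using swap.hyps by (auto intro!: permutes_swap_id)
  have "shift_perm k (Transposition.transpose a b \<circ> p) = Transposition.transpose (k + a) (k + b) \<circ> shift_perm k p"
    by (auto simp: shift_perm_def fun_eq_iff Transposition.transpose_def)
  moreover have p: "shift_perm k p permutes {..<k + l}" "sign (shift_perm k p) = sign p"
    using swap.IH by auto
  moreover have "sign (Transposition.transpose a b \<circ> p) = - sign p"
    "sign (Transposition.transpose (k + a) (k + b) \<circ> shift_perm k p) = - sign p"
    unfolding sign_compose_permutes[OF t(2) swap.hyps(4) finite_lessThan]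
      sign_compose_permutes[OF t(1) p(1) finite_lessThan]
    using swap.hyps p(2) by (simp_all add: sign_swap_id)
  ultimately show ?case using permutes_compose[OF p(1) t(1)] by metis
qed

text \<open>A permutation of the first k slots is also one of all k + l slots, and the outer
  alternation absorbs it together with its sign; so the k! summands of the inner \<open>Alt\<close>
  agree.\<close>

lemma Alt_tensor_Alt_left: "Alt (k + l) (tensor k (Alt k a) b) v = fact k * Alt (k + l) (tensor k a b) v"
proof -
  have "tensor k (Alt k a) b =
      (\<lambda>v. \<Sum>p | p permutes {..<k}. of_int (sign p) * tensor k a b (v \<circ> p))"
    unfolding tensor_def Alt_def fun_eq_iff sum_distrib_right
  proof (intro allI sum.cong refl)
    fix v :: "nat \<Rightarrow> 'a" and p assume "p \<in> {p. p permutes {..<k}}"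
    then have "p (k + i) = k + i" for i by (auto intro: permutes_not_in)
    then show "real_of_int (sign p) * a (v \<circ> p) * b (\<lambda>i. v (k + i)) =
         real_of_int (sign p) * (a (v \<circ> p) * b (\<lambda>i. (v \<circ> p) (k + i)))" by simp
  qed
  then have "Alt (k + l) (tensor k (Alt k a) b) v = (\<Sum>p | p permutes {..<k}.
      of_int (sign p) * Alt (k + l) (\<lambda>v. tensor k a b (v \<circ> p)) v)"
    by (simp add: Alt_sum Alt_scale)
  also have "\<dots> = (\<Sum>p | p permutes {..<k}. Alt (k + l) (tensor k a b) v)"
  proof (intro sum.cong refl)
    fix p assume "p \<in> {p. p permutes {..<k}}"
    then have "p permutes {..<k + l}" by (auto intro: permutes_subset)
    then show "of_int (sign p) * Alt (k + l) (\<lambda>v. tensor k a b (v \<circ> p)) v = Alt (k + l) (tensor k a b) v"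
      by (simp add: Alt_permute flip: mult.assoc of_int_mult)
  qed
  finally show ?thesis by (simp add: card_permutations[of "{..<k}" k])
qed

text \<open>As on the left, with the permutations of the last l slots embedded by
  \<open>shift_perm\<close>. They move entries that \<open>a\<close> must not look at, hence the
  hypothesis on \<open>a\<close>.\<close>

lemma Alt_tensor_Alt_right: 
  assumes a: "multilinear k a"
  shows "Alt (k + l) (tensor k a (Alt l b)) v = fact l * Alt (k + l) (tensor k a b) v"
proof -
  have "tensor k a (Alt l b) =
      (\<lambda>v. \<Sum>p | p permutes {..<l}. of_int (sign p) * tensor k a b (v \<circ> shift_perm k p))"
    unfolding tensor_def Alt_def fun_eq_iff sum_distrib_left
  proof (intro allI sum.cong refl)
    fix v :: "nat \<Rightarrow> 'a" and p assume "p \<in> {p. p permutes {..<l}}"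
    have "a (v \<circ> shift_perm k p) = a v"
      by (rule multilinear_cong[OF a]) (simp add: shift_perm_def)
    then show "a v * (real_of_int (sign p) * b ((\<lambda>i. v (k + i)) \<circ> p)) =
         real_of_int (sign p) * (a (v \<circ> shift_perm k p) * b (\<lambda>i. (v \<circ> shift_perm k p) (k + i)))"
      by (simp add: shift_perm_def comp_def)
  qed
  then have "Alt (k + l) (tensor k a (Alt l b)) v = (\<Sum>p | p permutes {..<l}.
      of_int (sign p) * Alt (k + l) (\<lambda>v. tensor k a b (v \<circ> shift_perm k p)) v)"
    by (simp add: Alt_sum Alt_scale)
  also have "\<dots> = (\<Sum>p | p permutes {..<l}. Alt (k + l) (tensor k a b) v)"
  proof (intro sum.cong refl)
    fix p assume "p \<in> {p. p permutes {..<l}}"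
    then have "shift_perm k p permutes {..<k + l}" "sign (shift_perm k p) = sign p" 
      using shift_perm_permutes_sign by auto
    then show "of_int (sign p) * Alt (k + l) (\<lambda>v. tensor k a b (v \<circ> shift_perm k p)) v = Alt (k + l) (tensor k a b) v"
      by (simp add: Alt_permute flip: mult.assoc of_int_mult)
  qed
  finally show ?thesis by (simp add: card_permutations[of "{..<l}" l])
qed

lemma mform_wedge_eq_Alt:
  "mform_wedge k l a b v = Alt (k + l) (tensor k a b) v / (fact k * fact l)"
  by (simp add: mform_wedge_def Alt_def tensor_def comp_def mult.assoc)

lemma multilinear_tensor:
  assumes a: "multilinear k a" and b: "multilinear l b"
  shows "multilinear (k + l) (tensor k a b)"
  unfolding multilinear_def
proof (intro conjI allI impI)
  fix v w :: "nat \<Rightarrow> 'a" assume vw: "\<forall>i<k + l. v i = w i"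
  then have "a v = a w" "b (\<lambda>i. v (k + i)) = b (\<lambda>i. w (k + i))"
    by (auto intro: multilinear_cong[OF a] multilinear_cong[OF b])
  then show "tensor k a b v = tensor k a b w" by (simp add: tensor_def)
next
  fix i v assume i: "i < k + l"
  show "linear (\<lambda>x. tensor k a b (v(i := x)))"
  proof (cases "i < k")
    case True
    then have "tensor k a b (v(i := x)) = b (\<lambda>i. v (k + i)) *\<^sub>R a (v(i := x))" for x
      by (simp add: tensor_def)
    then show ?thesis using linear_compose_scale_right[OF multilinear_linear[OF a True]] by simp
  next
    case False
    have "(\<lambda>j. (v(i := x)) (k + j)) = (\<lambda>j. v (k + j))(i - k := x)" for x
      using False by (auto simp: fun_eq_iff)
    moreover have "a (v(i := x)) = a v" for x
      by (rule multilinear_cong[OF a]) (use False in auto)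
    ultimately have "tensor k a b (v(i := x)) = a v *\<^sub>R b ((\<lambda>j. v (k + j))(i - k := x))" for x
      by (simp add: tensor_def)
    moreover have "i - k < l" using False i by simp
    ultimately show ?thesis using linear_compose_scale_right[OF multilinear_linear[OF b]] by simp
  qed
qed

lemma alternatingI:
  assumes "\<And>v w. (\<And>i. i < k \<Longrightarrow> v i = w i) \<Longrightarrow> a v = a w"
    and "\<And>i v. i < k \<Longrightarrow> linear (\<lambda>x. a (v(i := x)))"
    and "\<And>i j v. i < k \<Longrightarrow> j < k \<Longrightarrow> i \<noteq> j \<Longrightarrow> v i = v j \<Longrightarrow> a v = 0"
  shows "alternating k a"
  unfolding alternating_def
proof (intro conjI allI impI)
  show "a v = a w" if "\<forall>i<k. v i = w i" for v w using assms(1) that by blast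
qed (use assms(2,3) in auto)

lemma alternating_add:
  assumes a: "alternating k a" and b: "alternating k b"
  shows "alternating k (\<lambda>v. a v + b v)"
proof (rule alternatingI)
  show "a v + b v = a w + b w" if "\<And>i. i < k \<Longrightarrow> v i = w i" for v w
    using alternating_cong[OF a, of v w] alternating_cong[OF b, of v w] that by simp
  show "linear (\<lambda>x. a (v(i := x)) + b (v(i := x)))" if "i < k" for i v
    using alternating_linear[OF a that] alternating_linear[OF b that] by (rule linear_compose_add)
  show "a v + b v = 0" if "i < k" "j < k" "i \<noteq> j" "v i = v j" for i j v
    using alternating_eq_0[OF a that] alternating_eq_0[OF b that] by simp
qed

lemma alternating_scale:
  assumes a: "alternating k a"
  shows "alternating k (\<lambda>v. r * a v)"
proof (rule alternatingI)
  show "r * a v = r * a w" if "\<And>i. i < k \<Longrightarrow> v i = w i" for v w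
    using alternating_cong[OF a, of v w] that by simp
  show "linear (\<lambda>x. r * a (v(i := x)))" if "i < k" for i v
    using linear_compose_scale_right[OF alternating_linear[OF a that], of r v] by simp
  show "r * a v = 0" if "i < k" "j < k" "i \<noteq> j" "v i = v j" for i j v
    using alternating_eq_0[OF a that] by simp
qed

lemma alternating_0: "alternating k (\<lambda>v. 0)"
  by (simp add: alternating_def linear_zero)

lemma alternating_mform_wedge:
  assumes "alternating k a" "alternating l b"
  shows "alternating (k + l) (mform_wedge k l a b)"
proof -
  have "mform_wedge k l a b = (\<lambda>v. (1 / (fact k * fact l)) * Alt (k + l) (tensor k a b) v)"
    by (simp add: mform_wedge_eq_Alt fun_eq_iff)
  then show ?thesis
    using assms by (simp only:) (intro alternating_scale alternating_Alt multilinear_tensor alternating_imp_multilinear)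
qed

lemma tensor_assoc: "tensor (k + l) (tensor k a b) c = tensor k a (tensor l b c)"
  by (simp add: tensor_def fun_eq_iff add.assoc mult.assoc)

text \<open>Both sides are \<open>Alt\<close> of the triple tensor product, divided by k! l!
  m!.\<close>

lemma mform_wedge_assoc:
  assumes a: "multilinear k a"
  shows "mform_wedge (k + l) m (mform_wedge k l a b) c = mform_wedge k (l + m) a (mform_wedge l m b c)"
proof
  fix v
  have "tensor (k + l) (mform_wedge k l a b) c =
      (\<lambda>v. (1 / (fact k * fact l)) * tensor (k + l) (Alt (k + l) (tensor k a b)) c v)"
    by (simp add: tensor_def mform_wedge_eq_Alt fun_eq_iff)
  then have 1: "mform_wedge (k + l) m (mform_wedge k l a b) c v =
     Alt (k + l + m) (tensor (k + l) (tensor k a b) c) v / (fact k * fact l * fact m)"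
    unfolding mform_wedge_eq_Alt[of "k + l"] by (simp only: Alt_scale Alt_tensor_Alt_left) simp
  have "tensor k a (mform_wedge l m b c) =
      (\<lambda>v. (1 / (fact l * fact m)) * tensor k a (Alt (l + m) (tensor l b c)) v)"
    by (simp add: tensor_def mform_wedge_eq_Alt fun_eq_iff)
  then have 2: "mform_wedge k (l + m) a (mform_wedge l m b c) v =
     Alt (k + (l + m)) (tensor k a (tensor l b c)) v / (fact k * fact l * fact m)"
    unfolding mform_wedge_eq_Alt[of k "l + m"] by (simp only: Alt_scale Alt_tensor_Alt_right[OF a]) simp
  show "mform_wedge (k + l) m (mform_wedge k l a b) c v = mform_wedge k (l + m) a (mform_wedge l m b c) v"
    unfolding 1 2 tensor_assoc by (simp add: add.assoc)
qed

lemma mform_wedge_add_left: "mform_wedge k l (\<lambda>v. a v + a' v) b v = mform_wedge k l a b v + mform_wedge k l a' b v"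
  and mform_wedge_add_right: "mform_wedge k l a (\<lambda>v. b v + b' v) v = mform_wedge k l a b v + mform_wedge k l a b' v"
  and mform_wedge_diff_right: "mform_wedge k l a (\<lambda>v. b v - b' v) v = mform_wedge k l a b v - mform_wedge k l a b' v"
  and mform_wedge_scale_left: "mform_wedge k l (\<lambda>v. r * a v) b v = r * mform_wedge k l a b v"
  and mform_wedge_scale_right: "mform_wedge k l a (\<lambda>v. r * b v) v = r * mform_wedge k l a b v"
  and mform_wedge_minus_right: "mform_wedge k l a (\<lambda>v. - b v) v = - mform_wedge k l a b v"
  and mform_wedge_0_left: "mform_wedge k l (\<lambda>v. 0) b v = 0"
  and mform_wedge_0_right: "mform_wedge k l a (\<lambda>v. 0) v = 0"
proof -
  \<comment> \<open>Differences, negatives and zero are written through multiples, so that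
    \<open>Alt_add\<close> and \<open>Alt_scale\<close> cover all cases.\<close>
  have l: "tensor k (\<lambda>v. a v + a' v) b = (\<lambda>v. tensor k a b v + tensor k a' b v)"
    "tensor k (\<lambda>v. r * a v) b = (\<lambda>v. r * tensor k a b v)"
    "tensor k (\<lambda>v. 0) b = (\<lambda>v. 0 * tensor k a b v)" for a a' b :: "'a mform"
    by (simp_all add: tensor_def fun_eq_iff ring_distribs)
  have r: "tensor k a (\<lambda>v. b v + b' v) = (\<lambda>v. tensor k a b v + tensor k a b' v)"
    "tensor k a (\<lambda>v. b v - b' v) = (\<lambda>v. tensor k a b v + (- 1) * tensor k a b' v)"
    "tensor k a (\<lambda>v. r * b v) = (\<lambda>v. r * tensor k a b v)"
    "tensor k a (\<lambda>v. - b v) = (\<lambda>v. (- 1) * tensor k a b v)"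
    "tensor k a (\<lambda>v. 0) = (\<lambda>v. 0 * tensor k a b v)" for a b b' :: "'a mform"
    by (simp_all add: tensor_def fun_eq_iff ring_distribs)
  show "mform_wedge k l (\<lambda>v. a v + a' v) b v = mform_wedge k l a b v + mform_wedge k l a' b v"
    "mform_wedge k l (\<lambda>v. r * a v) b v = r * mform_wedge k l a b v"
    "mform_wedge k l (\<lambda>v. 0) b v = 0"
    unfolding mform_wedge_eq_Alt l(1,2) l(3)[where a = a] Alt_add Alt_scale by (simp_all add: add_divide_distrib)
  show "mform_wedge k l a (\<lambda>v. b v + b' v) v = mform_wedge k l a b v + mform_wedge k l a b' v"
    "mform_wedge k l a (\<lambda>v. b v - b' v) v = mform_wedge k l a b v - mform_wedge k l a b' v"
    "mform_wedge k l a (\<lambda>v. r * b v) v = r * mform_wedge k l a b v"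
    "mform_wedge k l a (\<lambda>v. - b v) v = - mform_wedge k l a b v"
    "mform_wedge k l a (\<lambda>v. 0) v = 0"
    unfolding mform_wedge_eq_Alt r(1,2,3,4) r(5)[where b = b] Alt_add Alt_scale
    by (simp_all add: add_divide_distrib diff_divide_distrib)
qed

lemma mform_wedge_sum_left: "mform_wedge k l (\<lambda>v. \<Sum>i\<in>X. a i v) b v = (\<Sum>i\<in>X. mform_wedge k l (a i) b v)"
  by (induction X rule: infinite_finite_induct) (simp_all add: mform_wedge_add_left mform_wedge_0_left)

section \<open>Expansion along the first argument\<close>

definition omit :: "nat \<Rightarrow> (nat \<Rightarrow> 'e) \<Rightarrow> nat \<Rightarrow> 'e" where
  "omit i v = (\<lambda>j. if j < i then v j else v (Suc j))"

text \<open>\<open>v \<circ> cyc b\<close> lists \<open>v b\<close> first and then the entries of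
  \<open>omit b v\<close>. As a product of \<open>b\<close> adjacent transpositions,
  \<open>cyc b\<close> has sign \<open>(- 1) ^ b\<close>, the sign in cofactor expansions.\<close>

primrec cyc :: "nat \<Rightarrow> nat \<Rightarrow> nat" where
  "cyc 0 = id"
| "cyc (Suc b) = Transposition.transpose b (Suc b) \<circ> cyc b"

lemma cyc_eq: "cyc b j = (if j = 0 then b else if j \<le> b then j - 1 else j)"
  by (induction b) (auto simp: Transposition.transpose_def)

lemma cyc_permutes_sign: "b \<le> k \<Longrightarrow> cyc b permutes {..<Suc k} \<and> sign (cyc b) = (- 1) ^ b"
proof (induction b)
  case (Suc b)
  have t: "Transposition.transpose b (Suc b) permutes {..<Suc k}" using Suc by (auto intro!: permutes_swap_id)
  have c: "cyc b permutes {..<Suc k}" "sign (cyc b) = (- 1) ^ b" using Suc by auto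
  show ?case unfolding cyc.simps
    using sign_compose_permutes[OF t c(1)] permutes_compose[OF c(1) t] c(2)
    by (simp only: sign_swap_id power_Suc) (simp del: o_apply add: comp_def)
qed (simp only: cyc.simps permutes_id sign_id power_0 simp_thms)

text \<open>Such a \<open>q\<close> is \<open>shift_perm 1\<close> of a permutation of the tail,
  with the same sign.\<close>

lemma alternating_permute_tail:
  assumes a: "alternating k a" and q: "q permutes {..<Suc k}" "q 0 = 0"
  shows "a (v \<circ> q \<circ> Suc) = of_int (sign q) * a (v \<circ> Suc)"
proof -
  define t where "t = (\<lambda>j. q (Suc j) - 1)"
  have q0: "q j \<noteq> 0" if "j \<noteq> 0" for j using that q permutes_inj[OF q(1)] by (metis injD)
  have qt: "q = shift_perm 1 t"
    using q(2) q0 by (auto simp: shift_perm_def t_def fun_eq_iff)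
  have "inj t"
  proof (rule injI)
    fix x y assume "t x = t y"
    then have "q (Suc x) = q (Suc y)"
      using q0[of "Suc x"] q0[of "Suc y"] by (simp add: t_def)
    then show "x = y" using permutes_inj[OF q(1)] by (auto dest: injD)
  qed
  moreover have "t x \<in> {..<k}" if "x \<in> {..<k}" for x
    using permutes_in_image[OF q(1), of "Suc x"] that q0[of "Suc x"] by (auto simp: t_def)
  moreover have "t x = x" if "x \<notin> {..<k}" for x
    using permutes_not_in[OF q(1), of "Suc x"] that by (auto simp: t_def)
  ultimately have t: "t permutes {..<k}"
    by (intro inj_imp_permutes) (auto intro: inj_on_subset)
  have "v \<circ> q \<circ> Suc = v \<circ> Suc \<circ> t" by (auto simp: fun_eq_iff qt shift_perm_def)
  then show ?thesis using alternating_permute[OF a t] shift_perm_permutes_sign[OF t, of 1] qt by simp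
qed

text \<open>Both the wedge product with a 1-form and the exterior derivative have the right-hand side of
  this shape.\<close>

lemma Alt_head_tail:
  assumes F: "\<And>x. alternating k (F x)"
  shows "Alt (Suc k) (\<lambda>v. F (v 0) (v \<circ> Suc)) v = fact k * (\<Sum>i\<le>k. (- 1) ^ i * F (v i) (omit i v))"
proof -
  define g where "g i = (- 1) ^ i * F (v i) (omit i v)" for i
  have *: "of_int (sign p) * F ((v \<circ> p) 0) (v \<circ> p \<circ> Suc) = g (p 0)" if p: "p permutes {..<Suc k}" for p
  proof -
    define b where "b = p 0"
    have "b \<le> k" using permutes_in_image[OF p, of 0] by (simp add: b_def)
    note c = cyc_permutes_sign[OF this]
    \<comment> \<open>\<open>p\<close> is split into the cycle that takes 0 to
      \<open>b = p 0\<close> and a permutation of the tail.\<close>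
    define q where "q = inv (cyc b) \<circ> p"
    have q: "q permutes {..<Suc k}" using c p by (auto simp: q_def intro: permutes_compose permutes_inv)
    have pq: "p = cyc b \<circ> q" using c by (auto simp: q_def fun_eq_iff permutes_inverses)
    have "cyc b 0 = b" by (simp add: cyc_eq)
    then have "q 0 = 0" using c by (metis q_def b_def comp_apply permutes_inverses(2))
    then have "F (v b) (v \<circ> p \<circ> Suc) = of_int (sign q) * F (v b) (v \<circ> cyc b \<circ> Suc)"
      using alternating_permute_tail[OF F q, of "v b" "v \<circ> cyc b"] by (simp add: pq comp_assoc)
    moreover have "v \<circ> cyc b \<circ> Suc = omit b v" by (auto simp: fun_eq_iff cyc_eq omit_def)
    moreover have "sign p = (-1) ^ b * sign q"
      using sign_compose_permutes[OF _ q] c pq by auto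
    ultimately have "of_int (sign p) * F ((v \<circ> p) 0) (v \<circ> p \<circ> Suc) =
        (-1) ^ b * of_int (sign q * sign q) * F (v b) (omit b v)"
      by (simp add: b_def[symmetric] del: sign_idempotent)
    then show ?thesis by (simp add: g_def b_def)
  qed
  have ins: "{..<Suc k} = insert 0 {1..<Suc k}" by auto
  have "Alt (Suc k) (\<lambda>v. F (v 0) (v \<circ> Suc)) v = (\<Sum>p | p permutes {..<Suc k}. g (p 0))"
    unfolding Alt_def by (intro sum.cong refl) (use * in auto)
  \<comment> \<open>The permutations are sorted by their value at 0; each value is taken by k! of
    them.\<close>
  also have "\<dots> = (\<Sum>b<Suc k. \<Sum>q | q permutes {1..<Suc k}. g ((Transposition.transpose 0 b \<circ> q) 0))"
    unfolding ins by (subst sum_over_permutations_insert) auto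
  also have "\<dots> = (\<Sum>b<Suc k. \<Sum>q | q permutes {1..<Suc k}. g b)"
    by (intro sum.cong refl) (auto simp: permutes_not_in)
  also have "\<dots> = (\<Sum>b<Suc k. fact k * g b)"
    by (simp add: card_permutations[of "{Suc 0..<Suc k}" k])
  finally show ?thesis by (simp add: g_def sum_distrib_left lessThan_Suc_atMost)
qed

section \<open>Interior products and the Lefschetz map\<close>

definition contract :: "'e \<Rightarrow> 'e mform \<Rightarrow> 'e mform" where
  "contract x a = (\<lambda>v. a (case_nat x v))"

lemma alternating_contract:
  assumes a: "alternating (Suc k) a"
  shows "alternating k (contract x a)"
  unfolding contract_def
proof (rule alternatingI)
  show "a (case_nat x v) = a (case_nat x w)" if "\<And>i. i < k \<Longrightarrow> v i = w i" for v w
    by (rule alternating_cong[OF a]) (use that in \<open>auto split: nat.split\<close>)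
  show "linear (\<lambda>y. a (case_nat x (v(i := y))))" if "i < k" for i v
  proof -
    have "case_nat x (v(i := y)) = (case_nat x v)(Suc i := y)" for y
      by (auto simp: fun_eq_iff split: nat.split)
    then show ?thesis using alternating_linear[OF a, of "Suc i"] that by simp
  qed
  show "a (case_nat x v) = 0" if "i < k" "j < k" "i \<noteq> j" "v i = v j" for i j v
    by (rule alternating_eq_0[OF a, of "Suc i" "Suc j"]) (use that in auto)
qed

text \<open>A single vector is passed to the 1-form as a constant sequence, of which only entry 0
  counts. The factorial in \<open>Alt_head_tail\<close> cancels against the normalisation of the
  wedge product.\<close>

lemma mform_wedge_1:
  assumes a: "multilinear 1 a" and b: "alternating l b"
  shows "mform_wedge 1 l a b v = (\<Sum>i\<le>l. (- 1) ^ i * (a (\<lambda>_. v i) * b (omit i v)))"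
proof -
  have "tensor 1 a b = (\<lambda>v. a (\<lambda>_. v 0) * b (v \<circ> Suc))"
  proof
    fix v show "tensor 1 a b v = a (\<lambda>_. v 0) * b (v \<circ> Suc)"
      using multilinear_cong[OF a, of v "\<lambda>_. v 0"] by (simp add: tensor_def comp_def)
  qed
  then show ?thesis
    using Alt_head_tail[of l "\<lambda>x v. a (\<lambda>_. x) * b v" v] alternating_scale[OF b]
    by (simp add: mform_wedge_eq_Alt del: fact_Suc)
qed

lemma omit_case_nat: "omit 0 (case_nat x v) = v" "omit (Suc i) (case_nat x v) = case_nat x (omit i v)"
  by (auto simp: omit_def fun_eq_iff split: nat.split)

text \<open>Interior products are antiderivations. Term 0 of the expansion reads \<open>a\<close> at
  \<open>x\<close>; in the others \<open>x\<close> stays the first argument of \<open>b\<close>, and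
  the index shift reverses their signs.\<close>

lemma contract_wedge_1:
  assumes a: "multilinear 1 a" and b: "alternating (Suc l) b"
  shows "contract x (mform_wedge 1 (Suc l) a b) v = a (\<lambda>_. x) * b v - mform_wedge 1 l a (contract x b) v"
  unfolding contract_def[of x "mform_wedge 1 (Suc l) a b"] mform_wedge_1[OF a b]
    mform_wedge_1[OF a alternating_contract[OF b]] sum.atMost_Suc_shift
  by (simp add: omit_case_nat contract_def sum_negf)

lemma wedge_1_1_anticommute:
  assumes "alternating 1 a" "alternating 1 b"
  shows "mform_wedge 1 1 a b v = - mform_wedge 1 1 b a v"
proof -
  have om: "c (omit i v) = c (\<lambda>_. omit i v 0)" if "alternating 1 c" for c i and v :: "nat \<Rightarrow> 'a"
    by (rule alternating_cong[OF that]) simp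
  show ?thesis
    unfolding mform_wedge_1[OF alternating_imp_multilinear[OF assms(1)] assms(2)]
      mform_wedge_1[OF alternating_imp_multilinear[OF assms(2)] assms(1)] om[OF assms(1)] om[OF assms(2)]
    by (simp add: omit_def)
qed

text \<open>Associativity brings \<open>a\<close> and \<open>b\<close> together, where
  \<open>wedge_1_1_anticommute\<close> exchanges them.\<close>

lemma wedge_1_anticommute:
  assumes a: "alternating 1 a" and b: "alternating 1 b"
  shows "mform_wedge 1 (Suc k) a (mform_wedge 1 k b c) v = - mform_wedge 1 (Suc k) b (mform_wedge 1 k a c) v"
proof -
  note assoc = mform_wedge_assoc[where k = 1 and l = 1 and m = k and c = c, simplified plus_1_eq_Suc]
  have "mform_wedge 1 1 a b = (\<lambda>v. (- 1) * mform_wedge 1 1 b a v)"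
    using wedge_1_1_anticommute[OF a b] by (simp add: fun_eq_iff)
  then show ?thesis
    unfolding assoc[OF alternating_imp_multilinear[OF a], symmetric]
      assoc[OF alternating_imp_multilinear[OF b], symmetric]
    by (simp only: mform_wedge_scale_left)
qed

lemma wedge_1_self:
  assumes a: "alternating 1 a"
  shows "mform_wedge 1 (Suc k) a (mform_wedge 1 k a c) v = 0"
  using wedge_1_anticommute[OF a a, of k c v] by simp

definition dual :: "'e::euclidean_space \<Rightarrow> 'e mform" where
  "dual e = (\<lambda>v. v 0 \<bullet> e)"

lemma alternating_dual: "alternating 1 (dual e)"
  unfolding dual_def
  by (rule alternatingI) (auto simp: linear_iff inner_left_distrib)

lemma linear_euclidean_sum:
  fixes f :: "'e::euclidean_space \<Rightarrow> real"
  assumes "linear f"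
  shows "(\<Sum>b\<in>Basis. (x \<bullet> b) * f b) = f x"
  using linear_sum[OF assms, of "\<lambda>b. (x \<bullet> b) *\<^sub>R b" Basis] linear_scale[OF assms]
  by (simp add: euclidean_representation)

lemma alternating_linear_const:
  assumes a: "alternating 1 a"
  shows "linear (\<lambda>x. a (\<lambda>_. x))"
proof -
  have "a (\<lambda>_. x) = a ((\<lambda>_. 0)(0 := x))" for x
    by (rule alternating_cong[OF a]) simp
  then show ?thesis using alternating_linear[OF a, of 0 "\<lambda>_. 0"] by simp
qed

text \<open>This reduces the wedge product with a 2-form to wedge products with 1-forms.\<close>

lemma two_form_decomposition:
  assumes w: "alternating 2 w"
  shows "w = (\<lambda>v. \<Sum>b\<in>Basis. (1 / 2) * mform_wedge 1 1 (dual b) (contract b w) v)"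
proof
  fix v
  have w1: "alternating 1 (contract b w)" for b using alternating_contract[of 1 w] w by (simp add: numeral_2_eq_2)
  have lin: "linear (\<lambda>b. contract b w u)" for u
  proof -
    have "contract b w u = w ((case_nat 0 u)(0 := b))" for b
      by (auto simp: contract_def intro!: arg_cong[where f = w] split: nat.split)
    then show ?thesis using alternating_linear[OF w, of 0] by simp
  qed
  have sw: "contract (v 1) w (\<lambda>_. v 0) = - w v"
  proof -
    have "contract (v 1) w (\<lambda>_. v 0) = w (v \<circ> Transposition.transpose 0 1)"
      unfolding contract_def by (rule alternating_cong[OF w]) (auto simp: less_2_cases_iff)
    then show ?thesis using alternating_transpose[OF w, of 0 1 v] by simp
  qed
  have nsw: "contract (v 0) w (\<lambda>_. v 1) = w v"
    unfolding contract_def by (rule alternating_cong[OF w]) (auto simp: less_2_cases_iff)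
  have om: "contract b w (omit i v) = contract b w (\<lambda>_. omit i v 0)" for b i
    by (rule alternating_cong[OF w1]) simp
  have e: "mform_wedge 1 1 (dual b) (contract b w) v =
      (v 0 \<bullet> b) * contract b w (\<lambda>_. v 1) - (v 1 \<bullet> b) * contract b w (\<lambda>_. v 0)" for b
    unfolding mform_wedge_1[OF alternating_imp_multilinear[OF alternating_dual] w1]
    by (simp add: dual_def om) (simp add: omit_def)
  \<comment> \<open>Summed over the basis, the two parts of \<open>e\<close> give \<open>w v\<close>
    each, since \<open>w\<close> changes sign when its arguments are exchanged; this accounts for
    the 1/2.\<close>
  show "w v = (\<Sum>b\<in>Basis. (1 / 2) * mform_wedge 1 1 (dual b) (contract b w) v)"
    unfolding e sum_distrib_left[symmetric] sum_subtractf linear_euclidean_sum[OF lin] sw nsw by simp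
qed

lemma mform_wedge_2:
  assumes w: "alternating 2 w"
  shows "mform_wedge 2 k w c v =
    (\<Sum>b\<in>Basis. (1 / 2) * mform_wedge 1 (Suc k) (dual b) (mform_wedge 1 k (contract b w) c) v)"
proof -
  have "mform_wedge 2 k w c v =
    (\<Sum>b\<in>Basis. (1 / 2) * mform_wedge 2 k (mform_wedge 1 1 (dual b) (contract b w)) c v)"
    by (subst two_form_decomposition[OF w]) (simp only: mform_wedge_sum_left mform_wedge_scale_left)
  then show ?thesis
    using mform_wedge_assoc[OF alternating_imp_multilinear[OF alternating_dual], where l = 1 and m = k and c = c]
    by (simp only: plus_1_eq_Suc Suc_1)
qed

lemma mform_wedge_sum_right: "mform_wedge k l a (\<lambda>v. \<Sum>i\<in>X. b i v) v = (\<Sum>i\<in>X. mform_wedge k l a (b i) v)"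
  by (induction X rule: infinite_finite_induct) (simp_all add: mform_wedge_add_right mform_wedge_0_right)

lemma alternating_wedge_1:
  "alternating 1 a \<Longrightarrow> alternating k b \<Longrightarrow> alternating (Suc k) (mform_wedge 1 k a b)"
  using alternating_mform_wedge[of 1 a k b] by simp

lemma alternating_wedge_2:
  "alternating 2 a \<Longrightarrow> alternating k b \<Longrightarrow> alternating (Suc (Suc k)) (mform_wedge 2 k a b)"
  using alternating_mform_wedge[of 2 a k b] by simp

text \<open>With \<open>w\<close> written through products of two 1-forms, \<open>a\<close> has to
  pass two factors, and the two signs cancel.\<close>

lemma wedge_1_2_commute:
  assumes a: "alternating 1 a" and w: "alternating 2 w"
  shows "mform_wedge 1 (Suc (Suc k)) a (mform_wedge 2 k w c) v = mform_wedge 2 (Suc k) w (mform_wedge 1 k a c) v"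
proof -
  have w1: "alternating 1 (contract b w)" for b using alternating_contract[of 1 w] w by (simp add: numeral_2_eq_2)
  have "mform_wedge 1 (Suc (Suc k)) a (mform_wedge 1 (Suc k) (dual b) (mform_wedge 1 k (contract b w) c)) v
     = mform_wedge 1 (Suc (Suc k)) (dual b) (mform_wedge 1 (Suc k) (contract b w) (mform_wedge 1 k a c)) v" for b
  proof -
    have "mform_wedge 1 (Suc k) a (mform_wedge 1 k (contract b w) c) =
       (\<lambda>v. - mform_wedge 1 (Suc k) (contract b w) (mform_wedge 1 k a c) v)"
      using wedge_1_anticommute[OF a w1] by (simp add: fun_eq_iff)
    then show ?thesis
      unfolding wedge_1_anticommute[OF a alternating_dual] by (simp add: mform_wedge_minus_right)
  qed
  then show ?thesis
    unfolding mform_wedge_2[OF w] mform_wedge_sum_right mform_wedge_scale_right by simp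
qed

text \<open>A 2-form is even, so no sign appears. Summed over the basis, contracting the factor
  \<open>dual b\<close> and contracting the factor \<open>contract b w\<close> contribute one half
  of \<open>contract x w\<close> each.\<close>

lemma contract_wedge_2:
  assumes w: "alternating 2 w" and c: "alternating (Suc k) c"
  shows "contract x (mform_wedge 2 (Suc k) w c) v =
    mform_wedge 2 k w (contract x c) v + mform_wedge 1 (Suc k) (contract x w) c v"
proof -
  have w1: "alternating 1 (contract b w)" for b using alternating_contract[of 1 w] w by (simp add: numeral_2_eq_2)
  have s: "contract b w (\<lambda>_. x) = - contract x w (\<lambda>_. b)" for b
  proof -
    have "contract b w (\<lambda>_. x) = w (case_nat x (\<lambda>_. b) \<circ> Transposition.transpose 0 1)"
      unfolding contract_def by (rule alternating_cong[OF w]) (auto simp: less_2_cases_iff)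
    then show ?thesis using alternating_transpose[OF w, of 0 1] by (simp add: contract_def)
  qed
  have 1: "(\<lambda>v. \<Sum>b\<in>Basis. (x \<bullet> b) * contract b w v) = contract x w"
  proof
    fix v
    have "contract b w v = w ((case_nat 0 v)(0 := b))" for b
      by (auto simp: contract_def intro!: arg_cong[where f = w] split: nat.split)
    then show "(\<Sum>b\<in>Basis. (x \<bullet> b) * contract b w v) = contract x w v"
      using linear_euclidean_sum[OF alternating_linear[OF w, of 0 "case_nat 0 v"]] by simp
  qed
  have 2: "(\<lambda>v. \<Sum>b\<in>Basis. contract x w (\<lambda>_. b) * dual b v) = contract x w"
  proof
    fix v
    have "contract x w v = contract x w (\<lambda>_. v 0)" by (rule alternating_cong[OF w1]) simp
    then show "(\<Sum>b\<in>Basis. contract x w (\<lambda>_. b) * dual b v) = contract x w v"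
      using linear_euclidean_sum[OF alternating_linear_const[OF w1], of "v 0" x]
      by (simp add: dual_def mult.commute)
  qed
  have 3: "contract x (mform_wedge 1 (Suc (Suc k)) (dual b) (mform_wedge 1 (Suc k) (contract b w) c)) v =
      (x \<bullet> b) * mform_wedge 1 (Suc k) (contract b w) c v
      + contract x w (\<lambda>_. b) * mform_wedge 1 (Suc k) (dual b) c v
      + mform_wedge 1 (Suc k) (dual b) (mform_wedge 1 k (contract b w) (contract x c)) v" for b
  proof -
    have "contract x (mform_wedge 1 (Suc k) (contract b w) c) =
        (\<lambda>v. - contract x w (\<lambda>_. b) * c v - mform_wedge 1 k (contract b w) (contract x c) v)"
      using contract_wedge_1[OF alternating_imp_multilinear[OF w1] c] s by (simp add: fun_eq_iff)
    then show ?thesis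
      using contract_wedge_1[OF alternating_imp_multilinear[OF alternating_dual] alternating_wedge_1[OF w1 c], of x b b v]
      by (simp add: mform_wedge_diff_right mform_wedge_minus_right mform_wedge_scale_right) (simp add: dual_def)
  qed
  have "contract x (mform_wedge 2 (Suc k) w c) v = (\<Sum>b\<in>Basis. (1 / 2) *
     contract x (mform_wedge 1 (Suc (Suc k)) (dual b) (mform_wedge 1 (Suc k) (contract b w) c)) v)"
    by (simp add: contract_def[of x] mform_wedge_2[OF w])
  also have "\<dots> = (1 / 2) * (\<Sum>b\<in>Basis. (x \<bullet> b) * mform_wedge 1 (Suc k) (contract b w) c v)
     + (1 / 2) * (\<Sum>b\<in>Basis. contract x w (\<lambda>_. b) * mform_wedge 1 (Suc k) (dual b) c v)
     + mform_wedge 2 k w (contract x c) v"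
    unfolding 3 mform_wedge_2[OF w, of k] by (simp add: sum_distrib_left sum.distrib ring_distribs)
  also have "(\<Sum>b\<in>Basis. (x \<bullet> b) * mform_wedge 1 (Suc k) (contract b w) c v) = mform_wedge 1 (Suc k) (contract x w) c v"
    unfolding mform_wedge_scale_left[symmetric] mform_wedge_sum_left[symmetric] 1 ..
  also have "(\<Sum>b\<in>Basis. contract x w (\<lambda>_. b) * mform_wedge 1 (Suc k) (dual b) c v) = mform_wedge 1 (Suc k) (contract x w) c v"
    unfolding mform_wedge_scale_left[symmetric] mform_wedge_sum_left[symmetric] 2 ..
  finally show ?thesis by simp
qed

section \<open>Powers of the Lefschetz map\<close>

primrec lefschetz :: "'e mform \<Rightarrow> nat \<Rightarrow> nat \<Rightarrow> 'e mform \<Rightarrow> 'e mform" where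
  "lefschetz w k 0 c = c"
| "lefschetz w k (Suc r) c = mform_wedge 2 (k + 2 * r) w (lefschetz w k r c)"

lemma alternating_lefschetz:
  "alternating 2 w \<Longrightarrow> alternating k c \<Longrightarrow> alternating (k + 2 * r) (lefschetz w k r c)"
  by (induction r) (auto dest: alternating_wedge_2)

text \<open>Each factor \<open>w\<close> contributes one \<open>contract x w\<close>, which commutes
  with the remaining factors; this gives the coefficient \<open>r + 1\<close>. The exponent on the
  left is a successor, so that no exponent \<open>r - 1\<close> arises.\<close>

lemma contract_lefschetz:
  assumes w: "alternating 2 w" and c: "alternating (Suc k) c"
  shows "contract x (lefschetz w (Suc k) (Suc r) c) v = lefschetz w k (Suc r) (contract x c) v
    + (real r + 1) * mform_wedge 1 (Suc k + 2 * r) (contract x w) (lefschetz w (Suc k) r c) v"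
proof (induction r arbitrary: v)
  case 0
  then show ?case using contract_wedge_2[OF w c] by simp
next
  case (Suc r)
  have w1: "alternating 1 (contract b w)" for b using alternating_contract[of 1 w] w by (simp add: numeral_2_eq_2)
  define L where "L = lefschetz w (Suc k) r c"
  have L: "alternating (Suc (k + 2 * Suc r)) (lefschetz w (Suc k) (Suc r) c)"
    using alternating_lefschetz[OF w c, of "Suc r"] by simp
  have IH: "contract x (lefschetz w (Suc k) (Suc r) c) = (\<lambda>v. lefschetz w k (Suc r) (contract x c) v
    + (real r + 1) * mform_wedge 1 (Suc k + 2 * r) (contract x w) L v)"
    using Suc by (simp add: fun_eq_iff L_def)
  have "contract x (lefschetz w (Suc k) (Suc (Suc r)) c) v =
      contract x (mform_wedge 2 (Suc (k + 2 * Suc r)) w (lefschetz w (Suc k) (Suc r) c)) v"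
    by simp
  also have "\<dots> = mform_wedge 2 (k + 2 * Suc r) w (contract x (lefschetz w (Suc k) (Suc r) c)) v
     + mform_wedge 1 (Suc (k + 2 * Suc r)) (contract x w) (lefschetz w (Suc k) (Suc r) c) v"
    by (rule contract_wedge_2[OF w L])
  also have "mform_wedge 2 (k + 2 * Suc r) w (contract x (lefschetz w (Suc k) (Suc r) c)) v
     = lefschetz w k (Suc (Suc r)) (contract x c) v
     + (real r + 1) * mform_wedge 2 (k + 2 * Suc r) w (mform_wedge 1 (Suc k + 2 * r) (contract x w) L) v"
    unfolding IH mform_wedge_add_right mform_wedge_scale_right by simp
  also have "mform_wedge 2 (k + 2 * Suc r) w (mform_wedge 1 (Suc k + 2 * r) (contract x w) L) v
     = mform_wedge 1 (Suc (k + 2 * Suc r)) (contract x w) (lefschetz w (Suc k) (Suc r) c) v"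
    using wedge_1_2_commute[OF w1 w, of "Suc k + 2 * r" x L v] by (simp add: L_def)
  finally show ?case by (simp add: ring_distribs)
qed

primrec wedge_pow :: "'e mform \<Rightarrow> 'e mform \<Rightarrow> nat \<Rightarrow> 'e mform" where
  "wedge_pow t w 0 = t"
| "wedge_pow t w (Suc m) = mform_wedge (1 + m * 2) 2 (wedge_pow t w m) w"

lemma alternating_wedge_pow:
  "alternating 1 t \<Longrightarrow> alternating 2 w \<Longrightarrow> alternating (1 + m * 2) (wedge_pow t w m)"
  by (induction m) (auto dest: alternating_mform_wedge[of _ _ 2])

text \<open>The contact condition multiplies by \<open>w\<close> on the right,
  \<open>lefschetz\<close> on the left; associativity translates between the two.\<close>

lemma wedge_pow_wedge:
  assumes t: "alternating 1 t" and w: "alternating 2 w"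
  shows "mform_wedge (1 + m * 2) k (wedge_pow t w m) c = mform_wedge 1 (k + 2 * m) t (lefschetz w k m c)"
proof (induction m arbitrary: k c)
  case (Suc m)
  \<comment> \<open>The innermost factor \<open>w\<close> may be counted as part of the argument,
    which then has degree k + 2.\<close>
  have shift: "lefschetz w (Suc (Suc k)) m (mform_wedge 2 k w c) = lefschetz w k (Suc m) c" for m
    by (induction m) auto
  have "mform_wedge (1 + Suc m * 2) k (wedge_pow t w (Suc m)) c =
      mform_wedge (1 + m * 2 + 2) k (mform_wedge (1 + m * 2) 2 (wedge_pow t w m) w) c"
    by (simp add: add_ac)
  also have "\<dots> = mform_wedge (1 + m * 2) (2 + k) (wedge_pow t w m) (mform_wedge 2 k w c)"
    by (rule mform_wedge_assoc[OF alternating_imp_multilinear[OF alternating_wedge_pow[OF t w]]])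
  also have "\<dots> = mform_wedge 1 (k + 2 * Suc m) t (lefschetz w (Suc (Suc k)) m (mform_wedge 2 k w c))"
    using Suc.IH[of "2 + k"] by simp
  finally show ?case unfolding shift .
qed simp

lemma mform_wedge_scalar:
  assumes "alternating k a"
  shows "mform_wedge k 0 a (\<lambda>_. s) v = s * a v"
proof -
  have "tensor k a (\<lambda>_. s) = (\<lambda>v. s * a v)" by (simp add: tensor_def fun_eq_iff)
  then show ?thesis by (simp add: mform_wedge_eq_Alt Alt_scale Alt_alternating[OF assms])
qed

lemma wedge_pow_eq_0_mono:
  assumes "wedge_pow t w r = (\<lambda>_. 0)" "r \<le> n"
  shows "wedge_pow t w n = (\<lambda>_. 0)"
  using assms(2,1)
proof (induction rule: dec_induct)
  case (step m)
  then show ?case by (simp only: wedge_pow.simps mform_wedge_0_left)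
qed

text \<open>If \<open>t\<close> does not vanish on \<open>v 0\<close>, then subtracting a multiple
  of \<open>v 0\<close> moves \<open>v 1\<close> into the kernel of \<open>t\<close> without
  changing \<open>c v\<close>. This takes two slots, hence the degree.\<close>

lemma alternating_eq_0_if_contract_ker:
  assumes c: "alternating (Suc (Suc k)) c" and t: "alternating 1 t"
    and 0: "\<And>x v. t (\<lambda>_. x) = 0 \<Longrightarrow> contract x c v = 0"
  shows "c v = 0"
proof -
  have lt: "linear (\<lambda>x. t (\<lambda>_. x))" by (rule alternating_linear_const[OF t])
  have c0: "c v = 0" if "t (\<lambda>_. v 0) = 0" for v
  proof -
    have "case_nat (v 0) (v \<circ> Suc) = v" by (auto simp: fun_eq_iff split: nat.split)
    then show ?thesis using 0[OF that, of "v \<circ> Suc"] by (simp add: contract_def)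
  qed
  show ?thesis
  proof (cases "t (\<lambda>_. v 0) = 0")
    case False
    define r where "r = t (\<lambda>_. v 1) / t (\<lambda>_. v 0)"
    define u where "u = v(1 := v 1 - r *\<^sub>R v 0)"
    have l: "linear (\<lambda>x. c (v(1 := x)))" using alternating_linear[OF c, of 1] by simp
    have "c u = c (v(1 := v 1)) - r * c (v(1 := v 0))"
      unfolding u_def using linear_diff[OF l] linear_scale[OF l] by simp
    also have "c (v(1 := v 0)) = 0" by (rule alternating_eq_0[OF c, of 0 1]) auto
    finally have "c v = c u" by simp
    also have "\<dots> = - c (u \<circ> Transposition.transpose 0 1)"
      using alternating_transpose[OF c, of 0 1 u] by simp
    \<comment> \<open>The transposition brings the kernel vector to slot 0, where \<open>c0\<close>
      applies.\<close>
    also have "c (u \<circ> Transposition.transpose 0 1) = 0"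
    proof (rule c0)
      show "t (\<lambda>_. (u \<circ> Transposition.transpose 0 1) 0) = 0"
        using False linear_diff[OF lt] linear_scale[OF lt] by (simp add: u_def r_def)
    qed
    finally show ?thesis by simp
  qed (rule c0)
qed

text \<open>The induction contracts \<open>c\<close> with vectors in the kernel of \<open>t\<close>, each time raising the power
  of \<open>w\<close> by one.\<close>

lemma lefschetz_injective_aux:
  assumes t: "alternating 1 t" and w: "alternating 2 w" and nz: "wedge_pow t w n \<noteq> (\<lambda>_. 0)"
  shows "k + r \<le> n \<Longrightarrow> alternating k c \<Longrightarrow> (\<And>v. mform_wedge 1 (k + 2 * r) t (lefschetz w k r c) v = 0)
    \<Longrightarrow> mform_wedge 1 k t c v = 0"
proof (induction k arbitrary: r c v)
  case 0
  \<comment> \<open>A 0-form ignores its arguments and is a number; \<open>undefined\<close> is an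
    arbitrary argument.\<close>
  have c: "c = (\<lambda>_. c undefined)" using alternating_cong[OF 0(2)] by blast
  have "mform_wedge (1 + r * 2) 0 (wedge_pow t w r) (\<lambda>_. c undefined) v = 0" for v
    using 0(3) c wedge_pow_wedge[OF t w, of r 0 c] by simp
  then have "c undefined * wedge_pow t w r v = 0" for v
    by (simp add: mform_wedge_scalar[OF alternating_wedge_pow[OF t w], simplified])
  moreover have "wedge_pow t w r \<noteq> (\<lambda>_. 0)" using nz wedge_pow_eq_0_mono 0(1) by auto
  ultimately have "c undefined = 0" by (metis mult_eq_0_iff)
  then have "c = (\<lambda>_. 0)" using c by metis
  then show ?case by (simp add: mform_wedge_0_right)
next
  case (Suc k)
  note t1 = alternating_imp_multilinear[OF t]
  note c = \<open>alternating (Suc k) c\<close>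
  define L where "L = lefschetz w (Suc k) r c"
  have L: "alternating (Suc (k + 2 * r)) L"
    unfolding L_def using alternating_lefschetz[OF w c, of r] by simp
  have tL: "mform_wedge 1 (Suc (k + 2 * r)) t L = (\<lambda>v. 0)"
    using Suc.prems(3) by (simp add: L_def fun_eq_iff)
  have "contract x (mform_wedge 1 (Suc k) t c) v = 0" if x: "t (\<lambda>_. x) = 0" for x v
  proof -
    have w1: "alternating 1 (contract x w)" using alternating_contract[of 1 w] w by (simp add: numeral_2_eq_2)
    have "mform_wedge 1 (k + 2 * Suc r) t (lefschetz w k (Suc r) (contract x c)) v = 0" for v
    proof -
      \<comment> \<open>The contraction formula is solved for its first term; \<open>t\<close> will
        annihilate both terms on the right.\<close>
      have eq: "lefschetz w k (Suc r) (contract x c) = (\<lambda>v. contract x (lefschetz w (Suc k) (Suc r) c) v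
         - (real r + 1) * mform_wedge 1 (Suc (k + 2 * r)) (contract x w) L v)"
        using contract_lefschetz[OF w c, of x r] by (simp add: fun_eq_iff L_def)
      have L': "alternating (Suc (k + 2 * Suc r)) (lefschetz w (Suc k) (Suc r) c)"
        using alternating_lefschetz[OF w c, of "Suc r"] by simp
      \<comment> \<open>Since \<open>t\<close> commutes with \<open>w\<close>, one more factor
        \<open>w\<close> keeps the product zero. Contracting it with \<open>x\<close>, on which
        \<open>t\<close> vanishes, only moves the contraction to the second factor, up to
        sign.\<close>
      have "mform_wedge 1 (Suc (k + 2 * Suc r)) t (lefschetz w (Suc k) (Suc r) c) = (\<lambda>v. 0)"
        using wedge_1_2_commute[OF t w, of "Suc (k + 2 * r)" L] unfolding tL mform_wedge_0_right
        by (simp add: L_def fun_eq_iff)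
      then have "mform_wedge 1 (k + 2 * Suc r) t (contract x (lefschetz w (Suc k) (Suc r) c)) v = 0"
        using contract_wedge_1[OF t1 L', of x v] x by (simp add: contract_def[of _ "\<lambda>v. 0"])
      moreover have "mform_wedge 1 (k + 2 * Suc r) t (mform_wedge 1 (Suc (k + 2 * r)) (contract x w) L) v = 0"
        using wedge_1_anticommute[OF t w1, of "Suc (k + 2 * r)" L v] tL by (simp add: mform_wedge_0_right)
      ultimately show ?thesis
        unfolding eq mform_wedge_diff_right mform_wedge_scale_right by simp
    qed
    \<comment> \<open>\<open>k\<close> has dropped by one and \<open>r\<close> has risen by one, so
      the bound \<open>k + r \<le> n\<close> persists.\<close>
    then have "mform_wedge 1 k t (contract x c) v = 0"
      by (intro Suc.IH[of "Suc r"]) (use Suc.prems(1) alternating_contract[OF c] in auto)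
    then show ?thesis using contract_wedge_1[OF t1 c, of x v] x by simp
  qed
  then show ?case using alternating_eq_0_if_contract_ker[OF alternating_wedge_1[OF t c] t] by blast
qed

text \<open>The case \<open>r = 1\<close>. Vanishing modulo \<open>t\<close> is expressed, in the
  hypothesis and in the conclusion, as a vanishing product with \<open>t\<close>.\<close>

lemma lefschetz_injective:
  assumes "alternating 1 t" "alternating 2 w" "wedge_pow t w n \<noteq> (\<lambda>_. 0)" "k < n" "alternating k c"
    and "\<And>v. mform_wedge 1 (2 + k) t (mform_wedge 2 k w c) v = 0"
  shows "mform_wedge 1 k t c v = 0"
  using lefschetz_injective_aux[OF assms(1,2,3), of k 1 c v] assms(4,5,6) by simp

section \<open>Calculus of smooth maps\<close>

lemma has_derivative_cong_open:
  assumes "open S" "x \<in> S" "\<And>y. y \<in> S \<Longrightarrow> f y = g y"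
  shows "(f has_derivative F) (at x) \<longleftrightarrow> (g has_derivative F) (at x)"
  using has_derivative_transform_within_open[OF _ assms(1,2)] assms(3) by metis

lemma frechet_derivative_cong_open:
  assumes "open S" "x \<in> S" "\<And>y. y \<in> S \<Longrightarrow> f y = g y"
  shows "frechet_derivative f (at x) = frechet_derivative g (at x)"
  unfolding frechet_derivative_def using has_derivative_cong_open[OF assms] by simp

lemma differentiable_cong_open:
  assumes "open S" "x \<in> S" "\<And>y. y \<in> S \<Longrightarrow> f y = g y"
  shows "f differentiable (at x) \<longleftrightarrow> g differentiable (at x)"
  unfolding differentiable_def using has_derivative_cong_open[OF assms] by simp

lemma Ck_cong:
  assumes S: "open S"
  shows "(\<And>y. y \<in> S \<Longrightarrow> f y = g y) \<Longrightarrow> Ck k S f \<longleftrightarrow> Ck k S g"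
proof (induction k arbitrary: f g)
  case 0
  then show ?case by (auto cong: continuous_on_cong)
next
  case (Suc k)
  have "Ck k S (\<lambda>x. frechet_derivative f (at x) v) \<longleftrightarrow> Ck k S (\<lambda>x. frechet_derivative g (at x) v)" for v
    by (rule Suc.IH) (use frechet_derivative_cong_open[OF S _ Suc.prems] in auto)
  then show ?case
    using differentiable_cong_open[OF S _ Suc.prems] by simp
qed

lemma Ck_mono_set: "Ck k S f \<Longrightarrow> T \<subseteq> S \<Longrightarrow> Ck k T f"
  by (induction k arbitrary: f) (auto intro: continuous_on_subset)

lemma Ck_imp_continuous_on: "Ck k S f \<Longrightarrow> continuous_on S f"
  by (cases k) (auto intro!: continuous_at_imp_continuous_on differentiable_imp_continuous_within)

lemma Ck_Suc_imp: "Ck (Suc k) S f \<Longrightarrow> Ck k S f"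
proof (induction k arbitrary: f)
  case 0
  then show ?case using Ck_imp_continuous_on[OF 0] by simp
next
  case (Suc k)
  then have "Ck k S (\<lambda>x. frechet_derivative f (at x) v)" for v by simp
  then show ?case using Suc.prems by simp
qed

lemma Ck_local:
  assumes "\<And>x. x \<in> S \<Longrightarrow> \<exists>T. open T \<and> x \<in> T \<and> Ck k T f"
  shows "Ck k S f"
  using assms
proof (induction k arbitrary: f)
  case 0
  then have "isCont f x" if "x \<in> S" for x
    using that by (metis Ck.simps(1) continuous_on_eq_continuous_at)
  then show ?case by (auto intro: continuous_at_imp_continuous_on)
next
  case (Suc k)
  have "\<exists>T. open T \<and> x \<in> T \<and> Ck k T (\<lambda>x. frechet_derivative f (at x) v)" if "x \<in> S" for x v
    using Suc.prems[OF that] by auto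
  then show ?case using Suc by fastforce
qed

lemma frechet_derivative_worksI:
  "f differentiable net \<Longrightarrow> (f has_derivative frechet_derivative f net) net"
  by (simp add: frechet_derivative_works)

lemma frechet_derivative_at_eq: "(f has_derivative F) (at x) \<Longrightarrow> frechet_derivative f (at x) v = F v"
  using frechet_derivative_at by metis

lemma frechet_derivative_add:
  "f differentiable (at x) \<Longrightarrow> g differentiable (at x) \<Longrightarrow>
    frechet_derivative (\<lambda>x. f x + g x) (at x) v = frechet_derivative f (at x) v + frechet_derivative g (at x) v"
  by (rule frechet_derivative_at_eq) (intro has_derivative_add frechet_derivative_worksI)

lemma frechet_derivative_mult:
  fixes f g :: "'a::real_normed_vector \<Rightarrow> real"
  shows "f differentiable (at x) \<Longrightarrow> g differentiable (at x) \<Longrightarrow>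
    frechet_derivative (\<lambda>x. f x * g x) (at x) v
      = f x * frechet_derivative g (at x) v + frechet_derivative f (at x) v * g x"
  by (rule frechet_derivative_at_eq) (intro has_derivative_mult frechet_derivative_worksI)

lemma Ck_const: "Ck k S (\<lambda>x. c)"
proof (induction k arbitrary: c)
  case (Suc k)
  have "frechet_derivative (\<lambda>x. c) (at x) v = 0" for x :: 'a and v
    by (rule frechet_derivative_at_eq) (rule has_derivative_const)
  then show ?case using Suc by simp
qed simp

lemma Ck_add: "open S \<Longrightarrow> Ck k S f \<Longrightarrow> Ck k S g \<Longrightarrow> Ck k S (\<lambda>x. f x + g x)"
proof (induction k arbitrary: f g)
  case (Suc k)
  then have "Ck k S (\<lambda>x. frechet_derivative f (at x) v + frechet_derivative g (at x) v)" for v by simp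
  moreover have "Ck k S (\<lambda>x. frechet_derivative f (at x) v + frechet_derivative g (at x) v) \<longleftrightarrow>
      Ck k S (\<lambda>x. frechet_derivative (\<lambda>x. f x + g x) (at x) v)" for v
    by (rule Ck_cong[OF Suc.prems(1)]) (use Suc.prems in \<open>simp add: frechet_derivative_add\<close>)
  ultimately show ?case using Suc.prems by simp
qed (simp add: continuous_on_add)

lemma Ck_mult:
  fixes f g :: "'a::real_normed_vector \<Rightarrow> real"
  shows "open S \<Longrightarrow> Ck k S f \<Longrightarrow> Ck k S g \<Longrightarrow> Ck k S (\<lambda>x. f x * g x)"
proof (induction k arbitrary: f g)
  case (Suc k)
  have "Ck k S (\<lambda>x. f x * frechet_derivative g (at x) v + frechet_derivative f (at x) v * g x)" for v
    using Suc.prems Ck_Suc_imp[OF Suc.prems(2)] Ck_Suc_imp[OF Suc.prems(3)]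
    by (intro Ck_add Suc.IH) auto
  moreover have "Ck k S (\<lambda>x. f x * frechet_derivative g (at x) v + frechet_derivative f (at x) v * g x) \<longleftrightarrow>
      Ck k S (\<lambda>x. frechet_derivative (\<lambda>x. f x * g x) (at x) v)" for v
    by (rule Ck_cong[OF Suc.prems(1)]) (use Suc.prems in \<open>simp add: frechet_derivative_mult\<close>)
  ultimately show ?case using Suc.prems by simp
qed (simp add: continuous_on_mult)

lemma smooth_on_cong: "open S \<Longrightarrow> (\<And>y. y \<in> S \<Longrightarrow> f y = g y) \<Longrightarrow> smooth_on S f \<longleftrightarrow> smooth_on S g"
  using Ck_cong[of S f g] by (simp add: smooth_on_def)

lemma smooth_on_mono_set: "smooth_on S f \<Longrightarrow> T \<subseteq> S \<Longrightarrow> smooth_on T f"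
  by (auto simp: smooth_on_def intro: Ck_mono_set)

lemma smooth_on_local:
  "(\<And>x. x \<in> S \<Longrightarrow> \<exists>T. open T \<and> x \<in> T \<and> smooth_on T f) \<Longrightarrow> smooth_on S f"
  unfolding smooth_on_def by (meson Ck_local)

lemma smooth_on_const: "smooth_on S (\<lambda>x. c)"
  by (simp add: smooth_on_def Ck_const)

lemma smooth_on_add: "open S \<Longrightarrow> smooth_on S f \<Longrightarrow> smooth_on S g \<Longrightarrow> smooth_on S (\<lambda>x. f x + g x)"
  by (simp add: smooth_on_def Ck_add)

lemma smooth_on_mult:
  fixes f g :: "'a::real_normed_vector \<Rightarrow> real"
  shows "open S \<Longrightarrow> smooth_on S f \<Longrightarrow> smooth_on S g \<Longrightarrow> smooth_on S (\<lambda>x. f x * g x)"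
  by (simp add: smooth_on_def Ck_mult)

lemma smooth_on_sum: "open S \<Longrightarrow> (\<And>i. i \<in> X \<Longrightarrow> smooth_on S (f i)) \<Longrightarrow> smooth_on S (\<lambda>x. \<Sum>i\<in>X. f i x)"
  by (induction X rule: infinite_finite_induct) (simp_all add: smooth_on_const smooth_on_add)

lemma smooth_on_frechet_derivative: "smooth_on S f \<Longrightarrow> smooth_on S (\<lambda>x. frechet_derivative f (at x) v)"
  unfolding smooth_on_def by (metis Ck.simps(2))

lemma smooth_on_imp_differentiable: "smooth_on S f \<Longrightarrow> x \<in> S \<Longrightarrow> f differentiable (at x)"
  unfolding smooth_on_def by (metis Ck.simps(2))

lemma smooth_on_imp_continuous_on: "smooth_on S f \<Longrightarrow> continuous_on S f"
  unfolding smooth_on_def by (metis Ck.simps(1))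

section \<open>Symmetry of second derivatives\<close>

lemma DERIV_along_line:
  fixes f :: "'a::real_normed_vector \<Rightarrow> real"
  assumes "f differentiable (at (p + s *\<^sub>R u))"
  shows "((\<lambda>s. f (p + s *\<^sub>R u)) has_field_derivative frechet_derivative f (at (p + s *\<^sub>R u)) u) (at s)"
proof -
  have f: "(f has_derivative frechet_derivative f (at (p + s *\<^sub>R u))) (at (p + s *\<^sub>R u))"
    using assms by (rule frechet_derivative_worksI)
  have l: "((\<lambda>s. p + s *\<^sub>R u) has_derivative (\<lambda>h. h *\<^sub>R u)) (at s)"
    by (auto intro!: derivative_eq_intros)
  have "((\<lambda>s. f (p + s *\<^sub>R u)) has_derivative (\<lambda>h. frechet_derivative f (at (p + s *\<^sub>R u)) (h *\<^sub>R u))) (at s)"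
    using has_derivative_compose[OF l f] .
  then show ?thesis
    using linear_scale[OF linear_frechet_derivative[OF assms]]
    by (simp add: has_field_derivative_def mult.commute[of _ "frechet_derivative f _ u"])
qed

text \<open>The mean value theorem twice: along \<open>u\<close> for the increment in direction
  \<open>w\<close>, then along \<open>w\<close> for the derivative in direction \<open>u\<close>.
  The bound on \<open>h\<close> keeps the whole parallelogram inside the ball.\<close>

lemma second_difference_mvt:
  fixes f :: "'a::real_normed_vector \<Rightarrow> real"
  assumes f: "smooth_on (ball x d) f" and h: "0 < h" "h * (norm u + norm w) < d"
  obtains \<xi> \<eta> where "0 < \<xi>" "\<xi> < h" "0 < \<eta>" "\<eta> < h"
    "f (x + h *\<^sub>R u + h *\<^sub>R w) - f (x + h *\<^sub>R u) - f (x + h *\<^sub>R w) + f x =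
       h * (h * frechet_derivative (\<lambda>y. frechet_derivative f (at y) u) (at (x + \<xi> *\<^sub>R u + \<eta> *\<^sub>R w)) w)"
proof -
  have B: "x + s *\<^sub>R u + t *\<^sub>R w \<in> ball x d" if "0 \<le> s" "s \<le> h" "0 \<le> t" "t \<le> h" for s t
  proof -
    have "norm (s *\<^sub>R u + t *\<^sub>R w) \<le> s * norm u + t * norm w"
      using norm_triangle_ineq[of "s *\<^sub>R u" "t *\<^sub>R w"] that by simp
    also have "\<dots> \<le> h * norm u + h * norm w" using that by (intro add_mono mult_right_mono) auto
    finally have "norm (s *\<^sub>R u + t *\<^sub>R w) < d" using h by (simp add: ring_distribs)
    moreover have "dist x (x + y) = norm y" for y by (simp add: dist_norm)
    then have "dist x (x + s *\<^sub>R u + t *\<^sub>R w) = norm (s *\<^sub>R u + t *\<^sub>R w)"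
      by (metis add.assoc)
    ultimately show ?thesis by simp
  qed
  define g where "g y = frechet_derivative f (at y) u" for y
  have g: "smooth_on (ball x d) g" unfolding g_def by (rule smooth_on_frechet_derivative[OF f])
  define \<phi> where "\<phi> s = f (x + h *\<^sub>R w + s *\<^sub>R u) - f (x + s *\<^sub>R u)" for s
  have d\<phi>: "(\<phi> has_field_derivative g (x + h *\<^sub>R w + s *\<^sub>R u) - g (x + s *\<^sub>R u)) (at s)" if "0 \<le> s" "s \<le> h" for s
    unfolding \<phi>_def g_def
  proof (intro DERIV_diff DERIV_along_line smooth_on_imp_differentiable[OF f])
    show "x + h *\<^sub>R w + s *\<^sub>R u \<in> ball x d" using B[OF that, of h] h by (simp add: add_ac)
    show "x + s *\<^sub>R u \<in> ball x d" using B[OF that, of 0] h by simp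
  qed
  then obtain \<xi> where \<xi>: "0 < \<xi>" "\<xi> < h"
      "\<phi> h - \<phi> 0 = (h - 0) * (g (x + h *\<^sub>R w + \<xi> *\<^sub>R u) - g (x + \<xi> *\<^sub>R u))"
    using MVT2[OF h(1) d\<phi>] by blast
  have dg: "((\<lambda>t. g (x + \<xi> *\<^sub>R u + t *\<^sub>R w)) has_field_derivative frechet_derivative g (at (x + \<xi> *\<^sub>R u + t *\<^sub>R w)) w) (at t)"
    if "0 \<le> t" "t \<le> h" for t
    by (intro DERIV_along_line smooth_on_imp_differentiable[OF g] B) (use that \<xi> in auto)
  then obtain \<eta> where \<eta>: "0 < \<eta>" "\<eta> < h"
      "g (x + \<xi> *\<^sub>R u + h *\<^sub>R w) - g (x + \<xi> *\<^sub>R u + 0 *\<^sub>R w) =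
        (h - 0) * frechet_derivative g (at (x + \<xi> *\<^sub>R u + \<eta> *\<^sub>R w)) w"
    using MVT2[OF h(1) dg] by blast
  have "\<phi> h - \<phi> 0 = h * (h * frechet_derivative g (at (x + \<xi> *\<^sub>R u + \<eta> *\<^sub>R w)) w)"
    using \<xi>(3) \<eta>(3) by (simp add: add_ac)
  then show thesis
    using that[OF \<xi>(1,2) \<eta>(1,2)] by (simp add: \<phi>_def g_def[abs_def] add_ac algebra_simps)
qed

text \<open>Schwarz: both mixed derivatives are limits of the same second difference quotient.\<close>

lemma frechet_derivative_commute_real:
  fixes f :: "'a::real_normed_vector \<Rightarrow> real"
  assumes S: "open S" "x \<in> S" and f: "smooth_on S f"
  shows "frechet_derivative (\<lambda>y. frechet_derivative f (at y) u) (at x) w =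
         frechet_derivative (\<lambda>y. frechet_derivative f (at y) w) (at x) u"
proof -
  define G where "G u w y = frechet_derivative (\<lambda>y. frechet_derivative f (at y) u) (at y) w" for u w y
  have cont: "isCont (G u w) x" for u w
    unfolding G_def using S smooth_on_imp_continuous_on[OF smooth_on_frechet_derivative[OF smooth_on_frechet_derivative[OF f]]]
    by (auto simp: continuous_on_eq_continuous_at)
  have *: "\<bar>G u w x - G w u x\<bar> \<le> 2 * e" if e: "e > 0" for e
  proof -
    obtain d0 where d0: "d0 > 0" "ball x d0 \<subseteq> S" using S open_contains_ball by blast
    obtain d1 where d1: "d1 > 0" "\<And>y. dist y x < d1 \<Longrightarrow> dist (G u w y) (G u w x) < e"
      using cont[of u w] e unfolding continuous_at_eps_delta by blast
    obtain d2 where d2: "d2 > 0" "\<And>y. dist y x < d2 \<Longrightarrow> dist (G w u y) (G w u x) < e"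
      using cont[of w u] e unfolding continuous_at_eps_delta by blast
    define d where "d = min d0 (min d1 d2)"
    have d: "d > 0" using d0 d1 d2 by (simp add: d_def)
    have fd: "smooth_on (ball x d) f" by (rule smooth_on_mono_set[OF f]) (use d0 in \<open>auto simp: d_def\<close>)
    \<comment> \<open>Small enough for the parallelogram to fit into the ball; the 1 keeps the
      denominator positive even if both vectors vanish.\<close>
    define h where "h = d / (norm u + norm w + 1)"
    have N: "norm u + norm w + 1 > 0" using norm_ge_zero[of u] norm_ge_zero[of w] by linarith
    have h: "h > 0" using d N by (simp add: h_def)
    have hd: "h * (norm u + norm w) < d" using d N by (simp add: h_def field_simps)
    have near: "dist (x + s *\<^sub>R u + t *\<^sub>R w) x < d" if "0 < s" "s < h" "0 < t" "t < h" for s t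
    proof -
      have "norm (s *\<^sub>R u + t *\<^sub>R w) \<le> s * norm u + t * norm w"
        using norm_triangle_ineq[of "s *\<^sub>R u" "t *\<^sub>R w"] that by simp
      also have "\<dots> \<le> h * norm u + h * norm w" using that by (intro add_mono mult_right_mono) auto
      finally show ?thesis using hd by (simp add: dist_norm add.assoc ring_distribs)
    qed
    have hd': "h * (norm w + norm u) < d" using hd by (simp add: add.commute)
    obtain s t where st: "0 < s" "s < h" "0 < t" "t < h" and
      1: "f (x + h *\<^sub>R u + h *\<^sub>R w) - f (x + h *\<^sub>R u) - f (x + h *\<^sub>R w) + f x = h * (h * G u w (x + s *\<^sub>R u + t *\<^sub>R w))"
      using second_difference_mvt[OF fd h hd] unfolding G_def by blast
    obtain s' t' where st': "0 < s'" "s' < h" "0 < t'" "t' < h" and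
      2: "f (x + h *\<^sub>R w + h *\<^sub>R u) - f (x + h *\<^sub>R w) - f (x + h *\<^sub>R u) + f x = h * (h * G w u (x + s' *\<^sub>R w + t' *\<^sub>R u))"
      using second_difference_mvt[OF fd h hd'] unfolding G_def by blast
    \<comment> \<open>Exchanging \<open>u\<close> and \<open>w\<close> does not change the second
      difference.\<close>
    have "x + h *\<^sub>R w + h *\<^sub>R u = x + h *\<^sub>R u + h *\<^sub>R w" by (simp add: add_ac)
    then have "h * (h * G u w (x + s *\<^sub>R u + t *\<^sub>R w)) = h * (h * G w u (x + s' *\<^sub>R w + t' *\<^sub>R u))"
      using 1 2 by (metis add.commute add_diff_eq diff_add_eq diff_diff_eq)
    then have "G u w (x + s *\<^sub>R u + t *\<^sub>R w) = G w u (x + t' *\<^sub>R u + s' *\<^sub>R w)" using h by (simp add: add_ac)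
    moreover have "dist (G u w (x + s *\<^sub>R u + t *\<^sub>R w)) (G u w x) < e"
      by (rule d1(2)) (use near[OF st] in \<open>simp add: d_def\<close>)
    moreover have "dist (G w u (x + t' *\<^sub>R u + s' *\<^sub>R w)) (G w u x) < e"
      by (rule d2(2)) (use near[OF st'(3,4,1,2)] in \<open>simp add: d_def\<close>)
    ultimately show ?thesis by (simp add: dist_real_def)
  qed
  have "\<bar>G u w x - G w u x\<bar> \<le> 0"
  proof (rule field_le_epsilon)
    show "\<bar>G u w x - G w u x\<bar> \<le> 0 + e" if "e > 0" for e
      using *[of "e / 2"] that by simp
  qed
  then show ?thesis by (simp add: G_def)
qed

lemma frechet_derivative_inner:
  assumes "f differentiable (at x)"
  shows "(\<lambda>x. f x \<bullet> b) differentiable (at x)"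
    and "frechet_derivative (\<lambda>x. f x \<bullet> b) (at x) v = frechet_derivative f (at x) v \<bullet> b"
proof -
  have "((\<lambda>x. f x \<bullet> b) has_derivative (\<lambda>v. frechet_derivative f (at x) v \<bullet> b)) (at x)"
    using frechet_derivative_worksI[OF assms] by (rule has_derivative_inner_left)
  then show "(\<lambda>x. f x \<bullet> b) differentiable (at x)"
    and "frechet_derivative (\<lambda>x. f x \<bullet> b) (at x) v = frechet_derivative f (at x) v \<bullet> b"
    by (auto simp: differentiable_def intro: frechet_derivative_at_eq)
qed

lemma Ck_inner: "open S \<Longrightarrow> Ck k S f \<Longrightarrow> Ck k S (\<lambda>x. f x \<bullet> b)"
proof (induction k arbitrary: f)
  case (Suc k)
  have "Ck k S (\<lambda>x. frechet_derivative f (at x) v \<bullet> b) \<longleftrightarrow>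
      Ck k S (\<lambda>x. frechet_derivative (\<lambda>x. f x \<bullet> b) (at x) v)" for v
    by (rule Ck_cong[OF Suc.prems(1)]) (use Suc.prems in \<open>simp add: frechet_derivative_inner\<close>)
  then show ?case using Suc by (simp add: frechet_derivative_inner(1))
qed (simp add: continuous_on_inner)

text \<open>Componentwise from the real case. Vector values occur for transition maps, whose second
  derivatives enter through \<open>coord_deriv_pullback\<close>.\<close>

lemma frechet_derivative_commute:
  fixes f :: "'a::real_normed_vector \<Rightarrow> 'b::euclidean_space"
  assumes S: "open S" "x \<in> S" and f: "smooth_on S f"
  shows "frechet_derivative (\<lambda>y. frechet_derivative f (at y) u) (at x) w =
         frechet_derivative (\<lambda>y. frechet_derivative f (at y) w) (at x) u"
proof (rule euclidean_eqI)
  fix b :: 'b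
  have "frechet_derivative (\<lambda>y. frechet_derivative f (at y) u) (at x) w \<bullet> b =
        frechet_derivative (\<lambda>y. frechet_derivative (\<lambda>y. f y \<bullet> b) (at y) u) (at x) w" for u w
  proof -
    have "frechet_derivative (\<lambda>y. frechet_derivative (\<lambda>y. f y \<bullet> b) (at y) u) (at x) =
        frechet_derivative (\<lambda>y. frechet_derivative f (at y) u \<bullet> b) (at x)"
      by (rule frechet_derivative_cong_open[OF S])
        (simp add: frechet_derivative_inner smooth_on_imp_differentiable[OF f])
    then show ?thesis
      using frechet_derivative_inner(2)[OF smooth_on_imp_differentiable[OF smooth_on_frechet_derivative[OF f] S(2)]]
      by simp
  qed
  moreover have "smooth_on S (\<lambda>y. f y \<bullet> b)" using f S by (simp add: smooth_on_def Ck_inner)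
  ultimately show "frechet_derivative (\<lambda>y. frechet_derivative f (at y) u) (at x) w \<bullet> b =
         frechet_derivative (\<lambda>y. frechet_derivative f (at y) w) (at x) u \<bullet> b"
    using frechet_derivative_commute_real[OF S] by metis
qed

section \<open>The exterior derivative in coordinates\<close>

definition form_field :: "'e::euclidean_space set \<Rightarrow> nat \<Rightarrow> ('e \<Rightarrow> 'e mform) \<Rightarrow> bool" where
  "form_field S k f \<longleftrightarrow> open S \<and> (\<forall>x\<in>S. alternating k (f x)) \<and> (\<forall>v. smooth_on S (\<lambda>x. f x v))"

definition coord_deriv :: "nat \<Rightarrow> ('e::euclidean_space \<Rightarrow> 'e mform) \<Rightarrow> 'e \<Rightarrow> 'e mform" where
  "coord_deriv k f x v = (\<Sum>i\<le>k. (- 1) ^ i * frechet_derivative (\<lambda>y. f y (omit i v)) (at x) (v i))"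

lemma form_fieldD:
  assumes "form_field S k f"
  shows "open S" "x \<in> S \<Longrightarrow> alternating k (f x)" "smooth_on S (\<lambda>x. f x v)"
    "x \<in> S \<Longrightarrow> (\<lambda>x. f x v) differentiable (at x)"
  using assms by (auto simp: form_field_def intro: smooth_on_imp_differentiable)

lemma coord_deriv_cong:
  assumes "open S" "x \<in> S" "\<And>y. y \<in> S \<Longrightarrow> f y = g y"
  shows "coord_deriv k f x = coord_deriv k g x"
proof
  fix v
  have "frechet_derivative (\<lambda>y. f y u) (at x) = frechet_derivative (\<lambda>y. g y u) (at x)" for u
    by (rule frechet_derivative_cong_open[OF assms(1,2)]) (simp add: assms(3))
  then show "coord_deriv k f x v = coord_deriv k g x v" by (simp add: coord_deriv_def)
qed

text \<open>The identities that make \<open>f y\<close> alternating hold for all \<open>y\<close> in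
  the open set, so they may be differentiated in \<open>y\<close>.\<close>

lemma alternating_frechet_derivative:
  assumes f: "form_field S k f" and x: "x \<in> S"
  shows "alternating k (\<lambda>u. frechet_derivative (\<lambda>y. f y u) (at x) h)"
proof (rule alternatingI)
  note S = form_fieldD(1)[OF f]
  note alt = form_fieldD(2)[OF f] and diff = form_fieldD(4)[OF f x]
  show "frechet_derivative (\<lambda>y. f y v) (at x) h = frechet_derivative (\<lambda>y. f y w) (at x) h"
    if "\<And>i. i < k \<Longrightarrow> v i = w i" for v w
  proof -
    have "f y v = f y w" if "y \<in> S" for y
      using alternating_cong[OF alt[OF that]] \<open>\<And>i. i < k \<Longrightarrow> v i = w i\<close> by blast
    then show ?thesis using frechet_derivative_cong_open[OF S x, of "\<lambda>y. f y v" "\<lambda>y. f y w"] by simp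
  qed
  show "frechet_derivative (\<lambda>y. f y v) (at x) h = 0" if ij: "i < k" "j < k" "i \<noteq> j" "v i = v j" for i j v
  proof -
    have "f y v = 0" if "y \<in> S" for y using alternating_eq_0[OF alt[OF that] ij] .
    then have "frechet_derivative (\<lambda>y. f y v) (at x) = frechet_derivative (\<lambda>y. 0) (at x)"
      by (rule frechet_derivative_cong_open[OF S x])
    then show ?thesis using frechet_derivative_at_eq[OF has_derivative_const[of 0]] by simp
  qed
  show "linear (\<lambda>z. frechet_derivative (\<lambda>y. f y (v(i := z))) (at x) h)" if i: "i < k" for i v
  proof (rule linearI)
    note lin = alternating_linear[OF alt i, of _ v]
    show "frechet_derivative (\<lambda>y. f y (v(i := a + b))) (at x) h =
       frechet_derivative (\<lambda>y. f y (v(i := a))) (at x) h + frechet_derivative (\<lambda>y. f y (v(i := b))) (at x) h" for a b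
    proof -
      have "frechet_derivative (\<lambda>y. f y (v(i := a + b))) (at x) =
          frechet_derivative (\<lambda>y. f y (v(i := a)) + f y (v(i := b))) (at x)"
        by (rule frechet_derivative_cong_open[OF S x]) (rule linear_add[OF lin])
      then show ?thesis using frechet_derivative_add[OF diff diff] by simp
    qed
    show "frechet_derivative (\<lambda>y. f y (v(i := r *\<^sub>R a))) (at x) h =
       r *\<^sub>R frechet_derivative (\<lambda>y. f y (v(i := a))) (at x) h" for r a
    proof -
      have "frechet_derivative (\<lambda>y. f y (v(i := r *\<^sub>R a))) (at x) =
          frechet_derivative (\<lambda>y. r *\<^sub>R f y (v(i := a))) (at x)"
        by (rule frechet_derivative_cong_open[OF S x]) (rule linear_scale[OF lin])
      then show ?thesis
        using frechet_derivative_at_eq[OF has_derivative_scaleR_right[OF frechet_derivative_worksI[OF diff]],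
            of r "v(i := a)" h]
        by simp
    qed
  qed
qed

text \<open>The derivative direction is slot 0, and the arguments of the form are the tail.
  Identities of the exterior derivative thereby reduce to identities between functions under
  \<open>Alt\<close>.\<close>

lemma coord_deriv_eq_Alt:
  assumes f: "form_field S k f" and x: "x \<in> S"
  shows "coord_deriv k f x v =
    Alt (Suc k) (\<lambda>v. frechet_derivative (\<lambda>y. f y (v \<circ> Suc)) (at x) (v 0)) v / fact k"
  using Alt_head_tail[of k "\<lambda>h u. frechet_derivative (\<lambda>y. f y u) (at x) h" v,
      OF alternating_frechet_derivative[OF f x]]
  by (simp add: coord_deriv_def)

lemma multilinear_head_tail:
  assumes F: "\<And>h. alternating k (F h)" and lin: "\<And>u. linear (\<lambda>h. F h u)"
  shows "multilinear (Suc k) (\<lambda>v. F (v 0) (v \<circ> Suc))"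
  unfolding multilinear_def
proof (intro conjI allI impI)
  fix v w :: "nat \<Rightarrow> 'a" assume vw: "\<forall>i<Suc k. v i = w i"
  have "F (w 0) (v \<circ> Suc) = F (w 0) (w \<circ> Suc)"
    by (rule alternating_cong[OF F]) (use vw in simp)
  then show "F (v 0) (v \<circ> Suc) = F (w 0) (w \<circ> Suc)" using vw by simp
next
  fix i v assume i: "i < Suc k"
  show "linear (\<lambda>x. F ((v(i := x)) 0) (v(i := x) \<circ> Suc))"
  proof (cases i)
    case 0
    have "v(0 := x) \<circ> Suc = v \<circ> Suc" for x by auto
    then show ?thesis using lin 0 by simp
  next
    case (Suc j)
    have "v(Suc j := x) \<circ> Suc = (v \<circ> Suc)(j := x)" for x by auto
    then show ?thesis using alternating_linear[OF F, of j "v 0" "v \<circ> Suc"] i Suc by simp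
  qed
qed

lemma alternating_coord_deriv:
  assumes f: "form_field S k f" and x: "x \<in> S"
  shows "alternating (Suc k) (coord_deriv k f x)"
proof -
  have "coord_deriv k f x = (\<lambda>v. (1 / fact k) *
      Alt (Suc k) (\<lambda>v. frechet_derivative (\<lambda>y. f y (v \<circ> Suc)) (at x) (v 0)) v)"
    using coord_deriv_eq_Alt[OF f x] by (simp add: fun_eq_iff)
  moreover have "multilinear (Suc k) (\<lambda>v. frechet_derivative (\<lambda>y. f y (v \<circ> Suc)) (at x) (v 0))"
    by (rule multilinear_head_tail[OF alternating_frechet_derivative[OF f x]])
      (rule linear_frechet_derivative[OF form_fieldD(4)[OF f x]])
  ultimately show ?thesis by (simp only:) (intro alternating_scale alternating_Alt)
qed

lemma form_field_coord_deriv: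
  assumes f: "form_field S k f"
  shows "form_field S (Suc k) (coord_deriv k f)"
  unfolding form_field_def
proof (intro conjI ballI allI)
  show "smooth_on S (\<lambda>x. coord_deriv k f x v)" for v
    unfolding coord_deriv_def
    by (intro smooth_on_sum smooth_on_mult smooth_on_const smooth_on_frechet_derivative form_fieldD[OF f])
qed (use form_fieldD(1)[OF f] alternating_coord_deriv[OF f] in auto)

text \<open>Differentiating twice produces second derivatives of \<open>f\<close> in the directions
  of the slots 0 and i + 1, neither of which is among the remaining arguments. They are symmetric in
  these two slots, so \<open>Alt\<close> annihilates them.\<close>

lemma coord_deriv_coord_deriv:
  assumes f: "form_field S k f" and x: "x \<in> S"
  shows "coord_deriv (Suc k) (coord_deriv k f) x v = 0"
proof -
  define D where "D u g h = frechet_derivative (\<lambda>y. frechet_derivative (\<lambda>y. f y g) (at y) u) (at x) h" for u g h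
  have comm: "D u g h = D h g u" for u g h
    unfolding D_def by (rule frechet_derivative_commute[OF form_fieldD(1)[OF f] x form_fieldD(3)[OF f]])
  define T where "T i v = D (v (Suc i)) (omit i (v \<circ> Suc)) (v 0)" for i and v :: "nat \<Rightarrow> 'a"
  have Alt0: "Alt (Suc (Suc k)) (T i) v = 0" if i: "i \<le> k" for i
  proof (rule Alt_symmetric_eq_0)
    show "T i (v \<circ> Transposition.transpose 0 (Suc i)) = T i v" for v
    proof -
      have "omit i (v \<circ> Transposition.transpose 0 (Suc i) \<circ> Suc) = omit i (v \<circ> Suc)"
        by (auto simp: omit_def fun_eq_iff Transposition.transpose_def)
      then show ?thesis using comm by (simp add: T_def)
    qed
  qed (use i in auto)
  have "frechet_derivative (\<lambda>y. coord_deriv k f y (u \<circ> Suc)) (at x) (u 0) = (\<Sum>i\<le>k. (- 1) ^ i * T i u)" for u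
  proof -
    have "((\<lambda>y. coord_deriv k f y (u \<circ> Suc)) has_derivative (\<lambda>h. \<Sum>i\<le>k. (- 1) ^ i * D (u (Suc i)) (omit i (u \<circ> Suc)) h)) (at x)" 
      unfolding coord_deriv_def D_def comp_apply
      by (intro has_derivative_sum has_derivative_mult_right frechet_derivative_worksI
          smooth_on_imp_differentiable[OF smooth_on_frechet_derivative[OF form_fieldD(3)[OF f]] x])
    from frechet_derivative_at_eq[OF this] show ?thesis by (simp add: T_def)
  qed
  then have "coord_deriv (Suc k) (coord_deriv k f) x v =
      Alt (Suc (Suc k)) (\<lambda>u. \<Sum>i\<le>k. (- 1) ^ i * T i u) v / fact (Suc k)"
    using coord_deriv_eq_Alt[OF form_field_coord_deriv[OF f] x] by simp
  then show ?thesis by (simp add: Alt_sum Alt_scale Alt0 del: fact_Suc)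
qed

lemma coord_deriv_add:
  assumes "form_field S k f" "form_field S k g" "x \<in> S"
  shows "coord_deriv k (\<lambda>y v. f y v + g y v) x v = coord_deriv k f x v + coord_deriv k g x v"
  using assms by (simp add: coord_deriv_def frechet_derivative_add form_fieldD(4) ring_distribs sum.distrib)

lemma form_field_wedge:
  assumes a: "form_field S k a" and b: "form_field S l b"
  shows "form_field S (k + l) (\<lambda>x. mform_wedge k l (a x) (b x))"
  unfolding form_field_def
proof (intro conjI ballI allI)
  show S: "open S" by (rule form_fieldD(1)[OF a])
  show "smooth_on S (\<lambda>x. mform_wedge k l (a x) (b x) v)" for v
    unfolding mform_wedge_def divide_inverse
    by (intro smooth_on_mult smooth_on_sum smooth_on_const form_fieldD(3)[OF a] form_fieldD(3)[OF b] S)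
qed (intro alternating_mform_wedge form_fieldD(2)[OF a] form_fieldD(2)[OF b])

text \<open>All terms of the expansion of \<open>t \<and> b\<close> contribute equally to the alternation, so it is enough
  to apply the product rule to one of them.\<close>

lemma coord_deriv_wedge_1:
  assumes t: "form_field S 1 t" and b: "form_field S l b" and x: "x \<in> S"
  shows "coord_deriv (Suc l) (\<lambda>y. mform_wedge 1 l (t y) (b y)) x v =
    mform_wedge 2 l (coord_deriv 1 t x) (b x) v - mform_wedge 1 (Suc l) (t x) (coord_deriv l b x) v"
proof -
  define Dt where "Dt h u = frechet_derivative (\<lambda>y. t y u) (at x) h" for h u
  define Db where "Db h u = frechet_derivative (\<lambda>y. b y u) (at x) h" for h u
  \<comment> \<open>The product rule for summand \<open>i\<close> of the wedge expansion,
    differentiated in direction \<open>v 0\<close>.\<close>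
  define T where "T i v = t x (\<lambda>_. v (Suc i)) * Db (v 0) (omit i (v \<circ> Suc)) +
     Dt (v 0) (\<lambda>_. v (Suc i)) * b x (omit i (v \<circ> Suc))" for i v
  note tm = alternating_imp_multilinear[OF form_fieldD(2)[OF t]]
  have wf: "form_field S (Suc l) (\<lambda>y. mform_wedge 1 l (t y) (b y))"
    using form_field_wedge[OF t b] by simp
  have D: "frechet_derivative (\<lambda>y. mform_wedge 1 l (t y) (b y) (u \<circ> Suc)) (at x) (u 0) = (\<Sum>i\<le>l. (- 1) ^ i * T i u)" for u
  proof -
    have "frechet_derivative (\<lambda>y. mform_wedge 1 l (t y) (b y) (u \<circ> Suc)) (at x) (u 0) =
      frechet_derivative (\<lambda>y. \<Sum>i\<le>l. (- 1) ^ i * (t y (\<lambda>_. u (Suc i)) * b y (omit i (u \<circ> Suc)))) (at x) (u 0)"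
      by (rule arg_cong[where f = "\<lambda>F. F (u 0)"], rule frechet_derivative_cong_open[OF form_fieldD(1)[OF t] x])
        (simp only: mform_wedge_1[OF tm form_fieldD(2)[OF b]], simp add: omit_def comp_def)
    also have "\<dots> = (\<Sum>i\<le>l. (- 1) ^ i * T i u)"
    proof -
      have "((\<lambda>y. \<Sum>i\<le>l. (- 1) ^ i * (t y (\<lambda>_. u (Suc i)) * b y (omit i (u \<circ> Suc)))) has_derivative
        (\<lambda>h. \<Sum>i\<le>l. (- 1) ^ i * (t x (\<lambda>_. u (Suc i)) * Db h (omit i (u \<circ> Suc)) +
           Dt h (\<lambda>_. u (Suc i)) * b x (omit i (u \<circ> Suc))))) (at x)"
        unfolding Dt_def Db_def
        by (intro has_derivative_sum has_derivative_mult_right has_derivative_mult frechet_derivative_worksI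
            form_fieldD(4)[OF t x] form_fieldD(4)[OF b x])
      from frechet_derivative_at_eq[OF this] show ?thesis by (simp add: T_def)
    qed
    finally show ?thesis .
  qed
  have AltT: "Alt (Suc (Suc l)) (T i) v = (- 1) ^ i * Alt (Suc (Suc l)) (T 0) v" if i: "i \<le> l" for i
  proof -
    \<comment> \<open>\<open>q\<close> fixes slot 0, the derivative direction, and brings the entry
      of slot i + 1 to slot 1.\<close>
    define q where "q = shift_perm 1 (cyc i)"
    have q: "q permutes {..<Suc (Suc l)}" "sign q = (- 1) ^ i"
      using shift_perm_permutes_sign[of "cyc i" "Suc l" 1] cyc_permutes_sign[OF i] by (auto simp: q_def)
    have "T i = (\<lambda>v. T 0 (v \<circ> q))"
    proof
      fix v :: "nat \<Rightarrow> 'a"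
      have "(v \<circ> q) 0 = v 0" "(v \<circ> q) (Suc 0) = v (Suc i)" "omit 0 (v \<circ> q \<circ> Suc) = omit i (v \<circ> Suc)"
        by (auto simp: q_def shift_perm_def cyc_eq omit_def fun_eq_iff)
      then show "T i v = T 0 (v \<circ> q)" by (simp add: T_def)
    qed
    then show ?thesis using Alt_permute[OF q(1), of "T 0" v] q(2) by simp
  qed
  have "coord_deriv (Suc l) (\<lambda>y. mform_wedge 1 l (t y) (b y)) x v =
      (\<Sum>i\<le>l. (- 1) ^ i * Alt (Suc (Suc l)) (T i) v) / fact (Suc l)"
    unfolding coord_deriv_eq_Alt[OF wf x] D by (simp only: Alt_sum Alt_scale)
  also have "(\<Sum>i\<le>l. (- 1) ^ i * Alt (Suc (Suc l)) (T i) v) = (\<Sum>i\<le>l. Alt (Suc (Suc l)) (T 0) v)"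
  proof (intro sum.cong refl)
    fix i assume "i \<in> {..l}"
    then have "i \<le> l" by simp
    show "(- 1) ^ i * Alt (Suc (Suc l)) (T i) v = Alt (Suc (Suc l)) (T 0) v"
      unfolding AltT[OF \<open>i \<le> l\<close>] mult.assoc[symmetric] minus_one_mult_self by simp
  qed
  \<comment> \<open>The l + 1 equal terms cancel one factor of (l + 1)!.\<close>
  also have "\<dots> / fact (Suc l) = Alt (Suc (Suc l)) (T 0) v / fact l"
    by simp
  finally have 1: "coord_deriv (Suc l) (\<lambda>y. mform_wedge 1 l (t y) (b y)) x v = Alt (Suc (Suc l)) (T 0) v / fact l" .
  define P where "P = (\<lambda>v. Dt (v 0) (v \<circ> Suc))"
  define Q where "Q = (\<lambda>v. Db (v 0) (v \<circ> Suc))"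
  have dt: "coord_deriv 1 t x = Alt 2 P"
    using coord_deriv_eq_Alt[OF t x] by (simp add: fun_eq_iff P_def Dt_def numeral_2_eq_2)
  have db: "coord_deriv l b x = (\<lambda>v. (1 / fact l) * Alt (Suc l) Q v)"
    using coord_deriv_eq_Alt[OF b x] by (simp add: fun_eq_iff Q_def Db_def)
  have 2: "mform_wedge 2 l (coord_deriv 1 t x) (b x) v = Alt (Suc (Suc l)) (tensor 2 P (b x)) v / fact l"
    unfolding dt mform_wedge_eq_Alt Alt_tensor_Alt_left by simp
  have "tensor 1 (t x) (\<lambda>v. (1 / fact l) * Alt (Suc l) Q v) = (\<lambda>v. (1 / fact l) * tensor 1 (t x) (Alt (Suc l) Q) v)"
    by (simp add: tensor_def fun_eq_iff)
  then have 3: "mform_wedge 1 (Suc l) (t x) (coord_deriv l b x) v = Alt (Suc (Suc l)) (tensor 1 (t x) Q) v / fact l"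
    unfolding db mform_wedge_eq_Alt by (simp only: Alt_scale Alt_tensor_Alt_right[OF tm[OF x]]) simp
  have tr: "Transposition.transpose 0 1 permutes {..<Suc (Suc l)}" by (rule permutes_swap_id) auto
  \<comment> \<open>Where \<open>b\<close> is differentiated, the argument of \<open>t\<close> has
    to precede the derivative direction; exchanging slots 0 and 1 produces the minus sign.\<close>
  have "T 0 = (\<lambda>v. tensor 2 P (b x) v + tensor 1 (t x) Q (v \<circ> Transposition.transpose 0 1))"
  proof
    fix v :: "nat \<Rightarrow> 'a"
    have "t x (v \<circ> Transposition.transpose 0 1) = t x (\<lambda>_. v 1)"
      by (rule multilinear_cong[OF tm[OF x]]) simp
    moreover have "Dt (v 0) (v \<circ> Suc) = Dt (v 0) (\<lambda>_. v 1)"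
      unfolding Dt_def by (rule alternating_cong[OF alternating_frechet_derivative[OF t x]]) simp
    moreover have "(\<lambda>i. (v \<circ> Transposition.transpose 0 1) (1 + i)) \<circ> Suc = omit 0 (v \<circ> Suc)"
      "(\<lambda>i. v (2 + i)) = omit 0 (v \<circ> Suc)"
      by (auto simp: fun_eq_iff omit_def)
    ultimately show "T 0 v = tensor 2 P (b x) v + tensor 1 (t x) Q (v \<circ> Transposition.transpose 0 1)"
      unfolding T_def tensor_def P_def Q_def by simp
  qed
  then have "Alt (Suc (Suc l)) (T 0) v = Alt (Suc (Suc l)) (tensor 2 P (b x)) v - Alt (Suc (Suc l)) (tensor 1 (t x) Q) v"
    by (simp only: Alt_add Alt_permute[OF tr]) (simp add: sign_swap_id)
  then show ?thesis unfolding 1 2 3 by (simp add: diff_divide_distrib)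
qed

text \<open>The product rule for a form whose base point and arguments vary together. The arguments
  are released one at a time: the next one is expanded in the basis, which by multilinearity leaves
  products of its scalar coordinates with values in which this argument is a constant basis vector,
  and to these the induction hypothesis applies.\<close>

lemma has_derivative_multilinear:
  fixes g :: "'e::euclidean_space \<Rightarrow> 'e mform" and \<tau> :: "'e \<Rightarrow> 'e"
  assumes g: "form_field T k g" and S: "open S" "x \<in> S" "\<tau> ` S \<subseteq> T"
    and \<tau>: "(\<tau> has_derivative \<tau>') (at x)"
    and w: "\<And>i. i < k \<Longrightarrow> (w i has_derivative w' i) (at x)"
  shows "((\<lambda>y. g (\<tau> y) (\<lambda>i. w i y)) has_derivative
    (\<lambda>h. frechet_derivative (\<lambda>y. g y (\<lambda>i. w i x)) (at (\<tau> x)) (\<tau>' h)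
       + (\<Sum>j<k. g (\<tau> x) ((\<lambda>i. w i x)(j := w' j h))))) (at x)"
proof -
  define D where "D h u = frechet_derivative (\<lambda>y. g y u) (at (\<tau> x)) h" for h u
  have \<tau>x: "\<tau> x \<in> T" using S by auto
  have D: "alternating k (D h)" for h
    unfolding D_def by (rule alternating_frechet_derivative[OF g \<tau>x])
  \<comment> \<open>The first \<open>m\<close> arguments vary with \<open>y\<close>, the others are
    frozen at \<open>u\<close>.\<close>
  define W where "W m u y = (\<lambda>i. if i < m then w i y else u i)" for m u y
  have "m \<le> k \<Longrightarrow> ((\<lambda>y. g (\<tau> y) (W m u y)) has_derivative
    (\<lambda>h. D (\<tau>' h) (W m u x) + (\<Sum>j<m. g (\<tau> x) ((W m u x)(j := w' j h))))) (at x)" for m u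
  proof (induction m arbitrary: u)
    case 0
    have "((\<lambda>y. g (\<tau> y) u) has_derivative (\<lambda>h. D (\<tau>' h) u)) (at x)"
      unfolding D_def
      using has_derivative_compose[OF \<tau> frechet_derivative_worksI[OF form_fieldD(4)[OF g \<tau>x]]] .
    then show ?case by (simp add: W_def)
  next
    case (Suc m)
    then have m: "m < k" by simp
    have W: "W (Suc m) u y = W m (u(m := w m y)) y" for y
      by (auto simp: W_def fun_eq_iff less_Suc_eq)
    have Wu: "W m (u(m := b)) y = (W m u y)(m := b)" for b y
      by (auto simp: W_def fun_eq_iff)
    have exp: "a (W m (u(m := z)) y) = (\<Sum>b\<in>Basis. (z \<bullet> b) * a (W m (u(m := b)) y))"
      if "alternating k a" for a z y
      unfolding Wu using linear_euclidean_sum[OF alternating_linear[OF that m]] by metis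
    have exp_upd: "g (\<tau> x) ((W m (u(m := z)) x)(j := c)) =
        (\<Sum>b\<in>Basis. (z \<bullet> b) * g (\<tau> x) ((W m (u(m := b)) x)(j := c)))" if "j < m" for z j c
    proof -
      have "(W m (u(m := b)) x)(j := c) = ((W m u x)(j := c))(m := b)" for b
        using that by (simp add: Wu fun_upd_twist)
      then show ?thesis
        using linear_euclidean_sum[OF alternating_linear[OF form_fieldD(2)[OF g \<tau>x] m]] by simp
    qed
    define G where "G b y = g (\<tau> y) (W m (u(m := b)) y)" for b y
    define G' where "G' b h = D (\<tau>' h) (W m (u(m := b)) x)
      + (\<Sum>j<m. g (\<tau> x) ((W m (u(m := b)) x)(j := w' j h)))" for b h
    have "((\<lambda>y. \<Sum>b\<in>Basis. (w m y \<bullet> b) * G b y) has_derivative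
        (\<lambda>h. \<Sum>b\<in>Basis. (w m x \<bullet> b) * G' b h + (w' m h \<bullet> b) * G b x)) (at x)"
      unfolding G_def G'_def
      by (intro has_derivative_sum has_derivative_mult has_derivative_inner_left[OF w[OF m]] Suc.IH)
        (use m in simp)
    moreover have "g (\<tau> y) (W (Suc m) u y) = (\<Sum>b\<in>Basis. (w m y \<bullet> b) * G b y)" if "y \<in> S" for y
      unfolding W G_def by (rule exp[OF form_fieldD(2)[OF g]]) (use that S in auto)
    ultimately have "((\<lambda>y. g (\<tau> y) (W (Suc m) u y)) has_derivative
        (\<lambda>h. \<Sum>b\<in>Basis. (w m x \<bullet> b) * G' b h + (w' m h \<bullet> b) * G b x)) (at x)"
      by (subst has_derivative_cong_open[OF S(1,2)]) auto
    moreover have "(\<Sum>b\<in>Basis. (w m x \<bullet> b) * G' b h + (w' m h \<bullet> b) * G b x) =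
       D (\<tau>' h) (W (Suc m) u x) + (\<Sum>j<Suc m. g (\<tau> x) ((W (Suc m) u x)(j := w' j h)))" for h
    proof -
      have "(\<Sum>b\<in>Basis. (w m x \<bullet> b) * G' b h) = D (\<tau>' h) (W (Suc m) u x)
          + (\<Sum>b\<in>Basis. \<Sum>j<m. (w m x \<bullet> b) * g (\<tau> x) ((W m (u(m := b)) x)(j := w' j h)))"
        unfolding G'_def W exp[OF D, of _ "w m x"] by (simp add: ring_distribs sum.distrib sum_distrib_left)
      also have "(\<Sum>b\<in>Basis. \<Sum>j<m. (w m x \<bullet> b) * g (\<tau> x) ((W m (u(m := b)) x)(j := w' j h))) =
          (\<Sum>j<m. g (\<tau> x) ((W (Suc m) u x)(j := w' j h)))"
        unfolding W by (subst sum.swap) (intro sum.cong refl, simp add: exp_upd[symmetric])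
      finally have 1: "(\<Sum>b\<in>Basis. (w m x \<bullet> b) * G' b h) = D (\<tau>' h) (W (Suc m) u x)
          + (\<Sum>j<m. g (\<tau> x) ((W (Suc m) u x)(j := w' j h)))" .
      have "(\<Sum>b\<in>Basis. (w' m h \<bullet> b) * G b x) = g (\<tau> x) (W m (u(m := w' m h)) x)"
        unfolding G_def by (rule exp[OF form_fieldD(2)[OF g \<tau>x], symmetric])
      also have "W m (u(m := w' m h)) x = (W (Suc m) u x)(m := w' m h)"
        by (simp add: W Wu)
      finally show ?thesis using 1 by (simp only: sum.distrib sum.lessThan_Suc add.assoc)
    qed
    ultimately show ?case by (simp only:)
  qed
  from this[of k "\<lambda>i. w i x"] have *: "((\<lambda>y. g (\<tau> y) (W k (\<lambda>i. w i x) y)) has_derivative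
    (\<lambda>h. D (\<tau>' h) (W k (\<lambda>i. w i x) x) + (\<Sum>j<k. g (\<tau> x) ((W k (\<lambda>i. w i x) x)(j := w' j h))))) (at x)"
    by simp
  have Wx: "W k (\<lambda>i. w i x) x = (\<lambda>i. w i x)" by (simp add: W_def)
  have eq: "g (\<tau> y) (W k (\<lambda>i. w i x) y) = g (\<tau> y) (\<lambda>i. w i y)" if "y \<in> S" for y
    by (rule alternating_cong[OF form_fieldD(2)[OF g]]) (use that S in \<open>auto simp: W_def\<close>)
  show ?thesis
    using * unfolding D_def Wx
    by (rule iffD2[OF has_derivative_cong_open[OF S(1,2), of "\<lambda>y. g (\<tau> y) (\<lambda>i. w i y)"
            "\<lambda>y. g (\<tau> y) (W k (\<lambda>i. w i x) y)"], rotated]) (rule eq[symmetric])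
qed

text \<open>The chain rule adds terms in which the Jacobian of \<open>\<tau>\<close> is
  differentiated. They contain its second derivative in the slots 0 and j + 1 and vanish under
  \<open>Alt\<close>.\<close>

lemma coord_deriv_pullback:
  fixes g :: "'e::euclidean_space \<Rightarrow> 'e mform" and \<tau> :: "'e \<Rightarrow> 'e"
  assumes f: "form_field S k f" and g: "form_field T k g"
    and S: "x \<in> S" "\<tau> ` S \<subseteq> T" and \<tau>: "smooth_on S \<tau>"
    and fg: "\<And>y v. y \<in> S \<Longrightarrow> f y v = g (\<tau> y) (\<lambda>i. frechet_derivative \<tau> (at y) (v i))"
  shows "coord_deriv k f x v = coord_deriv k g (\<tau> x) (\<lambda>i. frechet_derivative \<tau> (at x) (v i))"
proof -
  note open_S = form_fieldD(1)[OF f]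
  define J where "J = frechet_derivative \<tau> (at x)"
  define H where "H u h = frechet_derivative (\<lambda>y. frechet_derivative \<tau> (at y) u) (at x) h" for u h
  define R where "R j v = g (\<tau> x) ((\<lambda>i. J (v (Suc i)))(j := H (v (Suc j)) (v 0)))" for j v
  define P where "P v = frechet_derivative (\<lambda>y. g y (v \<circ> Suc)) (at (\<tau> x)) (v 0)" for v
  have \<tau>x: "\<tau> x \<in> T" using S by auto
  have "frechet_derivative (\<lambda>y. f y (u \<circ> Suc)) (at x) (u 0) = P (J \<circ> u) + (\<Sum>j<k. R j u)" for u
  proof -
    have "((\<lambda>y. g (\<tau> y) (\<lambda>i. frechet_derivative \<tau> (at y) ((u \<circ> Suc) i))) has_derivative
      (\<lambda>h. frechet_derivative (\<lambda>y. g y (\<lambda>i. J ((u \<circ> Suc) i))) (at (\<tau> x)) (J h)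
       + (\<Sum>j<k. g (\<tau> x) ((\<lambda>i. J ((u \<circ> Suc) i))(j := H ((u \<circ> Suc) j) h))))) (at x)"
      unfolding J_def H_def
      by (intro has_derivative_multilinear[OF g open_S S] frechet_derivative_worksI
          smooth_on_imp_differentiable[OF \<tau>] smooth_on_imp_differentiable[OF smooth_on_frechet_derivative[OF \<tau>]] S)
    then have "((\<lambda>y. f y (u \<circ> Suc)) has_derivative
      (\<lambda>h. frechet_derivative (\<lambda>y. g y (\<lambda>i. J ((u \<circ> Suc) i))) (at (\<tau> x)) (J h)
       + (\<Sum>j<k. g (\<tau> x) ((\<lambda>i. J ((u \<circ> Suc) i))(j := H ((u \<circ> Suc) j) h))))) (at x)"
      by (subst has_derivative_cong_open[OF open_S S(1) fg])
    then show ?thesis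
      by (simp add: frechet_derivative_at_eq P_def R_def comp_def)
  qed
  then have "coord_deriv k f x v = Alt (Suc k) (\<lambda>u. P (J \<circ> u) + (\<Sum>j<k. R j u)) v / fact k"
    unfolding coord_deriv_eq_Alt[OF f S(1)] by simp
  also have "\<dots> = Alt (Suc k) (\<lambda>u. P (J \<circ> u)) v / fact k"
  proof -
    have "Alt (Suc k) (R j) v = 0" if "j < k" for j
    proof (rule Alt_symmetric_eq_0[of _ 0 "Suc j"])
      fix u :: "nat \<Rightarrow> 'e"
      have "H (u (Suc j)) (u 0) = H (u 0) (u (Suc j))"
        unfolding H_def by (rule frechet_derivative_commute[OF open_S S(1) \<tau>])
      then show "R j (u \<circ> Transposition.transpose 0 (Suc j)) = R j u"
        unfolding R_def by (intro arg_cong[where f = "g (\<tau> x)"])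
          (auto simp: fun_eq_iff Transposition.transpose_def)
    qed (use that in auto)
    then show ?thesis by (simp add: Alt_add Alt_sum)
  qed
  also have "Alt (Suc k) (\<lambda>u. P (J \<circ> u)) v = Alt (Suc k) P (J \<circ> v)"
    by (simp add: Alt_def comp_assoc)
  also have "\<dots> / fact k = coord_deriv k g (\<tau> x) (J \<circ> v)"
    unfolding coord_deriv_eq_Alt[OF g \<tau>x] P_def ..
  finally show ?thesis by (simp add: J_def comp_def)
qed

section \<open>Differential forms on manifolds\<close>

lemma form_field_cong:
  assumes "form_field S k f" "\<And>x. x \<in> S \<Longrightarrow> f x = g x"
  shows "form_field S k g"
proof -
  have "smooth_on S (\<lambda>x. f x v) \<longleftrightarrow> smooth_on S (\<lambda>x. g x v)" for v
    by (rule smooth_on_cong[OF form_fieldD(1)[OF assms(1)]]) (simp add: assms(2))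
  then show ?thesis using assms by (simp add: form_field_def)
qed

lemma form_field_mono: "form_field S k f \<Longrightarrow> open T \<Longrightarrow> T \<subseteq> S \<Longrightarrow> form_field T k f"
  unfolding form_field_def using smooth_on_mono_set by blast

lemma form_field_add:
  assumes f: "form_field S k f" and g: "form_field S k g"
  shows "form_field S k (\<lambda>x v. f x v + g x v)"
  unfolding form_field_def
  by (intro conjI ballI allI alternating_add smooth_on_add form_fieldD[OF f] form_fieldD[OF g])

lemma form_field_scale:
  assumes f: "form_field S k f"
  shows "form_field S k (\<lambda>x v. r * f x v)"
  unfolding form_field_def
  by (intro conjI ballI allI alternating_scale smooth_on_mult smooth_on_const form_fieldD[OF f])

definition rep :: "('m, 'e) chart \<Rightarrow> ('m, 'e) dform \<Rightarrow> 'e \<Rightarrow> 'e mform" where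
  "rep c \<omega> x = \<omega> (chart_inv c x) c"

locale manifold =
  fixes M :: "'m topology" and A :: "('m, 'e::euclidean_space) chart set"
  assumes smooth_manifold: "smooth_manifold M A"
begin

lemma openin_chart: "c \<in> A \<Longrightarrow> openin M (fst c)"
  using smooth_manifold by (simp add: smooth_manifold_def)

lemma homeomorphic_chart:
  "c \<in> A \<Longrightarrow> homeomorphic_map (subtopology M (fst c)) (top_of_set (snd c ` fst c)) (snd c)"
  using smooth_manifold by (simp add: smooth_manifold_def)

lemma open_chart_image:
  assumes c: "c \<in> A" and U: "openin M U"
  shows "open (snd c ` (U \<inter> fst c))"
proof -
  have "openin (subtopology M (fst c)) (U \<inter> fst c)"
    using U by (auto simp: openin_subtopology)
  then have "openin (top_of_set (snd c ` fst c)) (snd c ` (U \<inter> fst c))"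
    using homeomorphic_imp_open_map[OF homeomorphic_chart[OF c]] by (auto simp: open_map_def)
  moreover have "open (snd c ` fst c)"
    using smooth_manifold c by (simp add: smooth_manifold_def)
  ultimately show ?thesis using openin_open_trans by blast
qed

lemma chart_inv: 
  assumes c: "c \<in> A" and p: "p \<in> fst c"
  shows "chart_inv c (snd c p) = p"
proof -
  have "inj_on (snd c) (topspace (subtopology M (fst c)))"
    using homeomorphic_imp_injective_map[OF homeomorphic_chart[OF c]] .
  then have "inj_on (snd c) (fst c)"
    using openin_subset[OF openin_chart[OF c]] by (simp add: Int_absorb1 inf_commute)
  then show ?thesis using p by (simp add: chart_inv_def)
qed

lemma rep_chart: "c \<in> A \<Longrightarrow> p \<in> fst c \<Longrightarrow> rep c \<omega> (snd c p) = \<omega> p c"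
  by (simp add: rep_def chart_inv)

lemma
  assumes "\<omega> \<in> forms A U k"
  shows forms_alternating: "p \<in> U \<Longrightarrow> c \<in> A \<Longrightarrow> p \<in> fst c \<Longrightarrow> alternating k (\<omega> p c)"
    and forms_eq_0: "\<not> (p \<in> U \<and> c \<in> A \<and> p \<in> fst c) \<Longrightarrow> \<omega> p c v = 0"
    and forms_compat: "p \<in> U \<Longrightarrow> c \<in> A \<Longrightarrow> c' \<in> A \<Longrightarrow> p \<in> fst c \<Longrightarrow> p \<in> fst c' \<Longrightarrow>
      \<omega> p c v = \<omega> p c' (\<lambda>i. frechet_derivative (transition c c') (at (snd c p)) (v i))"
    and forms_smooth: "c \<in> A \<Longrightarrow> smooth_on (snd c ` (U \<inter> fst c)) (\<lambda>x. \<omega> (chart_inv c x) c v)"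
proof -
  have "if p \<in> U then \<omega> p \<in> ext_cotangent A k p else \<omega> p = 0" for p
    using assms by (simp add: forms_def)
  then have *: "p \<in> U \<Longrightarrow> \<omega> p \<in> ext_cotangent A k p" "p \<notin> U \<Longrightarrow> \<omega> p = 0" for p by metis+
  have **: "if c \<in> A \<and> p \<in> fst c then alternating k (\<omega> p c) else \<omega> p c = 0" if "p \<in> U" for p c
    using *(1)[OF that] unfolding ext_cotangent_def by blast
  show "p \<in> U \<Longrightarrow> c \<in> A \<Longrightarrow> p \<in> fst c \<Longrightarrow> alternating k (\<omega> p c)"
    using **[of p c] by simp
  show "\<not> (p \<in> U \<and> c \<in> A \<and> p \<in> fst c) \<Longrightarrow> \<omega> p c v = 0"
    using **[of p c] *(2)[of p] by (cases "p \<in> U") (auto split: if_splits)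
  show "p \<in> U \<Longrightarrow> c \<in> A \<Longrightarrow> c' \<in> A \<Longrightarrow> p \<in> fst c \<Longrightarrow> p \<in> fst c' \<Longrightarrow>
      \<omega> p c v = \<omega> p c' (\<lambda>i. frechet_derivative (transition c c') (at (snd c p)) (v i))"
    using *(1)[of p] unfolding ext_cotangent_def by blast
  show "c \<in> A \<Longrightarrow> smooth_on (snd c ` (U \<inter> fst c)) (\<lambda>x. \<omega> (chart_inv c x) c v)"
    using assms by (simp add: forms_def)
qed

lemma form_field_rep:
  assumes \<omega>: "\<omega> \<in> forms A U k" and U: "openin M U" and c: "c \<in> A"
  shows "form_field (snd c ` (U \<inter> fst c)) k (rep c \<omega>)"
  unfolding form_field_def
proof (intro conjI ballI allI)
  show "smooth_on (snd c ` (U \<inter> fst c)) (\<lambda>x. rep c \<omega> x v)" for v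
    using forms_smooth[OF \<omega> c] by (simp add: rep_def)
qed (use forms_alternating[OF \<omega> _ c] open_chart_image[OF c U] rep_chart[OF c] in auto)

lemma formsI:
  assumes field: "\<And>c. c \<in> A \<Longrightarrow> form_field (snd c ` (U \<inter> fst c)) k (rep c \<omega>)"
    and 0: "\<And>p c v. \<not> (p \<in> U \<and> c \<in> A \<and> p \<in> fst c) \<Longrightarrow> \<omega> p c v = 0"
    and compat: "\<And>p c c' v. p \<in> U \<Longrightarrow> c \<in> A \<Longrightarrow> c' \<in> A \<Longrightarrow> p \<in> fst c \<Longrightarrow> p \<in> fst c' \<Longrightarrow>
      \<omega> p c v = \<omega> p c' (\<lambda>i. frechet_derivative (transition c c') (at (snd c p)) (v i))"
  shows "\<omega> \<in> forms A U k"
proof -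
  have alt: "alternating k (\<omega> p c)" if "p \<in> U" "c \<in> A" "p \<in> fst c" for p c
    using form_fieldD(2)[OF field[OF that(2)], of "snd c p"] rep_chart that by auto
  have zero: "\<omega> p c = 0" if "\<not> (p \<in> U \<and> c \<in> A \<and> p \<in> fst c)" for p c
    using 0[OF that] by (simp add: fun_eq_iff)
  have "\<omega> p \<in> ext_cotangent A k p" if p: "p \<in> U" for p
    unfolding ext_cotangent_def mem_Collect_eq
  proof (intro conjI allI ballI impI)
    show "if c \<in> A \<and> p \<in> fst c then alternating k (\<omega> p c) else \<omega> p c = 0" for c
      using alt[OF p, of c] zero[of p c] by simp
    show "\<omega> p c v = \<omega> p c' (\<lambda>i. frechet_derivative (transition c c') (at (snd c p)) (v i))"
      if "c \<in> A" "c' \<in> A" "p \<in> fst c \<inter> fst c'" for c c' v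
      by (rule compat) (use that p in simp_all)
  qed
  moreover have "\<omega> p = 0" if "p \<notin> U" for p
    using 0[of p] that by (intro ext) simp
  moreover have "smooth_on (snd c ` (U \<inter> fst c)) (\<lambda>x. \<omega> (chart_inv c x) c v)" if "c \<in> A" for c v
    using form_fieldD(3)[OF field[OF that]] by (simp add: rep_def)
  ultimately show ?thesis by (simp add: forms_def)
qed

lemma forms_0: "openin M U \<Longrightarrow> 0 \<in> forms A U k"
  by (rule formsI) (auto simp: form_field_def rep_def alternating_0 smooth_on_const open_chart_image func_zero)

lemma forms_add:
  assumes U: "openin M U" and a: "\<alpha> \<in> forms A U k" and b: "\<beta> \<in> forms A U k"
  shows "\<alpha> + \<beta> \<in> forms A U k"
proof (rule formsI)
  fix c assume c: "c \<in> A"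
  show "form_field (snd c ` (U \<inter> fst c)) k (rep c (\<alpha> + \<beta>))"
    using form_field_add[OF form_field_rep[OF a U c] form_field_rep[OF b U c]]
    by (rule form_field_cong) (simp add: rep_def fun_eq_iff)
next
  fix p c v assume "\<not> (p \<in> U \<and> c \<in> A \<and> p \<in> fst c)"
  then show "(\<alpha> + \<beta>) p c v = 0" using forms_eq_0[OF a] forms_eq_0[OF b] by (simp add: func_plus)
next
  fix p c c' v assume p: "p \<in> U" "c \<in> A" "c' \<in> A" "p \<in> fst c" "p \<in> fst c'"
  show "(\<alpha> + \<beta>) p c v = (\<alpha> + \<beta>) p c' (\<lambda>i. frechet_derivative (transition c c') (at (snd c p)) (v i))"
    unfolding func_plus forms_compat[OF a p, of v] forms_compat[OF b p, of v] ..
qed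

lemma forms_minus:
  assumes U: "openin M U" and a: "\<alpha> \<in> forms A U k"
  shows "(\<lambda>p c v. - \<alpha> p c v) \<in> forms A U k"
proof (rule formsI)
  fix c assume c: "c \<in> A"
  show "form_field (snd c ` (U \<inter> fst c)) k (rep c (\<lambda>p c v. - \<alpha> p c v))"
    using form_field_scale[OF form_field_rep[OF a U c], of "- 1"]
    by (rule form_field_cong) (simp add: rep_def fun_eq_iff)
next
  fix p c v assume "\<not> (p \<in> U \<and> c \<in> A \<and> p \<in> fst c)"
  then show "- \<alpha> p c v = 0" using forms_eq_0[OF a] by simp
next
  fix p c c' v assume p: "p \<in> U" "c \<in> A" "c' \<in> A" "p \<in> fst c" "p \<in> fst c'"
  show "- \<alpha> p c v = - \<alpha> p c' (\<lambda>i. frechet_derivative (transition c c') (at (snd c p)) (v i))"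
    unfolding forms_compat[OF a p, of v] ..
qed

lemma forms_diff:
  assumes U: "openin M U" and a: "\<alpha> \<in> forms A U k" and b: "\<beta> \<in> forms A U k"
  shows "\<alpha> - \<beta> \<in> forms A U k"
proof -
  have "\<alpha> - \<beta> = \<alpha> + (\<lambda>p c v. - \<beta> p c v)" by (auto simp: fun_eq_iff)
  then show ?thesis using forms_add[OF U a forms_minus[OF U b]] by (simp only:)
qed

lemma forms_wedge:
  assumes U: "openin M U" and a: "\<alpha> \<in> forms A U k" and b: "\<beta> \<in> forms A U l"
  shows "wedge k l \<alpha> \<beta> \<in> forms A U (k + l)"
proof (rule formsI)
  fix c assume c: "c \<in> A"
  show "form_field (snd c ` (U \<inter> fst c)) (k + l) (rep c (wedge k l \<alpha> \<beta>))"
    using form_field_wedge[OF form_field_rep[OF a U c] form_field_rep[OF b U c]]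
    by (rule form_field_cong) (simp add: rep_def wedge_def)
next
  fix p c v assume "\<not> (p \<in> U \<and> c \<in> A \<and> p \<in> fst c)"
  then have "\<alpha> p c = (\<lambda>v. 0)" using forms_eq_0[OF a] by blast
  then show "wedge k l \<alpha> \<beta> p c v = 0" by (simp add: wedge_def mform_wedge_0_left)
next
  fix p c c' v assume p: "p \<in> U" "c \<in> A" "c' \<in> A" "p \<in> fst c" "p \<in> fst c'"
  show "wedge k l \<alpha> \<beta> p c v = wedge k l \<alpha> \<beta> p c' (\<lambda>i. frechet_derivative (transition c c') (at (snd c p)) (v i))"
    unfolding wedge_def mform_wedge_def forms_compat[OF a p] forms_compat[OF b p] by (simp add: comp_def)
qed

text \<open>Alternation and compatibility are conditions at a point and smoothness is local, so
  agreement with some form near every point suffices.\<close>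

lemma forms_glue:
  assumes loc: "\<And>p. p \<in> topspace M \<Longrightarrow>
      \<exists>U \<alpha>. openin M U \<and> p \<in> U \<and> \<alpha> \<in> forms A U k \<and> (\<forall>q\<in>U. \<omega> q = \<alpha> q)"
    and out: "\<And>p. p \<notin> topspace M \<Longrightarrow> \<omega> p = 0"
  shows "\<omega> \<in> forms A (topspace M) k"
proof (rule formsI)
  fix c assume c: "c \<in> A"
  have sub: "fst c \<subseteq> topspace M" using openin_subset[OF openin_chart[OF c]] .
  show "form_field (snd c ` (topspace M \<inter> fst c)) k (rep c \<omega>)"
    unfolding form_field_def
  proof (intro conjI ballI allI)
    show "open (snd c ` (topspace M \<inter> fst c))" using open_chart_image[OF c] by blast
    show "alternating k (rep c \<omega> x)" if x: "x \<in> snd c ` (topspace M \<inter> fst c)" for x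
    proof -
      obtain p where p: "p \<in> topspace M" "p \<in> fst c" "x = snd c p" using x by auto
      obtain U \<alpha> where U: "p \<in> U" "\<alpha> \<in> forms A U k" "\<omega> p = \<alpha> p" using loc[OF p(1)] by blast
      show ?thesis using forms_alternating[OF U(2,1) c p(2)] p c U(3) by (simp add: rep_chart)
    qed
    show "smooth_on (snd c ` (topspace M \<inter> fst c)) (\<lambda>x. rep c \<omega> x v)" for v
    proof (rule smooth_on_local)
      fix x assume "x \<in> snd c ` (topspace M \<inter> fst c)"
      then obtain p where p: "p \<in> topspace M" "p \<in> fst c" "x = snd c p" by auto
      obtain U \<alpha> where U: "openin M U" "p \<in> U" "\<alpha> \<in> forms A U k" "\<forall>q\<in>U. \<omega> q = \<alpha> q"
        using loc[OF p(1)] by blast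
      have op: "open (snd c ` (U \<inter> fst c))" by (rule open_chart_image[OF c U(1)])
      have "smooth_on (snd c ` (U \<inter> fst c)) (\<lambda>x. \<alpha> (chart_inv c x) c v) \<longleftrightarrow>
          smooth_on (snd c ` (U \<inter> fst c)) (\<lambda>x. rep c \<omega> x v)"
        by (rule smooth_on_cong[OF op]) (use U(4) chart_inv[OF c] in \<open>auto simp: rep_def\<close>)
      then have "smooth_on (snd c ` (U \<inter> fst c)) (\<lambda>x. rep c \<omega> x v)"
        using forms_smooth[OF U(3) c] by simp
      then show "\<exists>T. open T \<and> x \<in> T \<and> smooth_on T (\<lambda>x. rep c \<omega> x v)"
        using op p U(2) by blast
    qed
  qed
next
  fix p c v assume n: "\<not> (p \<in> topspace M \<and> c \<in> A \<and> p \<in> fst c)"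
  show "\<omega> p c v = 0"
  proof (cases "p \<in> topspace M")
    case True
    obtain U \<alpha> where U: "openin M U" "p \<in> U" "\<alpha> \<in> forms A U k" "\<omega> p = \<alpha> p"
      using loc[OF True] by blast
    then show ?thesis using forms_eq_0[OF U(3)] n True by metis
  qed (simp add: out)
next
  fix p c c' v assume p: "p \<in> topspace M" "c \<in> A" "c' \<in> A" "p \<in> fst c" "p \<in> fst c'"
  obtain U \<alpha> where U: "p \<in> U" "\<alpha> \<in> forms A U k" "\<omega> p = \<alpha> p" using loc[OF p(1)] by blast
  show "\<omega> p c v = \<omega> p c' (\<lambda>i. frechet_derivative (transition c c') (at (snd c p)) (v i))"
    unfolding U(3) by (rule forms_compat[OF U(2,1) p(2-)])
qed

section \<open>The exterior derivative on a manifold\<close>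

lemma ext_deriv_eq:
  "p \<in> U \<Longrightarrow> c \<in> A \<Longrightarrow> p \<in> fst c \<Longrightarrow> ext_deriv A U k \<omega> p c = coord_deriv k (rep c \<omega>) (snd c p)"
  by (simp add: ext_deriv_def coord_deriv_def rep_def omit_def fun_eq_iff)

lemma ext_deriv_eq_0: "\<not> (p \<in> U \<and> c \<in> A \<and> p \<in> fst c) \<Longrightarrow> ext_deriv A U k \<omega> p c = (\<lambda>v. 0)"
  unfolding ext_deriv_def by (simp only: if_False)

text \<open>The open set in \<open>ext_deriv\<close> only determines where the result is set to 0,
  so derivatives taken over different sets can be compared.\<close>

lemma ext_deriv_local:
  assumes V: "openin M V" "p \<in> V" "V \<subseteq> U" "V \<subseteq> U'" and eq: "\<And>q. q \<in> V \<Longrightarrow> \<omega> q = \<omega>' q"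
  shows "ext_deriv A U k \<omega> p = ext_deriv A U' k \<omega>' p"
proof
  fix c
  show "ext_deriv A U k \<omega> p c = ext_deriv A U' k \<omega>' p c"
  proof (cases "c \<in> A \<and> p \<in> fst c")
    case True
    then have c: "c \<in> A" "p \<in> fst c" by auto
    have "coord_deriv k (rep c \<omega>) (snd c p) = coord_deriv k (rep c \<omega>') (snd c p)"
      by (rule coord_deriv_cong[OF open_chart_image[OF c(1) V(1)]])
        (use V c eq chart_inv[OF c(1)] in \<open>auto simp: rep_def\<close>)
    then show ?thesis using V c ext_deriv_eq[of p _ c] by (metis subsetD)
  next
    case False
    then show ?thesis using ext_deriv_eq_0[of p _ c] by metis
  qed
qed

lemma rep_ext_deriv:
  assumes "c \<in> A" "x \<in> snd c ` (U \<inter> fst c)"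
  shows "rep c (ext_deriv A U k \<omega>) x = coord_deriv k (rep c \<omega>) x"
  using assms by (auto simp: rep_chart ext_deriv_eq)

text \<open>Compatibility between charts is \<open>coord_deriv_pullback\<close> for the transition
  map.\<close>

lemma forms_ext_deriv:
  assumes U: "openin M U" and a: "\<omega> \<in> forms A U k"
  shows "ext_deriv A U k \<omega> \<in> forms A U (Suc k)"
proof (rule formsI)
  fix c assume c: "c \<in> A"
  show "form_field (snd c ` (U \<inter> fst c)) (Suc k) (rep c (ext_deriv A U k \<omega>))"
    by (rule form_field_cong[OF form_field_coord_deriv[OF form_field_rep[OF a U c]]])
      (simp add: rep_ext_deriv c)
next
  fix p c v assume "\<not> (p \<in> U \<and> c \<in> A \<and> p \<in> fst c)"
  then show "ext_deriv A U k \<omega> p c v = 0" using ext_deriv_eq_0 by metis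
next
  fix p c c' v assume p: "p \<in> U" "c \<in> A" "c' \<in> A" "p \<in> fst c" "p \<in> fst c'"
  define S where "S = snd c ` (U \<inter> fst c' \<inter> fst c)"
  define T where "T = snd c' ` (U \<inter> fst c')"
  define \<tau> where "\<tau> = transition c c'"
  have tau: "\<tau> (snd c q) = snd c' q" if "q \<in> fst c" for q
    using chart_inv[OF p(2) that] by (simp add: \<tau>_def transition_def)
  have "openin M (U \<inter> fst c')" by (intro openin_Int U openin_chart p)
  then have f: "form_field S k (rep c \<omega>)"
    unfolding S_def by (intro form_field_mono[OF form_field_rep[OF a U p(2)]] open_chart_image p) auto
  have g: "form_field T k (rep c' \<omega>)"
    unfolding T_def by (rule form_field_rep[OF a U p(3)])
  have pS: "snd c p \<in> S" using p by (auto simp: S_def)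
  have ST: "\<tau> ` S \<subseteq> T" using tau by (auto simp: S_def T_def)
  have "smooth_on (snd c ` (fst c \<inter> fst c')) \<tau>"
    unfolding \<tau>_def using smooth_manifold p by (simp add: smooth_manifold_def)
  then have sm: "smooth_on S \<tau>" by (rule smooth_on_mono_set) (auto simp: S_def)
  have fg: "rep c \<omega> y u = rep c' \<omega> (\<tau> y) (\<lambda>i. frechet_derivative \<tau> (at y) (u i))" if y: "y \<in> S" for y u
  proof -
    obtain q where q: "q \<in> U" "q \<in> fst c" "q \<in> fst c'" "y = snd c q" using y by (auto simp: S_def)
    show ?thesis
      unfolding q(4) tau[OF q(2)] rep_chart[OF p(2) q(2)] rep_chart[OF p(3) q(3)]
      unfolding \<tau>_def by (rule forms_compat[OF a q(1) p(2,3) q(2,3)])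
  qed
  have "coord_deriv k (rep c \<omega>) (snd c p) v =
      coord_deriv k (rep c' \<omega>) (snd c' p) (\<lambda>i. frechet_derivative \<tau> (at (snd c p)) (v i))"
    using coord_deriv_pullback[OF f g pS ST sm fg] tau[OF p(4)] by simp
  then show "ext_deriv A U k \<omega> p c v = ext_deriv A U k \<omega> p c' (\<lambda>i. frechet_derivative (transition c c') (at (snd c p)) (v i))"
    unfolding ext_deriv_eq[OF p(1,2,4)] ext_deriv_eq[OF p(1,3,5)] \<tau>_def .
qed

lemma ext_deriv_ext_deriv:
  assumes U: "openin M U" and a: "\<omega> \<in> forms A U k"
  shows "ext_deriv A U (Suc k) (ext_deriv A U k \<omega>) = 0"
proof (intro ext)
  fix p c v
  show "ext_deriv A U (Suc k) (ext_deriv A U k \<omega>) p c v = 0 p c v"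
  proof (cases "p \<in> U \<and> c \<in> A \<and> p \<in> fst c")
    case True
    then have p: "p \<in> U" "c \<in> A" "p \<in> fst c" by auto
    then have x: "snd c p \<in> snd c ` (U \<inter> fst c)" by auto
    have "coord_deriv (Suc k) (rep c (ext_deriv A U k \<omega>)) (snd c p) =
        coord_deriv (Suc k) (coord_deriv k (rep c \<omega>)) (snd c p)"
      by (rule coord_deriv_cong[OF open_chart_image[OF p(2) U] x rep_ext_deriv[OF p(2)]])
    then show ?thesis
      using coord_deriv_coord_deriv[OF form_field_rep[OF a U p(2)] x] by (simp add: ext_deriv_eq[OF p])
  next
    case False
    then show ?thesis using ext_deriv_eq_0[OF False] by simp
  qed
qed

lemma ext_deriv_add:
  assumes U: "openin M U" and a: "\<alpha> \<in> forms A U k" and b: "\<beta> \<in> forms A U k"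
  shows "ext_deriv A U k (\<alpha> + \<beta>) = ext_deriv A U k \<alpha> + ext_deriv A U k \<beta>"
proof (intro ext)
  fix p c v
  show "ext_deriv A U k (\<alpha> + \<beta>) p c v = (ext_deriv A U k \<alpha> + ext_deriv A U k \<beta>) p c v"
  proof (cases "p \<in> U \<and> c \<in> A \<and> p \<in> fst c")
    case True
    then have p: "p \<in> U" "c \<in> A" "p \<in> fst c" by auto
    then have x: "snd c p \<in> snd c ` (U \<inter> fst c)" by auto
    have "rep c (\<alpha> + \<beta>) = (\<lambda>y v. rep c \<alpha> y v + rep c \<beta> y v)" by (simp add: rep_def fun_eq_iff)
    then show ?thesis
      using coord_deriv_add[OF form_field_rep[OF a U p(2)] form_field_rep[OF b U p(2)] x, of v]
      by (simp add: ext_deriv_eq[OF p])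
  next
    case False
    then show ?thesis by (simp add: ext_deriv_eq_0[OF False])
  qed
qed

lemma ext_deriv_diff:
  assumes U: "openin M U" and a: "\<alpha> \<in> forms A U k" and b: "\<beta> \<in> forms A U k"
  shows "ext_deriv A U k (\<alpha> - \<beta>) = ext_deriv A U k \<alpha> - ext_deriv A U k \<beta>"
  using ext_deriv_add[OF U forms_diff[OF U a b] b] by (simp add: fun_eq_iff)

lemma ext_deriv_wedge_1:
  assumes U: "openin M U" and t: "\<theta> \<in> forms A U 1" and b: "\<beta> \<in> forms A U l"
  shows "ext_deriv A U (Suc l) (wedge 1 l \<theta> \<beta>) =
    wedge 2 l (ext_deriv A U 1 \<theta>) \<beta> - wedge 1 (Suc l) \<theta> (ext_deriv A U l \<beta>)"
proof (intro ext)
  fix p c v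
  show "ext_deriv A U (Suc l) (wedge 1 l \<theta> \<beta>) p c v =
    (wedge 2 l (ext_deriv A U 1 \<theta>) \<beta> - wedge 1 (Suc l) \<theta> (ext_deriv A U l \<beta>)) p c v"
  proof (cases "p \<in> U \<and> c \<in> A \<and> p \<in> fst c")
    case True
    then have p: "p \<in> U" "c \<in> A" "p \<in> fst c" by auto
    then have x: "snd c p \<in> snd c ` (U \<inter> fst c)" by auto
    have "rep c (wedge 1 l \<theta> \<beta>) = (\<lambda>y. mform_wedge 1 l (rep c \<theta> y) (rep c \<beta> y))"
      by (simp add: rep_def wedge_def fun_eq_iff)
    then show ?thesis
      using coord_deriv_wedge_1[OF form_field_rep[OF t U p(2)] form_field_rep[OF b U p(2)] x, of v]
      unfolding wedge_def minus_apply ext_deriv_eq[OF p] rep_chart[OF p(2,3)] by simp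
  next
    case False
    then have "\<theta> p c = (\<lambda>v. 0)" using forms_eq_0[OF t] by blast
    then show ?thesis
      unfolding wedge_def minus_apply ext_deriv_eq_0[OF False] by (simp add: mform_wedge_0_left)
  qed
qed

end

section \<open>Contact manifolds\<close>

lemma wedge_add_right: "wedge k l \<theta> (\<alpha> + \<beta>) = wedge k l \<theta> \<alpha> + wedge k l \<theta> \<beta>"
  unfolding wedge_def func_plus mform_wedge_add_right[symmetric] ..

lemma wedge_0_right: "wedge k l \<theta> 0 = 0"
  unfolding wedge_def func_zero mform_wedge_0_right ..

lemma wedge_power_left_eq_wedge_pow:
  "wedge_power_left 1 \<theta> 2 \<omega> m p c = wedge_pow (\<theta> p c) (\<omega> p c) m"
  by (induction m) (simp_all add: wedge_def)

text \<open>The factor is only given point by point. Near \<open>x\<close> it is the quotient of the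
  two values at an argument \<open>v0\<close> with \<open>t x v0 \<noteq> 0\<close>, hence
  differentiable at \<open>x\<close>, and \<open>\<eta>\<close> is its differential.\<close>

lemma coord_deriv_multiple:
  assumes t: "form_field S 1 t" and t': "form_field S 1 t'" and x: "x \<in> S" and nz: "t x \<noteq> (\<lambda>_. 0)"
    and mult: "\<And>y. y \<in> S \<Longrightarrow> \<exists>r. \<forall>v. t' y v = r * t y v"
  obtains r \<eta> where "alternating 1 \<eta>" "t' x = (\<lambda>v. r * t x v)"
    "coord_deriv 1 t' x = (\<lambda>v. mform_wedge 1 1 \<eta> (t x) v + r * coord_deriv 1 t x v)"
proof -
  obtain v0 where v0: "t x v0 \<noteq> 0" using nz by auto
  define \<phi> where "\<phi> y = t' y v0 / t y v0" for y
  define S' where "S' = S \<inter> (\<lambda>y. t y v0) -` (- {0})"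
  have S': "open S'"
    unfolding S'_def
    by (intro continuous_open_preimage smooth_on_imp_continuous_on form_fieldD[OF t]) auto
  have xS': "x \<in> S'" using x v0 by (simp add: S'_def)
  have eq: "t' y v = \<phi> y * t y v" if y: "y \<in> S'" for y v
  proof -
    obtain r where r: "\<forall>v. t' y v = r * t y v" using mult y by (auto simp: S'_def)
    then show ?thesis using y by (simp add: \<phi>_def S'_def)
  qed
  have d\<phi>: "\<phi> differentiable (at x)"
    unfolding \<phi>_def by (intro differentiable_divide form_fieldD(4)[OF t x] form_fieldD(4)[OF t' x] v0)
  define \<eta> where "\<eta> v = frechet_derivative \<phi> (at x) (v 0)" for v :: "nat \<Rightarrow> 'a"
  have \<eta>: "alternating 1 \<eta>"
    by (rule alternatingI) (auto simp: \<eta>_def linear_frechet_derivative[OF d\<phi>])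
  have D: "frechet_derivative (\<lambda>y. t' y u) (at x) h =
      \<phi> x * frechet_derivative (\<lambda>y. t y u) (at x) h + frechet_derivative \<phi> (at x) h * t x u" for u h
  proof -
    have "frechet_derivative (\<lambda>y. t' y u) (at x) = frechet_derivative (\<lambda>y. \<phi> y * t y u) (at x)"
      by (rule frechet_derivative_cong_open[OF S' xS' eq])
    then show ?thesis using frechet_derivative_mult[OF d\<phi> form_fieldD(4)[OF t x]] by simp
  qed
  have "coord_deriv 1 t' x v = mform_wedge 1 1 \<eta> (t x) v + \<phi> x * coord_deriv 1 t x v" for v
    unfolding mform_wedge_1[OF alternating_imp_multilinear[OF \<eta>] form_fieldD(2)[OF t x]] coord_deriv_def D
      sum_distrib_left sum.distrib[symmetric]
    by (intro sum.cong refl) (simp add: \<eta>_def ring_distribs)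
  then show thesis using that[OF \<eta>, of "\<phi> x"] eq[OF xS'] by blast
qed

context manifold
begin

lemma forms_alternating':
  assumes "\<omega> \<in> forms A U k"
  shows "alternating k (\<omega> p c)"
proof (cases "p \<in> U \<and> c \<in> A \<and> p \<in> fst c")
  case False
  then have "\<omega> p c = (\<lambda>v. 0)" using forms_eq_0[OF assms] by blast
  then show ?thesis by (simp add: alternating_0)
qed (use forms_alternating[OF assms] in blast)

text \<open>Compatibility expresses the component in any other chart around \<open>p\<close> through
  the one at \<open>c\<close>.\<close>

lemma forms_nonzero_chart:
  assumes \<omega>: "\<omega> \<in> forms A U k" and p: "p \<in> U" "c \<in> A" "p \<in> fst c" and nz: "\<omega> p \<noteq> 0"
  shows "\<omega> p c \<noteq> (\<lambda>_. 0)"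
proof
  assume 0: "\<omega> p c = (\<lambda>_. 0)"
  have "\<omega> p c' v = 0" for c' v
  proof (cases "c' \<in> A \<and> p \<in> fst c'")
    case True
    then show ?thesis using forms_compat[OF \<omega> p(1) _ p(2) _ p(3), of c' v] 0 by simp
  next
    case False
    then show ?thesis by (intro forms_eq_0[OF \<omega>]) auto
  qed
  then have "\<omega> p = 0" by (simp add: fun_eq_iff)
  then show False using nz by contradiction
qed

lemma forms_wedge_power_left:
  assumes U: "openin M U" and t: "\<theta> \<in> forms A U 1" and w: "\<omega> \<in> forms A U 2"
  shows "wedge_power_left 1 \<theta> 2 \<omega> m \<in> forms A U (1 + m * 2)"
proof (induction m)
  case 0
  then show ?case using t by simp
next
  case (Suc m)
  show ?case using forms_wedge[OF U Suc w] by (simp add: add_ac)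
qed

text \<open>Cofactors of the same generator add up. The degree is a variable constrained by an
  equation, as the induction over \<open>ideal_gen\<close> requires.\<close>

lemma ideal_gen_decomposition:
  assumes U: "openin M U"
  shows "ideal_gen A U {(1, \<theta>), (2, \<tau>)} k \<omega> \<Longrightarrow> k = Suc (Suc m) \<Longrightarrow>
    \<exists>\<alpha>\<in>forms A U (Suc m). \<exists>\<beta>\<in>forms A U m. \<omega> = wedge 1 (Suc m) \<theta> \<alpha> + wedge 2 m \<tau> \<beta>"
proof (induction rule: ideal_gen.induct)
  case (zero k)
  show ?case
    by (rule bexI[OF _ forms_0[OF U]], rule bexI[OF _ forms_0[OF U]]) (simp only: wedge_0_right add_0)
next
  case (mult j s \<alpha> l)
  consider "j = 1" "s = \<theta>" | "j = 2" "s = \<tau>" using mult.hyps(1) by auto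
  then show ?case
  proof cases
    case 1
    then have l: "l = Suc m" using mult.prems by simp
    have "\<alpha> \<in> forms A U (Suc m)" using mult.hyps(2) l by simp
    moreover have "wedge j l s \<alpha> = wedge 1 (Suc m) \<theta> \<alpha> + wedge 2 m \<tau> 0"
      by (simp only: wedge_0_right add_0_right 1 l)
    ultimately show ?thesis using forms_0[OF U] by blast
  next
    case 2
    then have l: "l = m" using mult.prems by simp
    have "\<alpha> \<in> forms A U m" using mult.hyps(2) l by simp
    moreover have "wedge j l s \<alpha> = wedge 1 (Suc m) \<theta> 0 + wedge 2 m \<tau> \<alpha>"
      by (simp only: wedge_0_right add_0 2 l)
    ultimately show ?thesis using forms_0[OF U] by blast
  qed
next
  case (add k \<omega> \<eta>)
  then obtain \<alpha> \<beta> \<alpha>' \<beta>' where *: "\<alpha> \<in> forms A U (Suc m)" "\<beta> \<in> forms A U m" "\<alpha>' \<in> forms A U (Suc m)" "\<beta>' \<in> forms A U m"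
    "\<omega> = wedge 1 (Suc m) \<theta> \<alpha> + wedge 2 m \<tau> \<beta>" "\<eta> = wedge 1 (Suc m) \<theta> \<alpha>' + wedge 2 m \<tau> \<beta>'"
    by blast
  have "\<omega> + \<eta> = wedge 1 (Suc m) \<theta> (\<alpha> + \<alpha>') + wedge 2 m \<tau> (\<beta> + \<beta>')"
    unfolding wedge_add_right * by (simp only: ac_simps)
  then show ?case using forms_add[OF U *(1,3)] forms_add[OF U *(2,4)] by blast
qed

end

locale contact = manifold M A for M :: "'m topology" and A :: "('m, 'e::euclidean_space) chart set" +
  fixes I :: "'m \<Rightarrow> ('m, 'e) covec set" and n :: nat
  assumes contact_manifold: "contact_manifold M A n I"
begin

lemma contact_formD:
  assumes "\<theta> \<in> contact_forms A I U"
  shows "\<theta> \<in> forms A U 1" "\<theta> \<in> sections A I U" "p \<in> U \<Longrightarrow> \<theta> p \<noteq> 0"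
  using assms by (auto simp: contact_forms_def sections_def)

text \<open>The fibre at \<open>p\<close> is a line, spanned by the nonzero element
  \<open>\<theta> p\<close>. The factor is common to all charts.\<close>

lemma sections_multiple:
  assumes U: "openin M U" and t: "\<theta> \<in> contact_forms A I U" and s: "s \<in> sections A I U'"
    and p: "p \<in> U" "p \<in> U'"
  obtains r where "\<And>c. s p c = (\<lambda>v. r * \<theta> p c v)"
proof -
  have pM: "p \<in> topspace M" using openin_subset[OF U] p by auto
  have "line_subbundle M A I" using contact_manifold by (simp add: contact_manifold_def)
  from this[unfolded line_subbundle_def, THEN bspec, OF pM]
  obtain V \<eta> where "p \<in> V" "\<forall>q\<in>V. \<eta> q \<noteq> 0 \<and> I q = {\<lambda>c v. r * \<eta> q c v | r. r \<in> UNIV}"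
    by (elim exE conjE) (rule that)
  then have I: "I p = {\<lambda>c v. r * \<eta> p c v | r. r \<in> UNIV}" by simp
  have "\<theta> p \<in> I p" "s p \<in> I p"
    using contact_formD(2)[OF t] s p by (auto simp: sections_def)
  then obtain r0 r1 where r: "\<theta> p = (\<lambda>c v. r0 * \<eta> p c v)" "s p = (\<lambda>c v. r1 * \<eta> p c v)"
    unfolding I by blast
  have "r0 \<noteq> 0" using contact_formD(3)[OF t p(1)] r(1) by (auto simp: fun_eq_iff)
  then have "s p c = (\<lambda>v. (r1 / r0) * \<theta> p c v)" for c by (simp add: r)
  then show thesis by (rule that)
qed

lemma forms_ext_deriv_1:
  "openin M U \<Longrightarrow> \<theta> \<in> forms A U 1 \<Longrightarrow> ext_deriv A U 1 \<theta> \<in> forms A U 2"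
  using forms_ext_deriv[of U \<theta> 1] by (simp add: numeral_2_eq_2)

text \<open>The contact condition says that the family of components at \<open>p\<close> is nonzero;
  \<open>forms_nonzero_chart\<close> carries this over to the chart \<open>c\<close>.\<close>

lemma wedge_pow_nonzero:
  assumes U: "openin M U" and t: "\<theta> \<in> contact_forms A I U" and p: "p \<in> U" "c \<in> A" "p \<in> fst c"
  shows "wedge_pow (\<theta> p c) (ext_deriv A U 1 \<theta> p c) n \<noteq> (\<lambda>_. 0)"
proof -
  have "wedge_power_left 1 \<theta> 2 (ext_deriv A U 1 \<theta>) n p \<noteq> 0"
    using contact_manifold U t p(1) unfolding contact_manifold_def by blast
  then show ?thesis
    using forms_nonzero_chart[OF forms_wedge_power_left[OF U contact_formD(1)[OF t]
          forms_ext_deriv_1[OF U contact_formD(1)[OF t]]] p]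
    by (simp only: wedge_power_left_eq_wedge_pow)
qed

text \<open>A contact form annihilates the multiples of every section of the line bundle, so contact
  forms from different open sets may be mixed.\<close>

lemma wedge_section_0:
  assumes U: "openin M U" and t: "\<theta> \<in> contact_forms A I U" and s: "s \<in> sections A I U'"
    and p: "p \<in> U" "p \<in> U'"
  shows "mform_wedge 1 (Suc l) (\<theta> p c) (mform_wedge 1 l (s p c) a) v = 0"
proof -
  obtain r where r: "s p c = (\<lambda>v. r * \<theta> p c v)" using sections_multiple[OF U t s p] by metis
  have "mform_wedge 1 l (s p c) a = (\<lambda>v. r * mform_wedge 1 l (\<theta> p c) a v)"
    unfolding r mform_wedge_scale_left ..
  then show ?thesis
    by (simp only: mform_wedge_scale_right wedge_1_self[OF forms_alternating'[OF contact_formD(1)[OF t]]])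
qed

text \<open>This is where the contact condition enters. On the overlap \<open>\<theta>' = f \<theta>\<close>, hence
  \<open>\<theta> \<and> d\<theta>' = f \<theta> \<and> d\<theta>\<close>, and the Lefschetz map applies to \<open>b - f b'\<close>.\<close>

lemma wedge_eqI:
  assumes U: "openin M U" "\<theta> \<in> contact_forms A I U" and U': "openin M U'" "\<theta>' \<in> contact_forms A I U'"
    and p: "p \<in> U" "p \<in> U'" "c \<in> A" "p \<in> fst c" and k: "k < n"
    and b: "alternating k b" and b': "alternating k b'"
    and eq: "\<And>v. mform_wedge 1 (Suc (Suc k)) (\<theta> p c) (mform_wedge 2 k (ext_deriv A U 1 \<theta> p c) b) v
      = mform_wedge 1 (Suc (Suc k)) (\<theta> p c) (mform_wedge 2 k (ext_deriv A U' 1 \<theta>' p c) b') v"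
  shows "mform_wedge 1 k (\<theta> p c) b v = mform_wedge 1 k (\<theta>' p c) b' v"
proof -
  define t w w' where "t = \<theta> p c" and "w = ext_deriv A U 1 \<theta> p c" and "w' = ext_deriv A U' 1 \<theta>' p c"
  define S where "S = snd c ` (U \<inter> U' \<inter> fst c)"
  note th = contact_formD(1)[OF U(2)] and th' = contact_formD(1)[OF U'(2)]
  have t: "alternating 1 t" unfolding t_def by (rule forms_alternating'[OF th])
  have w: "alternating 2 w" unfolding w_def
    by (rule forms_alternating'[OF forms_ext_deriv_1[OF U(1) th]])
  have S: "open S" unfolding S_def by (intro open_chart_image p openin_Int U U')
  have f: "form_field S 1 (rep c \<theta>)"
    by (rule form_field_mono[OF form_field_rep[OF th U(1) p(3)] S]) (auto simp: S_def)
  have f': "form_field S 1 (rep c \<theta>')"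
    by (rule form_field_mono[OF form_field_rep[OF th' U'(1) p(3)] S]) (auto simp: S_def)
  have x: "snd c p \<in> S" using p by (auto simp: S_def)
  have nz: "rep c \<theta> (snd c p) \<noteq> (\<lambda>_. 0)"
    unfolding rep_chart[OF p(3,4)] using forms_nonzero_chart[OF th p(1,3,4) contact_formD(3)[OF U(2) p(1)]] .
  have mult: "\<exists>r. \<forall>v. rep c \<theta>' y v = r * rep c \<theta> y v" if y: "y \<in> S" for y
  proof -
    obtain q where q: "q \<in> U" "q \<in> U'" "q \<in> fst c" "y = snd c q" using y by (auto simp: S_def)
    obtain r where "\<theta>' q c = (\<lambda>v. r * \<theta> q c v)"
      using sections_multiple[OF U contact_formD(2)[OF U'(2)] q(1,2)] by metis
    then show ?thesis unfolding q(4) rep_chart[OF p(3) q(3)] by auto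
  qed
  obtain r \<eta> where \<eta>: "alternating 1 \<eta>"
    and r: "rep c \<theta>' (snd c p) = (\<lambda>v. r * rep c \<theta> (snd c p) v)"
    and w': "coord_deriv 1 (rep c \<theta>') (snd c p) =
      (\<lambda>v. mform_wedge 1 1 \<eta> (rep c \<theta> (snd c p)) v + r * coord_deriv 1 (rep c \<theta>) (snd c p) v)"
    by (rule coord_deriv_multiple[OF f f' x nz mult])
  have r: "\<theta>' p c = (\<lambda>v. r * t v)"
    using r unfolding rep_chart[OF p(3,4)] t_def .
  have w': "w' = (\<lambda>v. mform_wedge 1 1 \<eta> t v + r * w v)"
    using w' unfolding t_def w_def w'_def ext_deriv_eq[OF p(1,3,4)] ext_deriv_eq[OF p(2,3,4)] rep_chart[OF p(3,4)] .
  have "mform_wedge 2 k (mform_wedge 1 1 \<eta> t) b' = mform_wedge 1 (Suc k) \<eta> (mform_wedge 1 k t b')"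
    using mform_wedge_assoc[OF alternating_imp_multilinear[OF \<eta>], where l = 1 and m = k and b = t and c = b']
    by (simp only: plus_1_eq_Suc Suc_1)
  then have "mform_wedge 2 k w' b' = (\<lambda>v. mform_wedge 1 (Suc k) \<eta> (mform_wedge 1 k t b') v + r * mform_wedge 2 k w b' v)"
    unfolding w' mform_wedge_add_left mform_wedge_scale_left by simp
  \<comment> \<open>Moving \<open>t\<close> past \<open>\<eta>\<close> produces a product of
    \<open>t\<close> with itself; so the term with the differential of the factor drops out.\<close>
  moreover have "mform_wedge 1 (Suc (Suc k)) t (mform_wedge 1 (Suc k) \<eta> (mform_wedge 1 k t b')) v = 0" for v
    unfolding wedge_1_anticommute[OF t \<eta>] wedge_1_self[OF t] mform_wedge_0_right by simp
  ultimately have "mform_wedge 1 (Suc (Suc k)) t (mform_wedge 2 k w b) v =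
      r * mform_wedge 1 (Suc (Suc k)) t (mform_wedge 2 k w b') v" for v
    using eq[of v] unfolding t_def[symmetric] w_def[symmetric] w'_def[symmetric]
    by (simp only: mform_wedge_add_right mform_wedge_scale_right add_0)
  then have 0: "mform_wedge 1 (2 + k) t (mform_wedge 2 k w (\<lambda>v. b v + (- r) * b' v)) v = 0" for v
    unfolding mform_wedge_add_right mform_wedge_scale_right by simp
  have "mform_wedge 1 k t (\<lambda>v. b v + (- r) * b' v) v = 0"
    by (rule lefschetz_injective[OF t w _ k _ 0])
      (use wedge_pow_nonzero[OF U p(1,3,4)] in \<open>simp_all only: t_def w_def not_False_eq_True alternating_add[OF b alternating_scale[OF b']]\<close>)
  then show ?thesis
    unfolding t_def[symmetric] r mform_wedge_add_right mform_wedge_scale_right mform_wedge_scale_left by simp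
qed

section \<open>Local decompositions of elements of the contact ideal\<close>

definition decomposition where
  "decomposition m \<omega> U \<theta> \<alpha> \<beta> \<longleftrightarrow> openin M U \<and> \<theta> \<in> contact_forms A I U \<and>
     \<alpha> \<in> forms A U (Suc m) \<and> \<beta> \<in> forms A U m \<and>
     restrict_form U \<omega> = wedge 1 (Suc m) \<theta> \<alpha> + wedge 2 m (ext_deriv A U 1 \<theta>) \<beta>"

lemma decompositionD:
  assumes "decomposition m \<omega> U \<theta> \<alpha> \<beta>"
  shows "openin M U" "\<theta> \<in> contact_forms A I U" "\<alpha> \<in> forms A U (Suc m)" "\<beta> \<in> forms A U m"
    "restrict_form U \<omega> = wedge 1 (Suc m) \<theta> \<alpha> + wedge 2 m (ext_deriv A U 1 \<theta>) \<beta>"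
  using assms by (auto simp: decomposition_def)

lemma contact_ideal_decomposition:
  assumes "\<omega> \<in> contact_ideal M A I (Suc (Suc m))" "p \<in> topspace M"
  shows "\<exists>U \<theta> \<alpha> \<beta>. p \<in> U \<and> decomposition m \<omega> U \<theta> \<alpha> \<beta>"
proof -
  obtain U \<theta> where U: "openin M U" "p \<in> U" "\<theta> \<in> contact_forms A I U"
    "ideal_gen A U {(1, \<theta>), (2, ext_deriv A U 1 \<theta>)} (Suc (Suc m)) (restrict_form U \<omega>)"
    using assms unfolding contact_ideal_def by blast
  then show ?thesis
    using ideal_gen_decomposition[OF U(1,4) refl] unfolding decomposition_def by blast
qed

text \<open>\<open>\<theta>'\<close> annihilates the multiple of \<open>\<theta>\<close> even if it
  comes from another open set, so different decompositions can be compared after multiplication by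
  one contact form.\<close>

lemma contact_form_wedge_decomposition:
  assumes dec: "decomposition m \<omega> U \<theta> \<alpha> \<beta>" and q: "q \<in> U" "q \<in> U'"
    and U': "openin M U'" "\<theta>' \<in> contact_forms A I U'"
  shows "mform_wedge 1 (Suc (Suc m)) (\<theta>' q c) (\<omega> q c) v =
    mform_wedge 1 (Suc (Suc m)) (\<theta>' q c) (mform_wedge 2 m (ext_deriv A U 1 \<theta> q c) (\<beta> q c)) v"
proof -
  have "\<omega> q = restrict_form U \<omega> q" using q by (simp add: restrict_form_def)
  then have "\<omega> q c = (\<lambda>v. mform_wedge 1 (Suc m) (\<theta> q c) (\<alpha> q c) v +
      mform_wedge 2 m (ext_deriv A U 1 \<theta> q c) (\<beta> q c) v)"
    unfolding decompositionD(5)[OF dec] wedge_def func_plus by simp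
  then show ?thesis
    by (simp only: mform_wedge_add_right
        wedge_section_0[OF U' contact_formD(2)[OF decompositionD(2)[OF dec]] q(2,1)] add_0)
qed

text \<open>Multiplied by \<open>\<theta>\<close>, the two terms d\<theta> \<and> \<beta> and
  d\<theta>' \<and> \<beta>' both give \<theta> \<and> \<omega>, which is the hypothesis of
  \<open>wedge_eqI\<close>.\<close>

lemma wedge_decomposition_unique:
  assumes 1: "decomposition m \<omega> U \<theta> \<alpha> \<beta>" and 2: "decomposition m \<omega> U' \<theta>' \<alpha>' \<beta>'"
    and p: "p \<in> U" "p \<in> U'" and m: "m < n"
  shows "wedge 1 m \<theta> \<beta> p = wedge 1 m \<theta>' \<beta>' p"
proof (intro ext)
  fix c v
  note 1 = 1 decompositionD[OF 1] and 2 = 2 decompositionD[OF 2]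
  show "wedge 1 m \<theta> \<beta> p c v = wedge 1 m \<theta>' \<beta>' p c v"
  proof (cases "c \<in> A \<and> p \<in> fst c")
    case True
    then show ?thesis
      unfolding wedge_def
      by (intro wedge_eqI[OF 1(2,3) 2(2,3) p _ _ m] forms_alternating'[OF 1(5)] forms_alternating'[OF 2(5)])
        (auto simp only: contact_form_wedge_decomposition[OF 1(1) p(1,1) 1(2,3), symmetric]
          contact_form_wedge_decomposition[OF 2(1) p(2,1) 1(2,3), symmetric])
  next
    case False
    then have "\<theta> p c = (\<lambda>v. 0)" "\<theta>' p c = (\<lambda>v. 0)"
      using forms_eq_0[OF contact_formD(1)[OF 1(3)]] forms_eq_0[OF contact_formD(1)[OF 2(3)]] by blast+
    then show ?thesis by (simp add: wedge_def mform_wedge_0_left)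
  qed
qed

text \<open>The correction \<open>\<phi>\<close> is \<open>\<theta> \<and> \<beta>\<close> in terms of a local decomposition
  \<open>\<omega> = \<theta> \<and> \<alpha> + d\<theta> \<and> \<beta>\<close>.\<close>

lemma correction_exists:
  assumes \<omega>: "\<omega> \<in> contact_ideal M A I (Suc (Suc m))" and m: "m < n"
  obtains \<phi> where "\<phi> \<in> contact_ideal M A I (Suc m)"
    "\<And>p. p \<in> topspace M \<Longrightarrow> \<exists>U \<theta> \<gamma>. openin M U \<and> p \<in> U \<and> \<theta> \<in> contact_forms A I U \<and> \<gamma> \<in> forms A U (Suc m) \<and>
      restrict_form U (\<omega> - ext_deriv A (topspace M) (Suc m) \<phi>) = wedge 1 (Suc m) \<theta> \<gamma>"
proof -
  define P where "P p = (\<lambda>(U, \<theta>, \<alpha>, \<beta>). p \<in> U \<and> decomposition m \<omega> U \<theta> \<alpha> \<beta>)" for p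
  \<comment> \<open>An arbitrary decomposition is chosen at every point; by uniqueness the choice
    does not affect the value of \<open>\<phi>\<close>.\<close>
  define ch where "ch p = (SOME x. P p x)" for p
  have ch: "P p (ch p)" if "p \<in> topspace M" for p
  proof -
    have "\<exists>x. P p x" using contact_ideal_decomposition[OF \<omega> that] by (auto simp: P_def)
    then show ?thesis unfolding ch_def by (rule someI_ex)
  qed
  define \<phi> where "\<phi> p = (if p \<in> topspace M then case ch p of (U, \<theta>, \<alpha>, \<beta>) \<Rightarrow> wedge 1 m \<theta> \<beta> p else 0)" for p
  \<comment> \<open>This holds on all of \<open>U\<close> and for every decomposition, which makes
    \<open>\<phi>\<close> smooth and lets it be differentiated locally.\<close>
  have \<phi>: "\<phi> q = wedge 1 m \<theta> \<beta> q" if dec: "decomposition m \<omega> U \<theta> \<alpha> \<beta>" and q: "q \<in> U" for U \<theta> \<alpha> \<beta> q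
  proof -
    have qM: "q \<in> topspace M" using q openin_subset[OF decompositionD(1)[OF dec]] by auto
    obtain U' \<theta>' \<alpha>' \<beta>' where c: "ch q = (U', \<theta>', \<alpha>', \<beta>')" by (metis prod.exhaust)
    then have "q \<in> U'" "decomposition m \<omega> U' \<theta>' \<alpha>' \<beta>'" using ch[OF qM] by (auto simp: P_def)
    then show ?thesis
      using wedge_decomposition_unique[OF _ dec _ q m] qM c by (simp add: \<phi>_def)
  qed
  have wf: "wedge 1 m \<theta> \<beta> \<in> forms A U (Suc m)" if dec: "decomposition m \<omega> U \<theta> \<alpha> \<beta>" for U \<theta> \<alpha> \<beta>
    using forms_wedge[OF decompositionD(1)[OF dec] contact_formD(1)[OF decompositionD(2)[OF dec]] decompositionD(4)[OF dec]]
    by simp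
  have "\<phi> \<in> forms A (topspace M) (Suc m)"
  proof (rule forms_glue)
    fix p assume "p \<in> topspace M"
    from contact_ideal_decomposition[OF \<omega> this] obtain U \<theta> \<alpha> \<beta> where
      U: "p \<in> U" "decomposition m \<omega> U \<theta> \<alpha> \<beta>" by blast
    then show "\<exists>U \<alpha>. openin M U \<and> p \<in> U \<and> \<alpha> \<in> forms A U (Suc m) \<and> (\<forall>q\<in>U. \<phi> q = \<alpha> q)"
      using decompositionD(1)[OF U(2)] wf[OF U(2)] \<phi>[OF U(2)] by blast
  qed (simp add: \<phi>_def)
  moreover have "restrict_form U \<phi> = wedge 1 m \<theta> \<beta>" if dec: "decomposition m \<omega> U \<theta> \<alpha> \<beta>" for U \<theta> \<alpha> \<beta>
  proof (rule ext)
    fix q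
    show "restrict_form U \<phi> q = wedge 1 m \<theta> \<beta> q"
      using \<phi>[OF dec, of q] forms_eq_0[OF wf[OF dec], of q] by (cases "q \<in> U") (auto simp: restrict_form_def fun_eq_iff)
  qed
  moreover have "\<exists>U \<theta>. openin M U \<and> p \<in> U \<and> \<theta> \<in> contact_forms A I U \<and>
      ideal_gen A U {(1, \<theta>), (2, ext_deriv A U 1 \<theta>)} (Suc m) (restrict_form U \<phi>)" if p: "p \<in> topspace M" for p
  proof -
    obtain U \<theta> \<alpha> \<beta> where U: "p \<in> U" "decomposition m \<omega> U \<theta> \<alpha> \<beta>"
      using contact_ideal_decomposition[OF \<omega> p] by blast
    have "ideal_gen A U {(1, \<theta>), (2, ext_deriv A U 1 \<theta>)} (1 + m) (wedge 1 m \<theta> \<beta>)"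
      by (rule ideal_gen.mult) (use decompositionD(4)[OF U(2)] in simp_all)
    then show ?thesis
      unfolding calculation(2)[OF U(2), symmetric] plus_1_eq_Suc using U(1) decompositionD(1,2)[OF U(2)] by blast
  qed
  ultimately have "\<phi> \<in> contact_ideal M A I (Suc m)" by (simp add: contact_ideal_def)
  moreover have "\<exists>U \<theta> \<gamma>. openin M U \<and> p \<in> U \<and> \<theta> \<in> contact_forms A I U \<and> \<gamma> \<in> forms A U (Suc m) \<and>
      restrict_form U (\<omega> - ext_deriv A (topspace M) (Suc m) \<phi>) = wedge 1 (Suc m) \<theta> \<gamma>" if p: "p \<in> topspace M" for p
  proof -
    obtain U \<theta> \<alpha> \<beta> where U: "p \<in> U" "decomposition m \<omega> U \<theta> \<alpha> \<beta>"
      using contact_ideal_decomposition[OF \<omega> p] by blast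
    note dec = decompositionD[OF U(2)]
    have g: "\<alpha> + ext_deriv A U m \<beta> \<in> forms A U (Suc m)"
      by (intro forms_add forms_ext_deriv dec)
    have "restrict_form U (\<omega> - ext_deriv A (topspace M) (Suc m) \<phi>) = restrict_form U \<omega> - ext_deriv A U (Suc m) (wedge 1 m \<theta> \<beta>)"
    proof
      fix q
      show "restrict_form U (\<omega> - ext_deriv A (topspace M) (Suc m) \<phi>) q = (restrict_form U \<omega> - ext_deriv A U (Suc m) (wedge 1 m \<theta> \<beta>)) q"
      proof (cases "q \<in> U")
        case True
        have "ext_deriv A (topspace M) (Suc m) \<phi> q = ext_deriv A U (Suc m) (wedge 1 m \<theta> \<beta>) q"
          by (rule ext_deriv_local[OF dec(1) True openin_subset[OF dec(1)] subset_refl \<phi>[OF U(2)]])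
        then show ?thesis using True by (simp add: restrict_form_def)
      next
        case False
        have "ext_deriv A U (Suc m) (wedge 1 m \<theta> \<beta>) q c v = 0" for c v
          using ext_deriv_eq_0[of q U c] False by simp
        then show ?thesis using False by (simp add: restrict_form_def fun_eq_iff)
      qed
    qed
    also have "\<dots> = wedge 1 (Suc m) \<theta> (\<alpha> + ext_deriv A U m \<beta>)"
      unfolding ext_deriv_wedge_1[OF dec(1) contact_formD(1)[OF dec(2)] dec(4)] dec(5) wedge_add_right
      by (simp add: fun_eq_iff)
    finally show ?thesis using U(1) dec(1,2) g by blast
  qed
  ultimately show thesis by (rule that)
qed

text \<open>From \<theta> \<and> \<omega> = 0 follows \<theta> \<and> \<beta> = 0 by injectivity.
  Differentiating this gives d\<theta> \<and> \<beta> = \<theta> \<and> d\<beta>, hence the smooth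
  cofactor \<alpha> + d\<beta> of \<theta>.\<close>

lemma line_ideal_iff:
  assumes \<omega>: "\<omega> \<in> contact_ideal M A I (Suc (Suc m))" and m: "m < n"
  shows "(\<forall>U \<theta>. openin M U \<and> \<theta> \<in> contact_forms A I U \<longrightarrow> wedge 1 (Suc (Suc m)) \<theta> (restrict_form U \<omega>) = 0)
    \<longleftrightarrow> \<omega> \<in> line_ideal M A I (Suc (Suc m))"
proof
  assume 0: "\<forall>U \<theta>. openin M U \<and> \<theta> \<in> contact_forms A I U \<longrightarrow> wedge 1 (Suc (Suc m)) \<theta> (restrict_form U \<omega>) = 0"
  have "\<exists>U. openin M U \<and> p \<in> U \<and> ideal_gen A U {(1, s) | s. s \<in> sections A I U} (Suc (Suc m)) (restrict_form U \<omega>)"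
    if p: "p \<in> topspace M" for p
  proof -
    obtain U \<theta> \<alpha> \<beta> where U: "p \<in> U" "decomposition m \<omega> U \<theta> \<alpha> \<beta>"
      using contact_ideal_decomposition[OF \<omega> p] by blast
    note dec = decompositionD[OF U(2)]
    have "wedge 1 m \<theta> \<beta> q c v = 0" for q c v
    proof (cases "q \<in> U \<and> c \<in> A \<and> q \<in> fst c")
      case True
      then have q: "q \<in> U" "c \<in> A" "q \<in> fst c" by auto
      \<comment> \<open>Comparison with the cofactor 0 over the same contact form.\<close>
      have "mform_wedge 1 m (\<theta> q c) (\<beta> q c) v = mform_wedge 1 m (\<theta> q c) (\<lambda>v. 0) v"
      proof (rule wedge_eqI[OF dec(1,2) dec(1,2) q(1,1,2,3) m forms_alternating'[OF dec(4)] alternating_0])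
        fix v
        have "wedge 1 (Suc (Suc m)) \<theta> (restrict_form U \<omega>) q c v = 0"
          using 0 dec(1,2) by simp
        then have "mform_wedge 1 (Suc (Suc m)) (\<theta> q c) (\<omega> q c) v = 0"
          using q(1) by (simp add: wedge_def restrict_form_def)
        then show "mform_wedge 1 (Suc (Suc m)) (\<theta> q c) (mform_wedge 2 m (ext_deriv A U 1 \<theta> q c) (\<beta> q c)) v =
            mform_wedge 1 (Suc (Suc m)) (\<theta> q c) (mform_wedge 2 m (ext_deriv A U 1 \<theta> q c) (\<lambda>v. 0)) v"
          unfolding contact_form_wedge_decomposition[OF U(2) q(1,1) dec(1,2)] mform_wedge_0_right .
      qed
      then show ?thesis by (simp only: wedge_def mform_wedge_0_right)
    next
      case False
      then have "\<theta> q c = (\<lambda>v. 0)" using forms_eq_0[OF contact_formD(1)[OF dec(2)]] by blast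
      then show ?thesis by (simp add: wedge_def mform_wedge_0_left)
    qed
    then have w0: "wedge 1 m \<theta> \<beta> = 0" by (simp add: fun_eq_iff)
    have "ext_deriv A U (Suc m) 0 = 0"
      using ext_deriv_diff[OF dec(1) forms_0[OF dec(1)] forms_0[OF dec(1)], of "Suc m"] by simp
    then have "wedge 2 m (ext_deriv A U 1 \<theta>) \<beta> = wedge 1 (Suc m) \<theta> (ext_deriv A U m \<beta>)"
      using ext_deriv_wedge_1[OF dec(1) contact_formD(1)[OF dec(2)] dec(4)] unfolding w0 by (simp add: fun_eq_iff)
    then have eq: "restrict_form U \<omega> = wedge 1 (Suc m) \<theta> (\<alpha> + ext_deriv A U m \<beta>)"
      unfolding dec(5) wedge_add_right by simp
    have "ideal_gen A U {(1, s) | s. s \<in> sections A I U} (1 + Suc m) (wedge 1 (Suc m) \<theta> (\<alpha> + ext_deriv A U m \<beta>))"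
      by (rule ideal_gen.mult) (use contact_formD(2)[OF dec(2)] forms_add[OF dec(1,3) forms_ext_deriv[OF dec(1,4)]] in auto)
    then show ?thesis unfolding eq[symmetric] plus_1_eq_Suc using dec(1) U(1) by blast
  qed
  then show "\<omega> \<in> line_ideal M A I (Suc (Suc m))"
    using \<omega> by (simp add: line_ideal_def contact_ideal_def)
next
  assume \<omega>': "\<omega> \<in> line_ideal M A I (Suc (Suc m))"
  show "\<forall>U \<theta>. openin M U \<and> \<theta> \<in> contact_forms A I U \<longrightarrow> wedge 1 (Suc (Suc m)) \<theta> (restrict_form U \<omega>) = 0"
  proof (intro allI impI ext, elim conjE)
    fix U \<theta> p c v assume U: "openin M U" "\<theta> \<in> contact_forms A I U"
    show "wedge 1 (Suc (Suc m)) \<theta> (restrict_form U \<omega>) p c v = 0 p c v"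
    proof (cases "p \<in> U")
      case True
      then have "p \<in> topspace M" using openin_subset[OF U(1)] by auto
      then obtain V where V: "p \<in> V" "ideal_gen A V {(1, s) | s. s \<in> sections A I V} (Suc (Suc m)) (restrict_form V \<omega>)"
        using \<omega>' unfolding line_ideal_def by blast
      \<comment> \<open>All generators are sections of the line bundle, and \<open>\<theta>\<close>
        annihilates their multiples.\<close>
      have gen: "ideal_gen A V {(1, s) | s. s \<in> sections A I V} k \<eta> \<Longrightarrow> mform_wedge 1 k (\<theta> p c) (\<eta> p c) v = 0" for k \<eta>
      proof (induction rule: ideal_gen.induct)
        case (zero k)
        then show ?case unfolding func_zero by (rule mform_wedge_0_right)
      next
        case (mult j s \<alpha> l)
        then have s: "s \<in> sections A I V" and j: "j = 1" by auto
        show ?case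
          unfolding wedge_def j plus_1_eq_Suc by (rule wedge_section_0[OF U s True V(1)])
      next
        case (add k \<omega> \<eta>)
        then show ?case unfolding func_plus mform_wedge_add_right by simp
      qed
      show ?thesis using gen[OF V(2)] True V(1) by (simp add: wedge_def restrict_form_def)
    next
      case False
      then show ?thesis by (simp add: wedge_def restrict_form_def mform_wedge_0_right func_zero)
    qed
  qed
qed

text \<open>The exact part of \<open>\<phi>\<close> is d(\<theta> \<and> \<gamma>), and the
  remaining cofactor of \<theta> is \<alpha> + d\<gamma>.\<close>

lemma ext_deriv_decomposition:
  assumes dec: "decomposition m \<phi> U \<theta> \<alpha> \<gamma>" and q: "q \<in> U"
  shows "ext_deriv A (topspace M) (Suc (Suc m)) \<phi> q =
    ext_deriv A U (Suc (Suc m)) (wedge 1 (Suc m) \<theta> (\<alpha> + ext_deriv A U m \<gamma>)) q"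
proof -
  note d = decompositionD[OF dec]
  note th = contact_formD(1)[OF d(2)]
  define \<psi> where "\<psi> = wedge 1 (Suc m) \<theta> (\<alpha> + ext_deriv A U m \<gamma>)"
  have w: "wedge 1 m \<theta> \<gamma> \<in> forms A U (Suc m)" using forms_wedge[OF d(1) th d(4)] by simp
  have \<psi>: "\<psi> \<in> forms A U (Suc (Suc m))"
    unfolding \<psi>_def using forms_wedge[OF d(1) th forms_add[OF d(1,3) forms_ext_deriv[OF d(1,4)]]] by simp
  have "restrict_form U \<phi> = \<psi> + ext_deriv A U (Suc m) (wedge 1 m \<theta> \<gamma>)"
    unfolding \<psi>_def d(5) ext_deriv_wedge_1[OF d(1) th d(4)] wedge_add_right by (simp add: fun_eq_iff)
  then have "ext_deriv A U (Suc (Suc m)) (restrict_form U \<phi>) = ext_deriv A U (Suc (Suc m)) \<psi>"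
    using ext_deriv_add[OF d(1) \<psi> forms_ext_deriv[OF d(1) w]] ext_deriv_ext_deriv[OF d(1) w] by simp
  moreover have "ext_deriv A (topspace M) (Suc (Suc m)) \<phi> q = ext_deriv A U (Suc (Suc m)) (restrict_form U \<phi>) q"
    by (rule ext_deriv_local[OF d(1) q openin_subset[OF d(1)] subset_refl]) (simp add: restrict_form_def)
  ultimately show ?thesis by (simp add: \<psi>_def)
qed

text \<open>Two primitives are compared, each with its own contact form and cofactor; working with
  their difference would call for a common local decomposition. \<open>wedge_eqI\<close> admits
  different contact forms and yields \<theta> \<and> \<delta> = \<theta>' \<and> \<delta>'.\<close>

lemma ext_deriv_unique:
  assumes 1: "\<phi> \<in> contact_ideal M A I (Suc (Suc m))" and 2: "\<phi>' \<in> contact_ideal M A I (Suc (Suc m))"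
    and m: "Suc m < n"
    and 0: "\<And>U \<theta>. openin M U \<Longrightarrow> \<theta> \<in> contact_forms A I U \<Longrightarrow> wedge 1 (Suc (Suc (Suc m))) \<theta> (restrict_form U
      (ext_deriv A (topspace M) (Suc (Suc m)) \<phi> - ext_deriv A (topspace M) (Suc (Suc m)) \<phi>')) = 0"
  shows "ext_deriv A (topspace M) (Suc (Suc m)) \<phi> = ext_deriv A (topspace M) (Suc (Suc m)) \<phi>'"
proof
  fix p
  show "ext_deriv A (topspace M) (Suc (Suc m)) \<phi> p = ext_deriv A (topspace M) (Suc (Suc m)) \<phi>' p"
  proof (cases "p \<in> topspace M")
    case True
    obtain U \<theta> \<alpha> \<gamma> where U: "p \<in> U" "decomposition m \<phi> U \<theta> \<alpha> \<gamma>"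
      using contact_ideal_decomposition[OF 1 True] by blast
    obtain U' \<theta>' \<alpha>' \<gamma>' where U': "p \<in> U'" "decomposition m \<phi>' U' \<theta>' \<alpha>' \<gamma>'"
      using contact_ideal_decomposition[OF 2 True] by blast
    note d = decompositionD[OF U(2)] and d' = decompositionD[OF U'(2)]
    note th = contact_formD(1)[OF d(2)] and th' = contact_formD(1)[OF d'(2)]
    define \<delta> where "\<delta> = \<alpha> + ext_deriv A U m \<gamma>"
    define \<delta>' where "\<delta>' = \<alpha>' + ext_deriv A U' m \<gamma>'"
    have \<delta>: "\<delta> \<in> forms A U (Suc m)" unfolding \<delta>_def by (intro forms_add forms_ext_deriv d)
    have \<delta>': "\<delta>' \<in> forms A U' (Suc m)" unfolding \<delta>'_def by (intro forms_add forms_ext_deriv d')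
    have "wedge 1 (Suc m) \<theta> \<delta> q c v = wedge 1 (Suc m) \<theta>' \<delta>' q c v" if q: "q \<in> U" "q \<in> U'" for q c v
    proof (cases "c \<in> A \<and> q \<in> fst c")
      case True
      then have c: "c \<in> A" "q \<in> fst c" by auto
      have e: "ext_deriv A (topspace M) (Suc (Suc m)) \<phi> q = (wedge 2 (Suc m) (ext_deriv A U 1 \<theta>) \<delta> - wedge 1 (Suc (Suc m)) \<theta> (ext_deriv A U (Suc m) \<delta>)) q"
        unfolding ext_deriv_decomposition[OF U(2) q(1)] \<delta>_def[symmetric] ext_deriv_wedge_1[OF d(1) th \<delta>] ..
      have e': "ext_deriv A (topspace M) (Suc (Suc m)) \<phi>' q = (wedge 2 (Suc m) (ext_deriv A U' 1 \<theta>') \<delta>' - wedge 1 (Suc (Suc m)) \<theta>' (ext_deriv A U' (Suc m) \<delta>')) q"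
        unfolding ext_deriv_decomposition[OF U'(2) q(2)] \<delta>'_def[symmetric] ext_deriv_wedge_1[OF d'(1) th' \<delta>'] ..
      show ?thesis unfolding wedge_def
      proof (rule wedge_eqI[OF d(1,2) d'(1,2) q c m forms_alternating'[OF \<delta>] forms_alternating'[OF \<delta>']])
        fix v
        have "wedge 1 (Suc (Suc (Suc m))) \<theta> (restrict_form U (ext_deriv A (topspace M) (Suc (Suc m)) \<phi> - ext_deriv A (topspace M) (Suc (Suc m)) \<phi>')) q c v = 0"
          using 0[OF d(1,2)] by simp
        then have "mform_wedge 1 (Suc (Suc (Suc m))) (\<theta> q c)
            (\<lambda>v. ext_deriv A (topspace M) (Suc (Suc m)) \<phi> q c v - ext_deriv A (topspace M) (Suc (Suc m)) \<phi>' q c v) v = 0"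
          using q(1) by (simp add: wedge_def restrict_form_def fun_diff_def)
        \<comment> \<open>Multiplication by \<open>\<theta>\<close> removes the terms \<theta>
          \<and> d\<delta> and \<theta>' \<and> d\<delta>' of the two derivatives.\<close>
        then show "mform_wedge 1 (Suc (Suc (Suc m))) (\<theta> q c) (mform_wedge 2 (Suc m) (ext_deriv A U 1 \<theta> q c) (\<delta> q c)) v =
            mform_wedge 1 (Suc (Suc (Suc m))) (\<theta> q c) (mform_wedge 2 (Suc m) (ext_deriv A U' 1 \<theta>' q c) (\<delta>' q c)) v"
          unfolding e e' wedge_def minus_apply mform_wedge_diff_right
            wedge_section_0[OF d(1,2) contact_formD(2)[OF d(2)] q(1,1)]
            wedge_section_0[OF d(1,2) contact_formD(2)[OF d'(2)] q(1,2)] by simp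
      qed
    next
      case False
      then have "\<theta> q c = (\<lambda>v. 0)" "\<theta>' q c = (\<lambda>v. 0)"
        using forms_eq_0[OF th] forms_eq_0[OF th'] by blast+
      then show ?thesis by (simp add: wedge_def mform_wedge_0_left)
    qed
    then have "wedge 1 (Suc m) \<theta> \<delta> q = wedge 1 (Suc m) \<theta>' \<delta>' q" if "q \<in> U \<inter> U'" for q
      using that by blast
    \<comment> \<open>The two products agree on a neighbourhood of \<open>p\<close>, so their
      derivatives agree at \<open>p\<close>.\<close>
    then have "ext_deriv A U (Suc (Suc m)) (wedge 1 (Suc m) \<theta> \<delta>) p = ext_deriv A U' (Suc (Suc m)) (wedge 1 (Suc m) \<theta>' \<delta>') p"
      by (intro ext_deriv_local[OF openin_Int[OF d(1) d'(1)]]) (use U U' in auto)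
    then show ?thesis
      unfolding ext_deriv_decomposition[OF U(2,1)] ext_deriv_decomposition[OF U'(2,1)] \<delta>_def \<delta>'_def .
  next
    case False
    then show ?thesis using ext_deriv_eq_0[of p "topspace M"] by (metis ext)
  qed
qed

end

theorem theorem1p1:
  fixes M :: "'m topology"
    and A :: "('m, 'e::euclidean_space) chart set"
    and I :: "'m \<Rightarrow> ('m, 'e) covec set"
    and n :: nat
    and \<xi> :: "('m, 'e) dform set"
  assumes "contact_manifold M A n I"
    and "n \<ge> 2"
    and "\<xi> \<in> cohomology M A I (n + 1)"
  shows "(\<exists>!\<omega>. \<omega> \<in> \<xi> \<and> \<omega> \<in> contact_ideal M A I (n + 1) \<and>
            ext_deriv A (topspace M) (n + 1) \<omega> = 0 \<and>
            (\<forall>U \<theta>. openin M U \<and> \<theta> \<in> contact_forms A I U \<longrightarrow>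
               wedge 1 (n + 1) \<theta> (restrict_form U \<omega>) = 0)) \<and>
         (\<forall>\<omega>\<in>\<xi>.
            (\<forall>U \<theta>. openin M U \<and> \<theta> \<in> contact_forms A I U \<longrightarrow>
               wedge 1 (n + 1) \<theta> (restrict_form U \<omega>) = 0)
            \<longleftrightarrow> \<omega> \<in> line_ideal M A I (n + 1))"
proof -
  interpret contact M A I n
    using assms(1) by unfold_locales (simp_all add: contact_manifold_def)
  \<comment> \<open>In this indexing the class has degree m + 3, its primitives have degree m + 2,
    and the forms to which the Lefschetz map is applied have degree m + 1 = n - 1.\<close>
  obtain m where "n = m + 2" using assms(2) le_Suc_ex[of 2 n] by auto
  then have n: "n + 1 = Suc (Suc (Suc m))" and m: "Suc m < n" by auto
  have top: "openin M (topspace M)" by simp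
  obtain \<omega>0 where \<omega>0: "\<omega>0 \<in> cocycles M A I (Suc (Suc (Suc m)))"
    and \<xi>: "\<xi> = {\<eta> \<in> cocycles M A I (Suc (Suc (Suc m))). \<omega>0 - \<eta> \<in> coboundaries M A I (Suc (Suc (Suc m)))}"
    using assms(3) unfolding cohomology_def n quotient_def by auto
  have \<xi>_ideal: "\<omega> \<in> contact_ideal M A I (Suc (Suc (Suc m)))" if "\<omega> \<in> \<xi>" for \<omega>
    using that by (simp add: \<xi> cocycles_def)
  have \<omega>0_ideal: "\<omega>0 \<in> contact_ideal M A I (Suc (Suc (Suc m)))"
    and d\<omega>0: "ext_deriv A (topspace M) (Suc (Suc (Suc m))) \<omega>0 = 0"
    using \<omega>0 by (auto simp: cocycles_def)
  obtain \<phi> where \<phi>: "\<phi> \<in> contact_ideal M A I (Suc (Suc m))"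
    "\<And>p. p \<in> topspace M \<Longrightarrow> \<exists>U \<theta> \<gamma>. openin M U \<and> p \<in> U \<and> \<theta> \<in> contact_forms A I U \<and> \<gamma> \<in> forms A U (Suc (Suc m)) \<and>
      restrict_form U (\<omega>0 - ext_deriv A (topspace M) (Suc (Suc m)) \<phi>) = wedge 1 (Suc (Suc m)) \<theta> \<gamma>"
    using correction_exists[OF \<omega>0_ideal m] by blast
  define \<rho> where "\<rho> = \<omega>0 - ext_deriv A (topspace M) (Suc (Suc m)) \<phi>"
  have forms: "\<omega>0 \<in> forms A (topspace M) (Suc (Suc (Suc m)))" "\<phi> \<in> forms A (topspace M) (Suc (Suc m))"
    using \<omega>0_ideal \<phi>(1) by (auto simp: contact_ideal_def)
  note d\<phi> = forms_ext_deriv[OF top forms(2)]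
  have \<rho>_form: "\<rho> \<in> forms A (topspace M) (Suc (Suc (Suc m)))"
    unfolding \<rho>_def by (rule forms_diff[OF top forms(1) d\<phi>])
  \<comment> \<open>Membership is read off from the local form \<theta> \<and> \<gamma> of
    \<open>\<rho>\<close>, rather than from closure of the ideal under d.\<close>
  have \<rho>_ideal: "\<rho> \<in> contact_ideal M A I (Suc (Suc (Suc m)))"
    unfolding contact_ideal_def mem_Collect_eq
  proof (intro conjI ballI \<rho>_form)
    fix p assume "p \<in> topspace M"
    then obtain U \<theta> \<gamma> where U: "openin M U" "p \<in> U" "\<theta> \<in> contact_forms A I U" "\<gamma> \<in> forms A U (Suc (Suc m))"
      and eq: "restrict_form U \<rho> = wedge 1 (Suc (Suc m)) \<theta> \<gamma>"
      using \<phi>(2) unfolding \<rho>_def by blast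
    have "ideal_gen A U {(1, \<theta>), (2, ext_deriv A U 1 \<theta>)} (1 + Suc (Suc m)) (restrict_form U \<rho>)"
      unfolding eq by (rule ideal_gen.mult[OF _ U(4)]) simp
    then show "\<exists>U \<theta>. openin M U \<and> p \<in> U \<and> \<theta> \<in> contact_forms A I U \<and>
        ideal_gen A U {(1, \<theta>), (2, ext_deriv A U 1 \<theta>)} (Suc (Suc (Suc m))) (restrict_form U \<rho>)"
      using U unfolding plus_1_eq_Suc by blast
  qed
  have "\<rho> \<in> line_ideal M A I (Suc (Suc (Suc m)))"
    unfolding line_ideal_def mem_Collect_eq
  proof (intro conjI ballI \<rho>_form)
    fix p assume "p \<in> topspace M"
    then obtain U \<theta> \<gamma> where U: "openin M U" "p \<in> U" "\<theta> \<in> contact_forms A I U" "\<gamma> \<in> forms A U (Suc (Suc m))"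
      and eq: "restrict_form U \<rho> = wedge 1 (Suc (Suc m)) \<theta> \<gamma>"
      using \<phi>(2) unfolding \<rho>_def by blast
    have "ideal_gen A U {(1, s) | s. s \<in> sections A I U} (1 + Suc (Suc m)) (restrict_form U \<rho>)"
      unfolding eq by (rule ideal_gen.mult[OF _ U(4)]) (use contact_formD(2)[OF U(3)] in auto)
    then show "\<exists>U. openin M U \<and> p \<in> U \<and>
        ideal_gen A U {(1, s) | s. s \<in> sections A I U} (Suc (Suc (Suc m))) (restrict_form U \<rho>)"
      using U unfolding plus_1_eq_Suc by blast
  qed
  then have \<rho>_wedge: "\<forall>U \<theta>. openin M U \<and> \<theta> \<in> contact_forms A I U \<longrightarrow> wedge 1 (n + 1) \<theta> (restrict_form U \<rho>) = 0"
    using line_ideal_iff[OF \<rho>_ideal m] unfolding n by blast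
  have d\<rho>: "ext_deriv A (topspace M) (Suc (Suc (Suc m))) \<rho> = 0"
    unfolding \<rho>_def ext_deriv_diff[OF top forms(1) d\<phi>] d\<omega>0 ext_deriv_ext_deriv[OF top forms(2)]
    by simp
  have "\<omega>0 - \<rho> = ext_deriv A (topspace M) (Suc (Suc m)) \<phi>"
    unfolding \<rho>_def by (simp add: fun_eq_iff)
  then have \<rho>: "\<rho> \<in> \<xi>"
    using \<rho>_ideal d\<rho> \<phi>(1) by (auto simp: \<xi> cocycles_def coboundaries_def)
  have unique: "\<omega> = \<rho>" if \<omega>: "\<omega> \<in> \<xi>"
    and \<omega>_wedge: "\<forall>U \<theta>. openin M U \<and> \<theta> \<in> contact_forms A I U \<longrightarrow> wedge 1 (n + 1) \<theta> (restrict_form U \<omega>) = 0" for \<omega>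
  proof -
    obtain \<phi>' where \<phi>': "\<phi>' \<in> contact_ideal M A I (Suc (Suc m))"
      and eq': "\<omega>0 - \<omega> = ext_deriv A (topspace M) (Suc (Suc m)) \<phi>'"
      using \<omega> by (auto simp: \<xi> coboundaries_def)
    \<comment> \<open>Both representatives differ from \<open>\<omega>0\<close> by coboundaries, so
      their difference is the difference of the derivatives of two primitives.\<close>
    have diff: "ext_deriv A (topspace M) (Suc (Suc m)) \<phi> - ext_deriv A (topspace M) (Suc (Suc m)) \<phi>' = \<omega> - \<rho>"
      unfolding eq'[symmetric] \<rho>_def by (simp add: fun_eq_iff)
    have "ext_deriv A (topspace M) (Suc (Suc m)) \<phi> = ext_deriv A (topspace M) (Suc (Suc m)) \<phi>'"
    proof (rule ext_deriv_unique[OF \<phi>(1) \<phi>' m])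
      fix U \<theta> assume U: "openin M U" "\<theta> \<in> contact_forms A I U"
      have "restrict_form U (\<omega> - \<rho>) = restrict_form U \<omega> - restrict_form U \<rho>"
        by (simp add: restrict_form_def fun_eq_iff)
      moreover have "wedge 1 (n + 1) \<theta> (\<alpha> - \<beta>) = wedge 1 (n + 1) \<theta> \<alpha> - wedge 1 (n + 1) \<theta> \<beta>" for \<alpha> \<beta>
        unfolding wedge_def fun_diff_def mform_wedge_diff_right ..
      ultimately show "wedge 1 (Suc (Suc (Suc m))) \<theta> (restrict_form U
          (ext_deriv A (topspace M) (Suc (Suc m)) \<phi> - ext_deriv A (topspace M) (Suc (Suc m)) \<phi>')) = 0"
        unfolding diff n[symmetric] using U \<omega>_wedge \<rho>_wedge by simp
    qed
    then have "\<omega> - \<rho> = 0" using diff by simp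
    then show ?thesis by (simp add: fun_eq_iff)
  qed
  show ?thesis
  proof (rule conjI)
    show "\<exists>!\<omega>. \<omega> \<in> \<xi> \<and> \<omega> \<in> contact_ideal M A I (n + 1) \<and>
        ext_deriv A (topspace M) (n + 1) \<omega> = 0 \<and>
        (\<forall>U \<theta>. openin M U \<and> \<theta> \<in> contact_forms A I U \<longrightarrow> wedge 1 (n + 1) \<theta> (restrict_form U \<omega>) = 0)"
    proof (rule ex1I[of _ \<rho>])
      show "\<rho> \<in> \<xi> \<and> \<rho> \<in> contact_ideal M A I (n + 1) \<and> ext_deriv A (topspace M) (n + 1) \<rho> = 0 \<and>
          (\<forall>U \<theta>. openin M U \<and> \<theta> \<in> contact_forms A I U \<longrightarrow> wedge 1 (n + 1) \<theta> (restrict_form U \<rho>) = 0)"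
        by (intro conjI \<rho> \<rho>_wedge) (simp_all only: n \<rho>_ideal d\<rho>)
    qed (elim conjE, rule unique)
    show "\<forall>\<omega>\<in>\<xi>. (\<forall>U \<theta>. openin M U \<and> \<theta> \<in> contact_forms A I U \<longrightarrow>
        wedge 1 (n + 1) \<theta> (restrict_form U \<omega>) = 0) \<longleftrightarrow> \<omega> \<in> line_ideal M A I (n + 1)"
      unfolding n by (intro ballI line_ideal_iff[OF \<xi>_ideal m])
  qed
qed

end
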